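(* Let $0<m_1\le m_2$ and $0<n_1\le n_2$ be integers. Suppose the groups $\mathbb{G}(P_{m_1,m_2})$ and $\mathbb{G}(P_{n_1,n_2})$ are commensurable. Then $\frac{m_1}{n_1}=\frac{m_2}{n_2}$. In particular, there are infinitely many commensurability classes among RAAGs defined by trees of diameter 4.
   Context: For a finite simplicial graph $\Gamma$, $\mathbb{G}(\Gamma)$ is the right-angled Artin group (RAAG) with generators the vertices of $\Gamma$ and relations $[u,v]=1$ for each edge. Two groups are commensurable if they have isomorphic finite index subgroups. For integers $0<d_1\le d_2$, $P_{d_1,d_2}$ denotes the tree of diameter 4 consisting of a center vertex $c$ adjacent to exactly two vertices $p_1,p_2$, where $p_1$ is adjacent to $d_1$ further leaves and $p_2$ is adjacent to $d_2$ further leaves (and there are no other vertices). *)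

theory Defs
  imports "HOL-Algebra.Algebra"
begin

text \<open>Right-angled Artin group of a simplicial graph with vertex set V and
(symmetric, irreflexive) adjacency E.  Elements are equivalence classes of
words over the letters V x bool (True = generator, False = its inverse),
modulo free cancellation and commutation of adjacent generators.\<close>

definition raag_step :: "'a set \<Rightarrow> ('a \<Rightarrow> 'a \<Rightarrow> bool) \<Rightarrow> (('a \<times> bool) list \<times> ('a \<times> bool) list) set" where
  "raag_step V E =
     {(xs @ [(a, b), (a, \<not> b)] @ ys, xs @ ys) | xs ys a b.
        xs \<in> lists (V \<times> UNIV) \<and> ys \<in> lists (V \<times> UNIV) \<and> a \<in> V}
   \<union> {(xs @ [(a, b), (c, d)] @ ys, xs @ [(c, d), (a, b)] @ ys) | xs ys a b c d.
        xs \<in> lists (V \<times> UNIV) \<and> ys \<in> lists (V \<times> UNIV) \<and> a \<in> V \<and> c \<in> V \<and> E a c}"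

definition raag_rel :: "'a set \<Rightarrow> ('a \<Rightarrow> 'a \<Rightarrow> bool) \<Rightarrow> (('a \<times> bool) list \<times> ('a \<times> bool) list) set" where
  "raag_rel V E = Id_on (lists (V \<times> UNIV)) \<union> (raag_step V E \<union> (raag_step V E)\<inverse>)\<^sup>+"

definition RAAG :: "'a set \<Rightarrow> ('a \<Rightarrow> 'a \<Rightarrow> bool) \<Rightarrow> ('a \<times> bool) list set monoid" where
  "RAAG V E =
     \<lparr> carrier = lists (V \<times> UNIV) // raag_rel V E,
       monoid.mult = (\<lambda>A B. \<Union>x\<in>A. \<Union>y\<in>B. raag_rel V E `` {x @ y}),
       one = raag_rel V E `` {[]} \<rparr>"

text \<open>The tree P_{d1,d2} on vertices {0..d1+d2+2}: centre 0, p1 = 1, p2 = 2,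
leaves 3..d1+2 attached to 1 and leaves d1+3..d1+d2+2 attached to 2.\<close>

definition P_verts :: "nat \<Rightarrow> nat \<Rightarrow> nat set" where
  "P_verts d1 d2 = {0 .. d1 + d2 + 2}"

definition P_edge0 :: "nat \<Rightarrow> nat \<Rightarrow> nat \<Rightarrow> nat \<Rightarrow> bool" where
  "P_edge0 d1 d2 u v \<longleftrightarrow>
     (u = 0 \<and> v = 1) \<or> (u = 0 \<and> v = 2) \<or>
     (u = 1 \<and> 3 \<le> v \<and> v \<le> d1 + 2) \<or>
     (u = 2 \<and> d1 + 3 \<le> v \<and> v \<le> d1 + d2 + 2)"

definition P_edge :: "nat \<Rightarrow> nat \<Rightarrow> nat \<Rightarrow> nat \<Rightarrow> bool" where
  "P_edge d1 d2 u v \<longleftrightarrow> P_edge0 d1 d2 u v \<or> P_edge0 d1 d2 v u"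

definition RAAG_P :: "nat \<Rightarrow> nat \<Rightarrow> (nat \<times> bool) list set monoid" where
  "RAAG_P d1 d2 = RAAG (P_verts d1 d2) (P_edge d1 d2)"

definition commensurable :: "('a, 'c) monoid_scheme \<Rightarrow> ('b, 'd) monoid_scheme \<Rightarrow> bool" where
  "commensurable G H \<longleftrightarrow>
     (\<exists>A B. subgroup A G \<and> finite (rcosets\<^bsub>G\<^esub> A) \<and>
            subgroup B H \<and> finite (rcosets\<^bsub>H\<^esub> B) \<and>
            G\<lparr>carrier := A\<rparr> \<cong> H\<lparr>carrier := B\<rparr>)"

end

(* The group G of the tree P_{d1,d2} acts on the Bass-Serre tree whose vertices are the conjugates of
   the generators p_0 = c, p_1, p_2; the stabilizers are the centralizers C(p_i), and C(p_i)/<p_i> is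
   free of rank m_i + 1 with m_0 = 1, m_1 = d1, m_2 = d2.  The powers of the vertices are exactly the
   elements with nonabelian centralizer, so an isomorphism phi between finite index subgroups H < G and
   H' < G' induces an isomorphism sigma of the trees.  For a vertex v let z(v) be the index of
   H \<inter> <v> in <v> and rho(v) = z'(sigma v) / z(v).  Comparing Euler characteristics of
   the vertex groups gives m_i [C(v) : C_H(v)] rho(v) = m'_j [C(sigma v) : C_H'(sigma v)] for v of type i and
   sigma v of type j, and the edge groups, which are free abelian of rank 2, give
   [G_e : H_e] rho(v) rho(w) = [G'_e : H'_e].  Suppose sigma preserves the type of the centre.  With R_ij the
   sum of rho(g p_i g^-1) over the cosets Hg for which sigma(g p_i g^-1) has type j, summation over vertices
   gives m_1 R_1j + m_2 R_2j = m'_j [G' : H'], and summation over edges shows that R_1j + R_2j does not depend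
   on j.  Hence m'_2 / m'_1 <= m_2 / m_1, and equality follows by symmetry.  If sigma exchanges the centres with
   the other vertices, the same sums yield m'_1 = m'_2, and by symmetry m_1 = m_2. *)

theory Submission
  imports Defs
begin

text \<open>The structure of G is read off from a splitting G = K Q: Q is free on p_1 and p_2, K is
  free on c and all Q-conjugates of the leaves, and Q permutes this basis by conjugation.
  Centralizers can then be computed letter by letter on reduced words; this is the source of the
  claim about nonabelian centralizers. The tree occurs only as the set of conjugates of the p_i with
  commutation as adjacency, because both are visible in a subgroup of finite index up to passing to
  powers. Ranks of subgroups of the free groups C(v)/<v> are detected by counting homomorphisms to
  the group of order two, a number that an isomorphism of H \<inter> C(v) preserving H \<inter> <v>
  obviously preserves. The weights rho are forced by the centres: phi maps H \<inter> <v> onto H'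
  \<inter> <sigma v>, but the indices of these groups in <v> and <sigma v> are unrelated. Nothing
  prevents sigma from sending some vertices of type 1 to type 1 and others to type 2. Hence only the
  sums R_ij are available, a single comparison yields an inequality, and the equality needs both
  directions.\<close>

definition com :: "('a, 'c) monoid_scheme \<Rightarrow> 'a \<Rightarrow> 'a \<Rightarrow> bool" where
  "com G x y \<longleftrightarrow> x \<otimes>\<^bsub>G\<^esub> y = y \<otimes>\<^bsub>G\<^esub> x"

definition cj :: "('a, 'c) monoid_scheme \<Rightarrow> 'a \<Rightarrow> 'a \<Rightarrow> 'a" where
  "cj G g x = g \<otimes>\<^bsub>G\<^esub> x \<otimes>\<^bsub>G\<^esub> inv\<^bsub>G\<^esub> g"

section \<open>Conjugation and commutation in a group\<close>

context group
begin

lemma inv_mult_cancel [simp]: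
  "x \<in> carrier G \<Longrightarrow> y \<in> carrier G \<Longrightarrow> inv x \<otimes> (x \<otimes> y) = y"
  "x \<in> carrier G \<Longrightarrow> y \<in> carrier G \<Longrightarrow> x \<otimes> (inv x \<otimes> y) = y"
  by (simp_all flip: m_assoc)

lemmas gsimps = m_assoc inv_mult_group

lemma cj_closed [simp, intro]: "g \<in> carrier G \<Longrightarrow> x \<in> carrier G \<Longrightarrow> cj G g x \<in> carrier G"
  by (simp add: cj_def)

lemma cj_one [simp]: "g \<in> carrier G \<Longrightarrow> cj G g \<one> = \<one>"
  by (simp add: cj_def)

lemma cj_by_one [simp]: "x \<in> carrier G \<Longrightarrow> cj G \<one> x = x"
  by (simp add: cj_def)

lemma cj_cj: "\<lbrakk>g \<in> carrier G; h \<in> carrier G; x \<in> carrier G\<rbrakk> \<Longrightarrow> cj G g (cj G h x) = cj G (g \<otimes> h) x"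
  by (simp add: cj_def gsimps)

lemma cj_mult: "\<lbrakk>g \<in> carrier G; x \<in> carrier G; y \<in> carrier G\<rbrakk> \<Longrightarrow> cj G g (x \<otimes> y) = cj G g x \<otimes> cj G g y"
  by (simp add: cj_def gsimps)

lemma cj_inv: "\<lbrakk>g \<in> carrier G; x \<in> carrier G\<rbrakk> \<Longrightarrow> cj G g (inv x) = inv (cj G g x)"
  by (simp add: cj_def gsimps)

lemma cj_cancel [simp]:
  "\<lbrakk>g \<in> carrier G; x \<in> carrier G\<rbrakk> \<Longrightarrow> cj G g (cj G (inv g) x) = x"
  "\<lbrakk>g \<in> carrier G; x \<in> carrier G\<rbrakk> \<Longrightarrow> cj G (inv g) (cj G g x) = x"
  by (simp_all add: cj_cj)

lemma cj_eq_iff: "\<lbrakk>g \<in> carrier G; x \<in> carrier G; y \<in> carrier G\<rbrakk> \<Longrightarrow> cj G g x = cj G g y \<longleftrightarrow> x = y"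
  by (metis cj_cancel(2))

lemma cj_hom: "g \<in> carrier G \<Longrightarrow> cj G g \<in> hom G G"
  by (auto simp: hom_def cj_mult)

lemma cj_nat_pow: "\<lbrakk>g \<in> carrier G; x \<in> carrier G\<rbrakk> \<Longrightarrow> cj G g (x [^] (n::nat)) = cj G g x [^] n"
  by (induction n) (simp_all add: cj_mult)

lemma cj_int_pow: "\<lbrakk>g \<in> carrier G; x \<in> carrier G\<rbrakk> \<Longrightarrow> cj G g (x [^] (n::int)) = cj G g x [^] n"
  using hom_int_pow[OF cj_hom, of g x n] is_group by simp

lemma cj_eq_self: "\<lbrakk>g \<in> carrier G; x \<in> carrier G\<rbrakk> \<Longrightarrow> cj G g x = x \<longleftrightarrow> com G g x"
  unfolding cj_def com_def by (metis inv_solve_right' m_closed)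

lemma cj_eq_one: "\<lbrakk>g \<in> carrier G; x \<in> carrier G\<rbrakk> \<Longrightarrow> cj G g x = \<one> \<longleftrightarrow> x = \<one>"
  using cj_eq_iff[of g x \<one>] by simp

lemma com_sym: "com G x y \<longleftrightarrow> com G y x"
  by (auto simp: com_def)

lemma com_refl [simp]: "com G x x"
  by (auto simp: com_def)

lemma com_one [simp]: "x \<in> carrier G \<Longrightarrow> com G x \<one>" "x \<in> carrier G \<Longrightarrow> com G \<one> x"
  by (auto simp: com_def)

lemma com_mult:
  assumes "x \<in> carrier G" "y \<in> carrier G" "z \<in> carrier G" "com G x y" "com G x z"
  shows "com G x (y \<otimes> z)"
proof -
  have "x \<otimes> (y \<otimes> z) = (x \<otimes> y) \<otimes> z" using assms by (simp add: m_assoc)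
  also have "\<dots> = y \<otimes> (x \<otimes> z)" using assms by (simp add: com_def m_assoc)
  also have "\<dots> = (y \<otimes> z) \<otimes> x" using assms by (simp add: com_def m_assoc)
  finally show ?thesis by (simp add: com_def)
qed

lemma com_inv:
  assumes "x \<in> carrier G" "y \<in> carrier G" "com G x y"
  shows "com G x (inv y)"
  using assms cj_eq_self[of x "inv y"] cj_eq_self[of x y] by (simp add: cj_inv)

lemma com_nat_pow: "\<lbrakk>x \<in> carrier G; y \<in> carrier G; com G x y\<rbrakk> \<Longrightarrow> com G x (y [^] (n::nat))"
  by (induction n) (auto intro: com_mult)

lemma com_int_pow: "\<lbrakk>x \<in> carrier G; y \<in> carrier G; com G x y\<rbrakk> \<Longrightarrow> com G x (y [^] (n::int))"
  unfolding int_pow_def2 by (metis com_nat_pow com_inv nat_pow_closed)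

lemma com_int_pows: "x \<in> carrier G \<Longrightarrow> com G (x [^] (i::int)) (x [^] (j::int))"
  using com_int_pow[of "x [^] i" x j] com_int_pow[of x x i] by (simp add: com_sym)

lemma com_cj: "\<lbrakk>g \<in> carrier G; x \<in> carrier G; y \<in> carrier G\<rbrakk> \<Longrightarrow> com G (cj G g x) (cj G g y) \<longleftrightarrow> com G x y"
  using cj_eq_iff[of g "x \<otimes> y" "y \<otimes> x"] by (simp add: com_def cj_mult)

definition Cent :: "'a \<Rightarrow> 'a set" where
  "Cent x = {g \<in> carrier G. com G g x}"

lemma Cent_subgroup: "x \<in> carrier G \<Longrightarrow> subgroup (Cent x) G"
  by (rule subgroupI) (auto simp: Cent_def com_sym[of _ x] intro: com_mult com_inv)

lemma com_cancel:
  assumes "x \<in> carrier G" "y \<in> carrier G" "z \<in> carrier G" "com G x (y \<otimes> z)" "com G x y"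
  shows "com G x z"
  using com_mult[of x "inv y" "y \<otimes> z"] assms com_inv by simp

lemma com_cancel2:
  assumes "x \<in> carrier G" "y \<in> carrier G" "z \<in> carrier G" "com G x (y \<otimes> z)" "com G x z"
  shows "com G x y"
  using com_mult[of x "y \<otimes> z" "inv z"] assms com_inv by (simp add: m_assoc)

lemma com_generate:
  assumes "\<And>s. s \<in> S \<Longrightarrow> com G x s" "S \<subseteq> carrier G" "x \<in> carrier G" "y \<in> generate G S"
  shows "com G x y"
proof -
  have "generate G S \<subseteq> Cent x"
    by (rule generate_subgroup_incl[OF _ Cent_subgroup])
       (use assms in \<open>auto simp: Cent_def com_sym[of _ x]\<close>)
  then show ?thesis using assms(4) by (auto simp: Cent_def com_sym[of _ x])
qed

end

section \<open>Words and reduced words\<close>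

definition ltr :: "('l, 'c) monoid_scheme \<Rightarrow> ('x \<Rightarrow> 'l) \<Rightarrow> 'x \<times> bool \<Rightarrow> 'l" where
  "ltr L f l = (if snd l then f (fst l) else inv\<^bsub>L\<^esub> (f (fst l)))"

text \<open>Letters and their values are kept apart by \<open>f\<close>, so that one evaluation
  serves both abstract vertices (with \<open>f = vgen\<close>) and words whose letters are group
  elements (with \<open>f\<close> the identity).\<close>

primrec word_eval :: "('l, 'c) monoid_scheme \<Rightarrow> ('x \<Rightarrow> 'l) \<Rightarrow> ('x \<times> bool) list \<Rightarrow> 'l" where
  "word_eval L f [] = \<one>\<^bsub>L\<^esub>"
| "word_eval L f (l # w) = ltr L f l \<otimes>\<^bsub>L\<^esub> word_eval L f w"

definition flip :: "'x \<times> bool \<Rightarrow> 'x \<times> bool" where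
  "flip l = (fst l, \<not> snd l)"

lemma flip_simps [simp]: "fst (flip l) = fst l" "snd (flip l) = (\<not> snd l)" "flip (flip l) = l"
  "flip l \<noteq> l" "l \<noteq> flip l"
  by (auto simp: flip_def prod_eq_iff)

lemma flip_pair: "flip (a, b) = (a, \<not> b)"
  by (simp add: flip_def)

lemma flip_inj: "flip x = flip y \<longleftrightarrow> x = y"
  by (metis flip_simps(3))

definition winv :: "('x \<times> bool) list \<Rightarrow> ('x \<times> bool) list" where
  "winv w = rev (map flip w)"

definition red :: "('x \<times> bool) list \<Rightarrow> bool" where
  "red w \<longleftrightarrow> successively (\<lambda>x y. y \<noteq> flip x) w"

text \<open>Left multiplication by one letter on normal forms: the only possible cancellation is
  with the first letter. It serves both to reduce words and as the action that proves
  freeness.\<close>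

definition lcons :: "'x \<times> bool \<Rightarrow> ('x \<times> bool) list \<Rightarrow> ('x \<times> bool) list" where
  "lcons x w = (if w \<noteq> [] \<and> hd w = flip x then tl w else x # w)"

abbreviation letters :: "('x \<times> bool) list \<Rightarrow> 'x set" where
  "letters w \<equiv> fst ` set w"

lemma winv_simps [simp]: "winv [] = []" "winv (u @ v) = winv v @ winv u" "winv (winv u) = u"
  "length (winv u) = length u" "letters (winv u) = letters u" "winv [a] = [flip a]"
  "winv (a # u) = winv u @ [flip a]"
  "winv u = [] \<longleftrightarrow> u = []"
  by (simp_all add: winv_def rev_map image_image comp_def)

lemma red_Nil [simp]: "red []" and red_single [simp]: "red [a]"
  by (simp_all add: red_def)

lemma red_append: "red (u @ v) \<longleftrightarrow> red u \<and> red v \<and> (u = [] \<or> v = [] \<or> hd v \<noteq> flip (last u))"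
  by (auto simp: red_def successively_append_iff)

lemma red_Cons: "red (a # v) \<longleftrightarrow> red v \<and> (v = [] \<or> hd v \<noteq> flip a)"
  by (auto simp: red_def successively_Cons)

lemma red_winv: "red (winv w) \<longleftrightarrow> red w"
proof -
  have "successively (\<lambda>x y. flip x \<noteq> y) w = successively (\<lambda>x y. y \<noteq> flip x) w"
    by (intro successively_cong) auto
  then show ?thesis unfolding red_def winv_def
    by (simp add: successively_map)
qed

lemma red_lcons: "red w \<Longrightarrow> red (lcons x w)"
  by (cases w) (auto simp: lcons_def red_Cons)

lemma lcons_lcons_flip: "red w \<Longrightarrow> lcons x (lcons (flip x) w) = w"
  by (cases w rule: remdups_adj.cases) (auto simp: lcons_def red_Cons flip_inj)

lemma lcons_red: "red (x # w) \<Longrightarrow> lcons x w = x # w"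
  by (auto simp: lcons_def red_Cons)

lemma letters_lcons: "letters (lcons x w) \<subseteq> insert (fst x) (letters w)"
  by (cases w) (auto simp: lcons_def)

text \<open>Being reduced concerns adjacent letters only, and since \<open>v\<close> is nonempty
  every adjacent pair lies in \<open>u @ v\<close> or in \<open>v @ w\<close>.\<close>

lemma red_overlap: "red (u @ v) \<Longrightarrow> red (v @ w) \<Longrightarrow> v \<noteq> [] \<Longrightarrow> red (u @ v @ w)"
  by (auto simp: red_append)

section \<open>Powers of words and commutation in the free monoid\<close>

fun wpow :: "'x list \<Rightarrow> nat \<Rightarrow> 'x list" where
  "wpow x 0 = []"
| "wpow x (Suc n) = x @ wpow x n"

lemma wpow_add: "wpow x (m + n) = wpow x m @ wpow x n"
  by (induction m) auto

lemma wpow_Suc2: "wpow x (Suc n) = wpow x n @ x"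
  using wpow_add[of x n 1] by simp

lemma length_wpow [simp]: "length (wpow x n) = n * length x"
  by (induction n) auto

lemma set_wpow: "set (wpow x n) \<subseteq> set x" "0 < n \<Longrightarrow> set (wpow x n) = set x"
  by (induction n) auto

lemma red_wpow: "red (x @ x) \<Longrightarrow> red (wpow x n)"
proof (induction n)
  case (Suc n)
  then show ?case
    by (cases n; cases "x = []") (auto simp: red_append)
qed simp

text \<open>\<open>u\<close> can be moved across any number of copies of \<open>x\<close>. The bound
  on \<open>M\<close> makes the power at least as long as \<open>u\<close>, so that \<open>u\<close>
  is one of its prefixes.\<close>

lemma append_comm_prefix:
  assumes "u @ x = x @ u" "x \<noteq> []" "length u \<le> M"
  shows "u @ wpow x M = wpow x M @ u" "u = take (length u) (wpow x M)"
proof -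
  show *: "u @ wpow x M = wpow x M @ u" for M
  proof (induction M)
    case (Suc M)
    have "u @ wpow x (Suc M) = (x @ u) @ wpow x M" using assms(1) by simp
    also have "\<dots> = wpow x (Suc M) @ u" using Suc by simp
    finally show ?case .
  qed simp
  have "length u \<le> M * length x" using assms(2,3) by (cases x) (auto simp: trans_le_add1)
  then show "u = take (length u) (wpow x M)"
    using arg_cong[OF *[of M], of "take (length u)"] by simp
qed

text \<open>Both \<open>u @ w\<close> and \<open>w @ u\<close> are the prefix of length
  \<open>length u + length w\<close> of one and the same power of \<open>x\<close>.\<close>

lemma append_comm_trans:
  assumes "u @ x = x @ u" "w @ x = x @ w" "x \<noteq> []"
  shows "u @ w = w @ u"
proof -
  define M where "M = length u + length w"
  have M: "M \<le> M * length x" using assms(3) by (cases x) auto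
  have *: "u @ w = take M (wpow x M)"
    if "u @ x = x @ u" "w @ x = x @ w" "length u + length w = M" for u w
  proof -
    have "u @ w = take M (u @ wpow x M)"
      using append_comm_prefix(2)[OF that(2) assms(3), of M] that(3) by (metis diff_add_inverse le_add1 le_add2 take_all take_append)
    also have "\<dots> = take M (wpow x M)"
      using append_comm_prefix(1)[OF that(1) assms(3), of M] that(3) M by simp
    finally show ?thesis .
  qed
  show ?thesis using *[OF assms(1,2)] *[OF assms(2,1)] by (simp add: M_def)
qed

section \<open>Evaluation of words and bounded cancellation\<close>

context group
begin

lemma ltr_closed [simp]: "f (fst l) \<in> carrier G \<Longrightarrow> ltr G f l \<in> carrier G"
  by (auto simp: ltr_def)

lemma ltr_flip: "f (fst l) \<in> carrier G \<Longrightarrow> ltr G f (flip l) = inv (ltr G f l)"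
  by (auto simp: ltr_def)

lemma word_eval_closed [simp]: "f ` letters w \<subseteq> carrier G \<Longrightarrow> word_eval G f w \<in> carrier G"
  by (induction w) auto

lemma word_eval_append: "f ` letters u \<subseteq> carrier G \<Longrightarrow> f ` letters v \<subseteq> carrier G \<Longrightarrow>
  word_eval G f (u @ v) = word_eval G f u \<otimes> word_eval G f v"
  by (induction u) (auto simp: m_assoc)

lemma word_eval_winv: "f ` letters u \<subseteq> carrier G \<Longrightarrow> word_eval G f (winv u) = inv (word_eval G f u)"
proof (induction u)
  case (Cons a u)
  have "word_eval G f (winv ([a] @ u)) = word_eval G f (winv u) \<otimes> word_eval G f (winv [a])"
    using Cons.prems by (subst winv_simps(2), subst word_eval_append) (auto simp: image_image[symmetric])
  then show ?case using Cons by (auto simp: ltr_flip inv_mult_group)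
qed simp

lemma word_eval_wpow: "f ` letters x \<subseteq> carrier G \<Longrightarrow> word_eval G f (wpow x n) = word_eval G f x [^] n"
proof (induction n)
  case (Suc n)
  have "f ` letters (wpow x n) \<subseteq> carrier G" using Suc.prems set_wpow(1)[of x n] by blast
  then show ?case using Suc by (simp only: wpow.simps word_eval_append nat_pow_Suc2 word_eval_closed)
qed simp

lemma word_eval_lcons: "f ` letters w \<subseteq> carrier G \<Longrightarrow> f (fst l) \<in> carrier G \<Longrightarrow>
  word_eval G f (lcons l w) = ltr G f l \<otimes> word_eval G f w"
  by (cases w) (auto simp: lcons_def ltr_flip)

lemma word_eval_generate:
  "f ` letters w \<subseteq> S \<Longrightarrow> word_eval G f w \<in> generate G S"
  by (induction w) (auto simp: ltr_def intro: generate.intros)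

text \<open>Rebuilding an arbitrary word with \<open>lcons\<close>, letter by letter, makes it
  reduced without changing its value.\<close>

lemma generate_word_eval:
  assumes "f ` Y \<subseteq> carrier G" "g \<in> generate G (f ` Y)"
  shows "\<exists>w. red w \<and> letters w \<subseteq> Y \<and> g = word_eval G f w"
proof -
  have nf: "\<exists>u. red u \<and> letters u \<subseteq> Y \<and> word_eval G f w = word_eval G f u" if "letters w \<subseteq> Y" for w
    using that
  proof (induction w)
    case (Cons a w)
    then obtain u where u: "red u" "letters u \<subseteq> Y" "word_eval G f w = word_eval G f u" by auto
    have "letters (lcons a u) \<subseteq> Y" using subset_trans[OF letters_lcons[of a u], of Y] u(2) Cons.prems by simp
    moreover have "word_eval G f (a # w) = word_eval G f (lcons a u)"
      using u Cons.prems assms by (subst word_eval_lcons) auto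
    ultimately show ?case using u red_lcons by blast
  qed (auto intro: exI[of _ "[]"])
  have "\<exists>w. letters w \<subseteq> Y \<and> g = word_eval G f w"
    using assms(2)
  proof (induction rule: generate.induct)
    case one
    show ?case by (rule exI[of _ "[]"]) simp
  next
    case (incl h)
    then obtain x where "x \<in> Y" "h = f x" by auto
    then show ?case using assms by (intro exI[of _ "[(x, True)]"]) (auto simp: ltr_def)
  next
    case (inv h)
    then obtain x where "x \<in> Y" "h = f x" by auto
    then show ?case using assms by (intro exI[of _ "[(x, False)]"]) (auto simp: ltr_def)
  next
    case (eng h1 h2)
    then obtain u v where "letters u \<subseteq> Y" "h1 = word_eval G f u" "letters v \<subseteq> Y" "h2 = word_eval G f v" by auto
    then show ?case using assms by (intro exI[of _ "u @ v"]) (auto simp: word_eval_append image_subset_iff)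
  qed
  then show ?thesis using nf by metis
qed

text \<open>Each letter of \<open>v\<close> cancels at most one letter of \<open>w\<close>, so a
  suffix of \<open>w\<close> survives literally. The bound on \<open>s\<close> is the point: it
  keeps the far end of a long power intact in later arguments.\<close>

lemma left_mult_red:
  assumes "red w" "f ` letters w \<subseteq> carrier G" "f ` letters v \<subseteq> carrier G"
  shows "\<exists>v' s. red (v' @ drop s w) \<and> s \<le> length v \<and> letters v' \<subseteq> letters v \<and>
           word_eval G f (v' @ drop s w) = word_eval G f v \<otimes> word_eval G f w"
  using assms(3)
proof (induction v)
  case Nil
  then show ?case using assms by (intro exI[of _ "[]"] exI[of _ 0]) auto
next
  case (Cons a v)
  then obtain v' s where IH: "red (v' @ drop s w)" "s \<le> length v" "letters v' \<subseteq> letters v"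
    "word_eval G f (v' @ drop s w) = word_eval G f v \<otimes> word_eval G f w" by auto
  have sub: "f ` letters (v' @ drop s w) \<subseteq> carrier G"
  proof -
    have "letters (v' @ drop s w) \<subseteq> letters v \<union> letters w"
      using IH(3) set_drop_subset[of s w] by auto
    then have "f ` letters (v' @ drop s w) \<subseteq> f ` letters v \<union> f ` letters w" by blast
    also have "\<dots> \<subseteq> carrier G" using Cons.prems assms(2) by auto
    finally show ?thesis .
  qed
  have e: "word_eval G f (lcons a (v' @ drop s w)) = word_eval G f (a # v) \<otimes> word_eval G f w"
    using sub Cons.prems assms(2) IH(4) by (subst word_eval_lcons) (auto simp: m_assoc)
  have r: "red (lcons a (v' @ drop s w))" using IH(1) by (rule red_lcons)
  show ?case
  proof (cases v')
    case (Cons b t)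
    show ?thesis
    proof (cases "b = flip a")
      case True
      then have "lcons a (v' @ drop s w) = t @ drop s w" using Cons by (simp add: lcons_def)
      then show ?thesis using e r IH Cons by (intro exI[of _ t] exI[of _ s]) auto
    next
      case False
      then have "lcons a (v' @ drop s w) = (a # v') @ drop s w" using Cons by (simp add: lcons_def)
      then show ?thesis using e r IH by (intro exI[of _ "a # v'"] exI[of _ s]) auto
    qed
  next
    case Nil
    show ?thesis
    proof (cases "drop s w \<noteq> [] \<and> hd (drop s w) = flip a")
      case True
      then have "lcons a (v' @ drop s w) = [] @ drop (Suc s) w" using Nil by (simp add: lcons_def drop_Suc tl_drop)
      then show ?thesis using e r IH by (intro exI[of _ "[]"] exI[of _ "Suc s"]) auto
    next
      case False
      then have "lcons a (v' @ drop s w) = [a] @ drop s w" using Nil by (auto simp: lcons_def)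
      then show ?thesis using e r IH by (intro exI[of _ "[a]"] exI[of _ s]) auto
    qed
  qed
qed

text \<open>The mirror image of \<open>left_mult_red\<close>, obtained by inverting both
  words.\<close>

lemma right_mult_red:
  assumes "red w" "f ` letters w \<subseteq> carrier G" "f ` letters v \<subseteq> carrier G"
  shows "\<exists>v' s. red (take s w @ v') \<and> s \<le> length w \<and> length w \<le> s + length v \<and> letters v' \<subseteq> letters v \<and>
           word_eval G f (take s w @ v') = word_eval G f w \<otimes> word_eval G f v"
proof -
  obtain v' s where *: "red (v' @ drop s (winv w))" "s \<le> length (winv v)" "letters v' \<subseteq> letters (winv v)"
    "word_eval G f (v' @ drop s (winv w)) = word_eval G f (winv v) \<otimes> word_eval G f (winv w)"
    using left_mult_red[of "winv w" f "winv v"] assms by (auto simp: red_winv)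
  have d: "winv (drop s (winv w)) = take (length w - s) w"
    by (simp add: winv_def rev_map take_map drop_map rev_drop rev_take comp_def)
  have l: "f ` letters (v' @ drop s (winv w)) \<subseteq> carrier G"
  proof -
    have "letters (drop s (winv w)) \<subseteq> letters w" using set_drop_subset[of s "winv w"] winv_simps(5)[of w] by blast
    moreover have "letters v' \<subseteq> letters v" using *(3) by simp
    ultimately have "letters (v' @ drop s (winv w)) \<subseteq> letters v \<union> letters w" by (simp add: image_Un) blast
    then have "f ` letters (v' @ drop s (winv w)) \<subseteq> f ` letters v \<union> f ` letters w" by blast
    also have "\<dots> \<subseteq> carrier G" using assms(2,3) by blast
    finally show ?thesis .
  qed
  have "word_eval G f (winv (v' @ drop s (winv w))) = word_eval G f w \<otimes> word_eval G f v"
    using assms by (simp only: word_eval_winv[OF l] *(4)) (simp add: word_eval_winv inv_mult_group)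
  then show ?thesis using *(1,2,3) d red_winv[of "v' @ drop s (winv w)"]
    by (intro exI[of _ "winv v'"] exI[of _ "length w - s"]) auto
qed

end

section \<open>Free subsets of a group\<close>

text \<open>\<open>S\<close> is a free basis of the subgroup it generates, stated as uniqueness of
  reduced words. The letters are the elements of \<open>S\<close> themselves, so that conjugation in
  the group can act on words.\<close>

locale free_in = group G for G (structure) +
  fixes S
  assumes S_sub: "S \<subseteq> carrier G"
    and ev_inj: "\<lbrakk>red u; red v; letters u \<subseteq> S; letters v \<subseteq> S; word_eval G (\<lambda>x. x) u = word_eval G (\<lambda>x. x) v\<rbrakk> \<Longrightarrow> u = v"
begin

abbreviation "ev \<equiv> word_eval G (\<lambda>x. x)"
abbreviation "K \<equiv> generate G S"

lemma K_sub: "K \<subseteq> carrier G"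
  using generate_in_carrier[OF S_sub] by blast

lemma K_subgroup: "subgroup K G"
  by (rule generate_is_subgroup[OF S_sub])

lemma K_word:
  assumes "k \<in> K"
  obtains w where "red w" "letters w \<subseteq> S" "k = ev w"
  using generate_word_eval[of "\<lambda>x. x" S k] assms S_sub by auto

lemma ev_closed [simp]: "letters w \<subseteq> S \<Longrightarrow> ev w \<in> carrier G"
  using S_sub by (intro word_eval_closed) auto

lemma ev_K: "letters w \<subseteq> S \<Longrightarrow> ev w \<in> K"
  by (intro word_eval_generate) auto

lemma ev_append: "letters u \<subseteq> S \<Longrightarrow> letters v \<subseteq> S \<Longrightarrow> ev (u @ v) = ev u \<otimes> ev v"
  using S_sub by (intro word_eval_append) auto

lemma ev_winv: "letters u \<subseteq> S \<Longrightarrow> ev (winv u) = inv (ev u)"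
  using S_sub by (intro word_eval_winv) auto

lemma ev_wpow: "letters x \<subseteq> S \<Longrightarrow> ev (wpow x n) = ev x [^] n"
  using S_sub by (intro word_eval_wpow) auto

lemma letters_wpow: "letters x \<subseteq> S \<Longrightarrow> letters (wpow x n) \<subseteq> S"
  using set_wpow(1)[of x n] by blast

lemma ev_one: "red w \<Longrightarrow> letters w \<subseteq> S \<Longrightarrow> ev w = \<one> \<Longrightarrow> w = []"
  using ev_inj[of w "[]"] by simp

lemma left_mult:
  assumes "red w" "letters w \<subseteq> S" "letters v \<subseteq> S"
  obtains v' s where "red (v' @ drop s w)" "s \<le> length v" "letters v' \<subseteq> letters v"
    "ev (v' @ drop s w) = ev v \<otimes> ev w"
  using left_mult_red[of w "\<lambda>x. x" v] assms(1) order_trans[OF assms(2) S_sub] order_trans[OF assms(3) S_sub] by auto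

lemma right_mult:
  assumes "red w" "letters w \<subseteq> S" "letters v \<subseteq> S"
  obtains v' s where "red (take s w @ v')" "s \<le> length w" "length w \<le> s + length v" "letters v' \<subseteq> letters v"
    "ev (take s w @ v') = ev w \<otimes> ev v"
  using right_mult_red[of w "\<lambda>x. x" v] assms(1) order_trans[OF assms(2) S_sub] order_trans[OF assms(3) S_sub] by auto

lemma letters_take: "letters w \<subseteq> S \<Longrightarrow> letters (take n w) \<subseteq> S"
  using set_take_subset[of n w] by blast

lemma letters_drop: "letters w \<subseteq> S \<Longrightarrow> letters (drop n w) \<subseteq> S"
  using set_drop_subset[of n w] by blast

text \<open>If \<open>v\<close> commutes with a cyclically reduced word \<open>x\<close>, then for large \<open>N\<close> the reduced word of
  \<open>v x\<^sup>N\<close> starts and ends with \<open>x\<close>, so that it commutes with \<open>x\<close> already in the free monoid.\<close>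

lemma commuting_word:
  assumes x: "letters x \<subseteq> S" "x \<noteq> []" "red (x @ x)" and v: "v \<in> K" "com G v (ev x)"
  obtains u N where "set u \<subseteq> set x" "u @ x = x @ u" "v \<otimes> ev x [^] (N::nat) = ev u"
proof -
  obtain w where w: "red w" "letters w \<subseteq> S" "v = ev w" using K_word[OF v(1)] .
  define n where "n = length w"
  \<comment> \<open>Multiplication by \<open>v\<close> cancels at most \<open>n\<close> letters, and
    \<open>n\<close> copies of the nonempty \<open>x\<close> have at least \<open>n\<close> letters;
    the additional copy guarantees that a full \<open>x\<close> survives at the far end.\<close>
  define L where "L = wpow x (Suc n)"
  have L: "red L" "letters L \<subseteq> S" "ev L = ev x [^] Suc n"
    using red_wpow[OF x(3)] letters_wpow[OF x(1)] ev_wpow[OF x(1)] by (simp_all add: L_def del: wpow.simps)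
  have nl: "n \<le> n * length x" using x(2) by (cases x) auto
  obtain v' s where 1: "red (v' @ drop s L)" "s \<le> n" "letters v' \<subseteq> letters w"
    "ev (v' @ drop s L) = v \<otimes> ev L"
    using left_mult[OF L(1,2) w(2)] w(3) n_def by metis
  obtain v'' t where 2: "red (take t L @ v'')" "length L \<le> t + n" "letters v'' \<subseteq> letters w"
    "ev (take t L @ v'') = ev L \<otimes> v"
    using right_mult[OF L(1,2) w(2)] w(3) n_def by metis
  define u where "u = v' @ drop s L"
  have vc: "v \<in> carrier G" using w by simp
  have xc: "ev x \<in> carrier G" using x by simp
  have "com G v (ev L)" unfolding L(3) by (rule com_nat_pow[OF vc xc v(2)])
  then have ev_eq: "ev (v' @ drop s L) = ev (take t L @ v'')" using 1(4) 2(4) by (simp add: com_def)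
  have "letters v' \<union> letters (drop s L) \<subseteq> S" using 1(3) w(2) letters_drop[OF L(2)] by blast
  then have lu: "letters u \<subseteq> S" by (simp add: u_def image_Un)
  have "letters (take t L) \<union> letters v'' \<subseteq> S" using 2(3) w(2) letters_take[OF L(2)] by blast
  then have lu': "letters (take t L @ v'') \<subseteq> S" by (simp add: image_Un)
  have u2: "u = take t L @ v''" using ev_inj[OF 1(1) 2(1) _ lu' ev_eq] lu by (simp add: u_def)
  have "drop s L = drop s (wpow x n) @ x"
    unfolding L_def wpow_Suc2 using order_trans[OF 1(2) nl] by simp
  then obtain a where a: "u = a @ x" by (auto simp: u_def)
  have "length x + n * length x \<le> t + n" using 2(2) by (simp add: L_def)
  then have "length x \<le> t" using nl by linarith
  then have "take t L = x @ take (t - length x) (wpow x n)" by (simp add: L_def)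
  then obtain b where b: "u = x @ b" using u2 by auto
  have ru: "red u" using 1(1) by (simp add: u_def)
  \<comment> \<open>\<open>u\<close> begins and ends with \<open>x\<close> and \<open>x @ x\<close>
    is reduced, so nothing cancels at the seam in either product.\<close>
  have r1: "red (u @ x)" using red_overlap[of a x x] ru a x by simp
  have r2: "red (x @ u)" using red_overlap[of x x b] ru b x by simp
  have evu: "ev u = v \<otimes> ev x [^] Suc n" using 1(4) L(3) by (simp add: u_def)
  have "com G (ev x) (ev u)" unfolding evu
    by (intro com_mult) (use vc xc v(2) com_nat_pow[of "ev x" "ev x" "Suc n"] in \<open>auto simp: com_sym\<close>)
  then have "ev (u @ x) = ev (x @ u)" using lu x by (simp add: ev_append com_def)
  then have comm: "u @ x = x @ u" using ev_inj[OF r1 r2] lu x by auto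
  have "set u \<subseteq> set x"
    by (subst append_comm_prefix(2)[OF comm x(2) order_refl]) (meson set_take_subset set_wpow(1) subset_trans)
  then show thesis using comm evu that by metis
qed

text \<open>\<open>commuting_word\<close> writes \<open>v\<close> as \<open>ev u\<close> times the
  inverse of a power of \<open>ev x\<close>, where \<open>u\<close> uses only letters of
  \<open>x\<close>.\<close>

lemma commuting_letters:
  assumes x: "letters x \<subseteq> S" "x \<noteq> []" "red (x @ x)" and v: "v \<in> K" "com G v (ev x)"
  shows "v \<in> generate G (letters x)"
proof -
  obtain u N where u: "set u \<subseteq> set x" "u @ x = x @ u" "v \<otimes> ev x [^] (N::nat) = ev u"
    using commuting_word[OF assms] .
  have lx: "letters x \<subseteq> carrier G" using x S_sub by blast
  have gx: "subgroup (generate G (letters x)) G" by (rule generate_is_subgroup[OF lx])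
  have "ev u \<in> generate G (letters x)" "ev (wpow x N) \<in> generate G (letters x)"
    using u(1) set_wpow(1)[of x N] by (auto intro!: word_eval_generate)
  moreover have "v = ev u \<otimes> inv (ev (wpow x N))"
  proof -
    have "v \<in> carrier G" "ev x \<in> carrier G" using x v K_sub by auto
    then show ?thesis unfolding ev_wpow[OF x(1)] u(3)[symmetric] by (simp add: m_assoc)
  qed
  ultimately show ?thesis using subgroup.m_closed[OF gx] subgroup.m_inv_closed[OF gx] by simp
qed

text \<open>Up to powers of \<open>ev x\<close>, both \<open>v\<close> and \<open>w\<close> are
  values of words that commute with \<open>x\<close> in the free monoid, and such words commute with
  each other by \<open>append_comm_trans\<close>. The powers of \<open>ev x\<close> are then
  cancelled again.\<close>

lemma commuting_transitive_red:
  assumes x: "letters x \<subseteq> S" "x \<noteq> []" "red (x @ x)"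
    and v: "v \<in> K" "com G v (ev x)" and w: "w \<in> K" "com G w (ev x)"
  shows "com G v w"
proof -
  obtain a M where a: "set a \<subseteq> set x" "a @ x = x @ a" "v \<otimes> ev x [^] (M::nat) = ev a"
    using commuting_word[OF x v] .
  obtain b N where b: "set b \<subseteq> set x" "b @ x = x @ b" "w \<otimes> ev x [^] (N::nat) = ev b"
    using commuting_word[OF x w] .
  have la: "letters a \<subseteq> S" "letters b \<subseteq> S" using a(1) b(1) x(1) by blast+
  have "a @ b = b @ a" using append_comm_trans[OF a(2) b(2) x(2)] .
  then have "com G (ev a) (ev b)" using la by (metis com_def ev_append)
  moreover have c: "v \<in> carrier G" "w \<in> carrier G" "ev x \<in> carrier G" using v w x K_sub by auto
  moreover have "com G (ev a) (ev x [^] N)"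
    unfolding a(3)[symmetric] using c v
    by (intro com_nat_pow) (auto simp: com_sym[of _ "ev x"] intro!: com_mult com_nat_pow)
  ultimately have 1: "com G (ev a) w"
    using la by (intro com_cancel2[of "ev a" w "ev x [^] N"]) (auto simp: b(3))
  have "com G w (ev x [^] M)" using c w by (intro com_nat_pow) auto
  then have "com G w v"
    using 1 c by (intro com_cancel2[of w v "ev x [^] M"]) (auto simp: com_sym[of _ w] a(3))
  then show ?thesis by (simp add: com_sym)
qed

text \<open>If \<open>w @ w\<close> is not reduced, the last letter of \<open>w\<close> is inverse
  to the first one; stripping both conjugates the shorter middle word.\<close>

lemma cyclic_reduction_word:
  assumes "red w" "letters w \<subseteq> S"
  shows "\<exists>x t. letters x \<subseteq> S \<and> letters t \<subseteq> S \<and> red (x @ x) \<and> ev w = cj G (ev t) (ev x)"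
  using assms
proof (induction w rule: length_induct)
  case (1 w)
  show ?case
  proof (cases "red (w @ w)")
    case True
    then show ?thesis using 1 by (intro exI[of _ w] exI[of _ "[]"]) auto
  next
    case False
    then have w: "w \<noteq> []" "hd w = flip (last w)" using 1 by (auto simp: red_append)
    then obtain a m where am: "w = a # m" by (cases w) auto
    have "m \<noteq> []" using w am by auto
    then obtain n b where nb: "m = n @ [b]" by (metis append_butlast_last_id)
    have b: "b = flip a" using w am nb by simp
    have wn: "w = [a] @ n @ winv [a]" using am nb b by simp
    have ln: "letters n \<subseteq> S" "letters [a] \<subseteq> S" "red n" using 1(2,3) unfolding wn red_append by auto
    obtain x t where xt: "letters x \<subseteq> S" "letters t \<subseteq> S" "red (x @ x)" "ev n = cj G (ev t) (ev x)"
      using 1(1)[rule_format, OF _ ln(3,1)] wn by auto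
    have "ev w = cj G (ev [a]) (ev n)"
      unfolding wn using ln by (subst ev_append, simp, simp, subst ev_append, simp, simp, subst ev_winv)
        (auto simp: cj_def m_assoc simp del: word_eval.simps)
    also have "\<dots> = cj G (ev ([a] @ t)) (ev x)"
      using ln xt by (subst ev_append) (auto simp: cj_cj simp del: word_eval.simps)
    finally show ?thesis using xt ln by (intro exI[of _ x] exI[of _ "[a] @ t"]) auto
  qed
qed

lemma cyclic_reduction:
  assumes "k \<in> K"
  obtains x t where "letters x \<subseteq> S" "t \<in> K" "red (x @ x)" "k = cj G t (ev x)"
  using cyclic_reduction_word K_word[OF assms] ev_K by metis

lemma cj_K: "t \<in> K \<Longrightarrow> k \<in> K \<Longrightarrow> cj G t k \<in> K"
  unfolding cj_def using K_subgroup by (simp add: subgroup.m_closed subgroup.m_inv_closed)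

text \<open>Centralizers of nontrivial elements of a free group are abelian. Conjugation by
  \<open>t\<close> reduces this to a cyclically reduced \<open>k\<close>.\<close>

lemma commuting_transitive:
  assumes "k \<in> K" "k \<noteq> \<one>" "v \<in> K" "com G v k" "w \<in> K" "com G w k"
  shows "com G v w"
proof -
  obtain x t where x: "letters x \<subseteq> S" "t \<in> K" "red (x @ x)" "k = cj G t (ev x)"
    using cyclic_reduction[OF assms(1)] .
  have tc: "t \<in> carrier G" "v \<in> carrier G" "w \<in> carrier G" "ev x \<in> carrier G"
    using x assms K_sub by auto
  have ti: "inv t \<in> K" using x K_subgroup by (simp add: subgroup.m_inv_closed)
  have "x \<noteq> []" using x(4) assms(2) tc by auto
  moreover have "com G (cj G (inv t) v) (ev x)" "com G (cj G (inv t) w) (ev x)"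
    using assms(4,6) tc x(4) com_cj[of "inv t" v k] com_cj[of "inv t" w k] by auto
  ultimately have "com G (cj G (inv t) v) (cj G (inv t) w)"
    using commuting_transitive_red[OF x(1) _ x(3)] cj_K[OF ti] assms by blast
  then show ?thesis using com_cj tc by simp
qed

text \<open>No cancellation occurs in a power of a cyclically reduced word, so its length
  grows.\<close>

lemma torsion_free:
  assumes "k \<in> K" "k [^] (n::nat) = \<one>" "0 < n"
  shows "k = \<one>"
proof -
  obtain x t where x: "letters x \<subseteq> S" "t \<in> K" "red (x @ x)" "k = cj G t (ev x)"
    using cyclic_reduction[OF assms(1)] .
  have tc: "t \<in> carrier G" "ev x \<in> carrier G" using x K_sub by auto
  have "ev (wpow x n) = \<one>"
    using assms(2) x(1,4) tc by (simp add: ev_wpow cj_eq_one flip: cj_nat_pow)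
  then have "wpow x n = []" using ev_one red_wpow[OF x(3)] letters_wpow[OF x(1)] by blast
  then have "x = []" using assms(3) by (cases n) auto
  then show ?thesis using x(4) tc by simp
qed

text \<open>In \<open>v\<close> times a power of \<open>x\<close> times the inverse of
  \<open>v\<close>, each conjugator consumes at most \<open>n\<close> letters. The \<open>n\<close>
  copies of \<open>x\<close> on either side absorb this, so the middle \<open>x\<close> survives in
  the reduced word, which is a power of \<open>y\<close> by uniqueness.\<close>

lemma cyc_red_conj_letters:
  assumes x: "letters x \<subseteq> S" "red (x @ x)" and y: "letters y \<subseteq> S" "red (y @ y)"
    and v: "v \<in> K" "ev y = cj G v (ev x)"
  shows "set x \<subseteq> set y"
proof (cases "x = []")
  case False
  obtain w where w: "red w" "letters w \<subseteq> S" "v = ev w" using K_word[OF v(1)] .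
  define n where "n = length w"
  define L where "L = wpow x n @ x @ wpow x n"
  have L': "L = wpow x (n + Suc n)" by (simp only: L_def wpow_add) simp
  have L: "red L" "letters L \<subseteq> S" "ev L = ev x [^] (n + Suc n)"
    unfolding L' by (rule red_wpow[OF x(2)], rule letters_wpow[OF x(1)], rule ev_wpow[OF x(1)])
  have nl: "n \<le> n * length x" using False by (cases x) auto
  obtain v' s where 1: "red (v' @ drop s L)" "s \<le> n" "letters v' \<subseteq> letters w"
    "ev (v' @ drop s L) = v \<otimes> ev L"
    using left_mult[OF L(1,2) w(2)] w(3) n_def by metis
  define u where "u = v' @ drop s L"
  have "letters v' \<union> letters (drop s L) \<subseteq> S" using 1(3) w(2) letters_drop[OF L(2)] by blast
  then have lu: "letters u \<subseteq> S" by (simp add: u_def image_Un)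
  have ru: "red u" using 1 by (simp add: u_def)
  have wi: "letters (winv w) \<subseteq> S" using w by simp
  obtain v'' t where 2: "red (take t u @ v'')" "length u \<le> t + n" "letters v'' \<subseteq> letters (winv w)"
    "ev (take t u @ v'') = ev u \<otimes> inv v"
    using right_mult[OF ru lu wi] w(2,3) ev_winv n_def winv_simps(4) by metis
  have "letters (take t u) \<union> letters v'' \<subseteq> S" using 2(3) wi letters_take[OF lu] by blast
  then have lu': "letters (take t u @ v'') \<subseteq> S" by (simp add: image_Un)
  have c: "v \<in> carrier G" "ev x \<in> carrier G" using v K_sub x by auto
  have "ev (take t u @ v'') = cj G v (ev x [^] (n + Suc n))"
    unfolding 2(4) unfolding u_def 1(4) L(3) unfolding cj_def ..
  also have "\<dots> = ev y [^] (n + Suc n)" unfolding v(2) using c by (rule cj_nat_pow)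
  also have "\<dots> = ev (wpow y (n + Suc n))" by (rule ev_wpow[OF y(1), symmetric])
  finally have eq: "take t u @ v'' = wpow y (n + Suc n)"
    using ev_inj[OF 2(1) red_wpow[OF y(2)] lu' letters_wpow[OF y(1)]] by blast
  have "set x \<subseteq> set (take t u)"
  proof -
    have "u = (v' @ drop s (wpow x n) @ x) @ wpow x n"
      using order_trans[OF 1(2) nl] by (simp add: u_def L_def)
    moreover from this have "length u = length (v' @ drop s (wpow x n) @ x) + length (wpow x n)"
      by (simp only: length_append)
    then have "length (v' @ drop s (wpow x n) @ x) \<le> t" using 2(2) nl unfolding length_wpow by linarith
    ultimately have "take t u = (v' @ drop s (wpow x n) @ x) @ take (t - length (v' @ drop s (wpow x n) @ x)) (wpow x n)"
      by (metis take_all take_append)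
    then show ?thesis by auto
  qed
  also have "\<dots> \<subseteq> set (wpow y (n + Suc n))" using eq by (metis set_append sup_ge1)
  also have "\<dots> \<subseteq> set y" by (rule set_wpow(1))
  finally show ?thesis .
qed simp

lemma S_K: "s \<in> S \<Longrightarrow> s \<in> K"
  by (rule generate.incl)

lemma S_neq_one: "s \<in> S \<Longrightarrow> s \<noteq> \<one>"
  using ev_one[of "[(s, True)]"] S_sub by (auto simp: ltr_def)

text \<open>An element commuting with a nonzero power of \<open>s\<close> commutes with
  \<open>s\<close> by transitivity, and \<open>commuting_letters\<close> for the one-letter word
  \<open>s\<close> leaves only powers of \<open>s\<close>.\<close>

lemma centralizer_basis:
  assumes "s \<in> S" "v \<in> K" "com G v (s [^] (n::int))" "n \<noteq> 0"
  shows "\<exists>j::int. v = s [^] j"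
proof -
  have sc: "s \<in> carrier G" using assms S_sub by auto
  define m where "m = nat \<bar>n\<bar>"
  have m: "0 < m" using assms by (simp add: m_def)
  have vc: "v \<in> carrier G" using assms K_sub by auto
  have "com G v (s [^] int m)"
  proof (cases "n < 0")
    case True
    then have "s [^] int m = inv (s [^] n)" using sc by (simp add: m_def int_pow_neg)
    then show ?thesis using com_inv[of v "s [^] n"] vc sc assms by simp
  next
    case False
    then show ?thesis using assms by (simp add: m_def)
  qed
  then have c: "com G v (s [^] m)" by (simp add: int_pow_int)
  have sm: "s [^] m \<noteq> \<one>" using torsion_free[OF S_K[OF assms(1)] _ m] S_neq_one[OF assms(1)] by blast
  have smK: "s [^] m \<in> K" using S_K[OF assms(1)] K_subgroup by (simp add: subgroup_int_pow_closed flip: int_pow_int)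
  have "com G s (s [^] m)" using sc by (intro com_nat_pow) auto
  then have vs: "com G v s" using commuting_transitive[OF smK sm assms(2) c S_K[OF assms(1)]] by blast
  have "v \<in> generate G (letters [(s, True)])"
    by (rule commuting_letters) (use assms vs sc in \<open>auto simp: ltr_def red_Cons flip_def\<close>)
  then show ?thesis using generate_pow[OF sc] by auto
qed

end

section \<open>Free groups extended by a free group of basis permutations\<close>

text \<open>In the application \<open>T\<close> consists of the two branch vertices, \<open>z\<close> is the centre of the tree, and \<open>S\<close>
  consists of \<open>z\<close> and the conjugates of the leaves by the subgroup generated by \<open>T\<close>; thus \<open>\<pi>\<close> kills
  the centre and the leaves.\<close>

locale perm_split = Kf: free_in G S + Qf: free_in G T for G (structure) and S T +
  fixes \<pi> z
  assumes pi_hom: "\<pi> \<in> hom G G"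
    and pi_Q: "u \<in> generate G T \<Longrightarrow> \<pi> u = u"
    and pi_K: "k \<in> generate G S \<Longrightarrow> \<pi> k = \<one>"
    and act: "u \<in> generate G T \<Longrightarrow> s \<in> S \<Longrightarrow> cj G u s \<in> S"
    and decomp: "g \<in> carrier G \<Longrightarrow> \<exists>k\<in>generate G S. \<exists>q\<in>generate G T. g = k \<otimes> q"
    and z_S: "z \<in> S"
    and z_fixed: "u \<in> generate G T \<Longrightarrow> com G u z"
    and stab: "s \<in> S \<Longrightarrow> s \<noteq> z \<Longrightarrow> \<exists>u\<in>generate G T. \<exists>t\<in>T. \<forall>q\<in>generate G T. com G q s \<longleftrightarrow> (\<exists>j::int. q = cj G u (t [^] j))"
begin

abbreviation "Q \<equiv> generate G T"

definition act_word :: "'a \<Rightarrow> ('a \<times> bool) list \<Rightarrow> ('a \<times> bool) list" where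
  "act_word q w = map (\<lambda>l. (cj G q (fst l), snd l)) w"

lemma S_carrier: "s \<in> S \<Longrightarrow> s \<in> carrier G" and Q_carrier: "q \<in> Q \<Longrightarrow> q \<in> carrier G"
  and K_carrier: "k \<in> Kf.K \<Longrightarrow> k \<in> carrier G"
  using Kf.S_sub Qf.K_sub Kf.K_sub by auto

lemma letters_act_word: "letters (act_word q w) = cj G q ` letters w"
  by (simp add: act_word_def image_image)

lemma letters_act_word_S: "q \<in> Q \<Longrightarrow> letters w \<subseteq> S \<Longrightarrow> letters (act_word q w) \<subseteq> S"
  unfolding letters_act_word using act by blast

lemma ev_act_word: "q \<in> Q \<Longrightarrow> letters w \<subseteq> S \<Longrightarrow> Kf.ev (act_word q w) = cj G q (Kf.ev w)"
proof (induction w)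
  case Nil
  then show ?case by (simp add: act_word_def Q_carrier)
next
  case (Cons a w)
  have "ltr G (\<lambda>x. x) (cj G q (fst a), snd a) = cj G q (ltr G (\<lambda>x. x) a)"
    using Cons.prems by (simp add: ltr_def Q_carrier S_carrier Kf.cj_inv)
  then show ?case using Cons by (simp add: act_word_def Q_carrier S_carrier Kf.cj_mult)
qed

text \<open>Conjugation by \<open>q\<close> is injective on letters, so no new pair of inverse
  neighbours arises.\<close>

lemma red_act_word:
  assumes "q \<in> Q" "letters w \<subseteq> S" "red w"
  shows "red (act_word q w)"
proof -
  have "successively (\<lambda>x y. (cj G q (fst y), snd y) \<noteq> flip (cj G q (fst x), snd x)) w"
  proof (rule successively_mono)
    show "successively (\<lambda>x y. y \<noteq> flip x) w" using assms(3) by (simp add: red_def)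
    fix x y assume "x \<in> set w" "y \<in> set w" "y \<noteq> flip x"
    then show "(cj G q (fst y), snd y) \<noteq> flip (cj G q (fst x), snd x)"
      using assms Kf.cj_eq_iff[of q "fst y" "fst x"] Q_carrier S_carrier
      by (auto simp: prod_eq_iff image_subset_iff)
  qed
  then show ?thesis by (simp add: red_def act_word_def successively_map)
qed

text \<open>\<open>act_word q w\<close> is again reduced and has the same value as \<open>w\<close>,
  so the two words agree letter by letter.\<close>

lemma com_letters:
  assumes "q \<in> Q" "red w" "letters w \<subseteq> S" "com G q (Kf.ev w)" "s \<in> letters w"
  shows "com G q s"
proof -
  have "Kf.ev (act_word q w) = Kf.ev w"
    using assms by (simp add: ev_act_word Kf.cj_eq_self Q_carrier)
  then have "act_word q w = w"
    using Kf.ev_inj[OF red_act_word _ letters_act_word_S] assms by blast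
  then have "map (\<lambda>l. (cj G q (fst l), snd l)) w = map (\<lambda>l. l) w" by (simp add: act_word_def)
  then have "\<forall>l\<in>set w. cj G q (fst l) = fst l" unfolding map_eq_conv by (metis fst_conv)
  then show ?thesis using assms Kf.cj_eq_self[of q s] Q_carrier S_carrier by auto
qed

lemma com_ev:
  assumes "q \<in> carrier G" "letters w \<subseteq> S" "\<And>s. s \<in> letters w \<Longrightarrow> com G q s"
  shows "com G q (Kf.ev w)"
proof (rule Kf.com_generate)
  show "Kf.ev w \<in> generate G (letters w)" by (rule Kf.word_eval_generate) simp
qed (use assms S_carrier in auto)

lemma root_of_stab:
  assumes "u \<in> Q" "t \<in> T" "q \<in> Q" "com G q (cj G u (t [^] j))" "(j::int) \<noteq> 0"
  shows "\<exists>i::int. q = cj G u (t [^] i)"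
proof -
  have c: "u \<in> carrier G" "t \<in> carrier G" "q \<in> carrier G"
    using assms Q_carrier Qf.S_sub by auto
  have ui: "inv u \<in> Q" using assms(1) Qf.K_subgroup by (simp add: subgroup.m_inv_closed)
  have "com G (cj G (inv u) q) (t [^] j)"
    using Kf.com_cj[of "inv u" q "cj G u (t [^] j)"] assms(4) c by simp
  then obtain i :: int where "cj G (inv u) q = t [^] i"
    using Qf.centralizer_basis[OF assms(2) Qf.cj_K[OF ui assms(3)] _ assms(5)] by blast
  then have "q = cj G u (t [^] i)" using c by (metis Kf.cj_cancel(1))
  then show ?thesis ..
qed

text \<open>The stabilizer of a letter in \<open>Q\<close> is all of \<open>Q\<close> for
  \<open>z\<close> and otherwise generated by a conjugate of a basis element of \<open>Q\<close>. A
  subgroup of the latter kind contains all roots of its nontrivial elements.\<close>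

lemma stab_root:
  assumes "s \<in> S" "q \<in> Q" "0 < (N::nat)" "com G (q [^] N) s"
  shows "com G q s"
proof (cases "s = z \<or> q = \<one>")
  case True
  then show ?thesis using z_fixed assms S_carrier by auto
next
  case False
  obtain u t where ut: "u \<in> Q" "t \<in> T" "\<forall>q\<in>Q. com G q s \<longleftrightarrow> (\<exists>j::int. q = cj G u (t [^] j))"
    using stab assms(1) False by blast
  have c: "u \<in> carrier G" "t \<in> carrier G" "q \<in> carrier G"
    using assms ut Q_carrier Qf.S_sub by auto
  have "q [^] N \<in> Q" using assms(2) Qf.K_subgroup by (simp add: Kf.subgroup_int_pow_closed flip: int_pow_int)
  then obtain j :: int where j: "q [^] N = cj G u (t [^] j)" using ut(3) assms(4) by blast
  have "j \<noteq> 0" using j c Qf.torsion_free[OF assms(2) _ assms(3)] False by auto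
  moreover have "com G q (cj G u (t [^] j))" using j[symmetric] c by (simp add: Kf.com_nat_pow)
  ultimately have "\<exists>i::int. q = cj G u (t [^] i)" using root_of_stab ut(1,2) assms(2) by blast
  then show ?thesis using ut(3) assms(2) by blast
qed

text \<open>For \<open>s \<noteq> z\<close> the stabilizer is generated by a conjugate of a basis
  element of the free group \<open>Q\<close>, hence contains the centralizer in \<open>Q\<close> of
  each of its nontrivial elements.\<close>

lemma stab_com:
  assumes "s \<in> S" "q \<in> Q" "q \<noteq> \<one>" "com G q s" "q' \<in> Q" "com G q' q"
  shows "com G q' s"
proof (cases "s = z")
  case True
  then show ?thesis using z_fixed assms by auto
next
  case False
  obtain u t where ut: "u \<in> Q" "t \<in> T" "\<forall>q\<in>Q. com G q s \<longleftrightarrow> (\<exists>j::int. q = cj G u (t [^] j))"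
    using stab assms(1) False by blast
  have c: "u \<in> carrier G" using ut Q_carrier by auto
  obtain j :: int where j: "q = cj G u (t [^] j)" using ut(3) assms by blast
  have "j \<noteq> 0" using j c assms(3) by auto
  then show ?thesis using root_of_stab[OF ut(1,2) assms(5)] assms(5,6) ut(3) j by blast
qed

text \<open>By the pigeonhole principle two powers of \<open>q\<close> induce the same map on the
  finite set \<open>A\<close>; their quotient fixes \<open>A\<close> pointwise.\<close>

lemma finite_orbit_power:
  assumes "finite A" "A \<subseteq> S" "q \<in> Q" "\<And>s. s \<in> A \<Longrightarrow> cj G q s \<in> A"
  shows "\<exists>N>0. \<forall>s\<in>A. com G (q [^] (N::nat)) s"
proof -
  have qc: "q \<in> carrier G" using assms Q_carrier by auto
  define F where "F i = restrict (cj G (q [^] (i::nat))) A" for i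
  have *: "cj G (q [^] (i::nat)) s \<in> A" if "s \<in> A" for i s
    using that
  proof (induction i arbitrary: s)
    case (Suc i)
    then have sc: "s \<in> carrier G" using assms(2) S_carrier by auto
    have "cj G (q [^] Suc i) s = cj G (q [^] i) (cj G q s)" using sc qc by (simp add: Kf.cj_cj)
    then show ?case using Suc assms(4) by simp
  qed (use assms S_carrier in auto)
  have "range F \<subseteq> (\<Pi>\<^sub>E i\<in>A. A)" using * by (auto simp: F_def)
  then have "finite (range F)" using assms(1) finite_PiE finite_subset by metis
  then have "\<not> inj F" using finite_imageD infinite_UNIV_nat by metis
  then obtain i j where ij: "i < j" "F i = F j" by (metis injI linorder_neqE_nat)
  show ?thesis
  proof (intro exI[of _ "j - i"] conjI ballI)
    fix s assume s: "s \<in> A"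
    then have sc: "s \<in> carrier G" using assms(2) S_carrier by auto
    have "cj G (q [^] i) s = cj G (q [^] j) s" using fun_cong[OF ij(2), of s] s by (simp add: F_def)
    also have "q [^] j = q [^] i \<otimes> q [^] (j - i)" using ij(1) qc by (simp add: Kf.nat_pow_mult)
    also have "cj G (q [^] i \<otimes> q [^] (j - i)) s = cj G (q [^] i) (cj G (q [^] (j - i)) s)"
      using sc qc by (simp add: Kf.cj_cj)
    finally have "cj G (q [^] (j - i)) s = s" using sc qc by (metis Kf.cj_eq_iff Kf.cj_closed Kf.nat_pow_closed)
    then show "com G (q [^] (j - i)) s" using sc qc by (simp add: Kf.cj_eq_self)
  qed (use ij in auto)
qed

text \<open>The hypothesis says that \<open>k\<close> conjugates the letterwise image of
  \<open>w\<close> under \<open>q\<close> back to \<open>w\<close>. Both words are cyclically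
  reduced, so \<open>q\<close> maps the finite set of letters of \<open>w\<close> into itself, some
  power of \<open>q\<close> fixes all of them, and by \<open>stab_root\<close> so does
  \<open>q\<close>. What remains is that \<open>k\<close> commutes with \<open>ev w\<close>, so
  \<open>k\<close> lies in the subgroup generated by the letters of \<open>w\<close>.\<close>

lemma centralizer_of_cyc_red:
  assumes w: "letters w \<subseteq> S" "w \<noteq> []" "red (w @ w)" and h: "k \<in> Kf.K" "q \<in> Q" "com G (k \<otimes> q) (Kf.ev w)"
  shows "\<And>s. s \<in> letters w \<Longrightarrow> com G q s" "com G q (Kf.ev w)" "com G k (Kf.ev w)"
    "\<And>g. g \<in> carrier G \<Longrightarrow> (\<And>s. s \<in> letters w \<Longrightarrow> com G g s) \<Longrightarrow> com G g k"
proof -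
  have c: "k \<in> carrier G" "q \<in> carrier G" "Kf.ev w \<in> carrier G"
    using h w K_carrier Q_carrier by auto
  have rw: "red w" using w(3) by (simp add: red_append)
  have law: "letters (act_word q w) \<subseteq> S" using letters_act_word_S h w by blast
  have "red (act_word q (w @ w))" using h w by (intro red_act_word) auto
  then have raw: "red (act_word q w @ act_word q w)" by (simp add: act_word_def)
  have "Kf.ev w = cj G k (Kf.ev (act_word q w))"
    using h w c Kf.cj_eq_self[of "k \<otimes> q" "Kf.ev w"] by (simp add: ev_act_word Kf.cj_cj)
  then have "set (act_word q w) \<subseteq> set w"
    by (rule Kf.cyc_red_conj_letters[OF law raw w(1,3) h(1)])
  then have "letters (act_word q w) \<subseteq> letters w" by blast
  then have "\<exists>N>0. \<forall>s\<in>letters w. com G (q [^] (N::nat)) s"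
    using h w by (intro finite_orbit_power) (auto simp: letters_act_word)
  then show 1: "\<And>s. s \<in> letters w \<Longrightarrow> com G q s" using stab_root w h by blast
  show 2: "com G q (Kf.ev w)" by (rule com_ev) (use 1 c w in auto)
  have "com G (Kf.ev w) k"
    by (rule Kf.com_cancel2[of _ _ q]) (use 2 c h Kf.com_sym in auto)
  then show 3: "com G k (Kf.ev w)" by (simp add: Kf.com_sym)
  show "com G g k" if "g \<in> carrier G" "\<And>s. s \<in> letters w \<Longrightarrow> com G g s" for g
    by (rule Kf.com_generate[OF _ _ _ Kf.commuting_letters[OF w h(1) 3]])
       (use that w S_carrier in auto)
qed

lemma cj_int_pow_com:
  assumes "u \<in> carrier G" "t \<in> carrier G"
  shows "com G (cj G u (t [^] (i::int))) (cj G u (t [^] (j::int)))"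
  using assms by (simp add: Kf.com_cj Kf.com_int_pows)

text \<open>Suppose \<open>w\<close> has a letter \<open>s \<noteq> z\<close>. Then the parts of
  \<open>x\<close> and \<open>y\<close> in \<open>Q\<close> lie in the cyclic stabilizer of
  \<open>s\<close>, their parts in \<open>K\<close> commute by transitivity in a free group, and the
  mixed pairs commute since each part in \<open>Q\<close> fixes all letters of \<open>w\<close>. So
  \<open>x\<close> and \<open>y\<close> would commute.\<close>

lemma nonabelian_centralizer_K:
  assumes w: "letters w \<subseteq> S" "w \<noteq> []" "red (w @ w)"
    and x: "x \<in> carrier G" "com G x (Kf.ev w)" and y: "y \<in> carrier G" "com G y (Kf.ev w)"
    and xy: "\<not> com G x y"
  shows "\<exists>n::int. Kf.ev w = z [^] n"
proof -
  obtain x1 q1 where x1: "x1 \<in> Kf.K" "q1 \<in> Q" "x = x1 \<otimes> q1" using decomp x by blast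
  obtain y1 q2 where y1: "y1 \<in> Kf.K" "q2 \<in> Q" "y = y1 \<otimes> q2" using decomp y by blast
  have c: "x1 \<in> carrier G" "q1 \<in> carrier G" "y1 \<in> carrier G" "q2 \<in> carrier G"
    using x1 y1 K_carrier Q_carrier by auto
  note cx = centralizer_of_cyc_red[OF w x1(1,2) x(2)[unfolded x1(3)]]
  note cy = centralizer_of_cyc_red[OF w y1(1,2) y(2)[unfolded y1(3)]]
  have "letters w \<subseteq> {z}"
  proof (rule ccontr)
    assume "\<not> letters w \<subseteq> {z}"
    then obtain s where s: "s \<in> letters w" "s \<noteq> z" by blast
    then obtain u t where ut: "u \<in> Q" "t \<in> T" "\<forall>q\<in>Q. com G q s \<longleftrightarrow> (\<exists>j::int. q = cj G u (t [^] j))"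
      using stab w(1) by blast
    obtain i j :: int where "q1 = cj G u (t [^] i)" "q2 = cj G u (t [^] j)"
      using ut(3) x1 y1 cx(1)[OF s(1)] cy(1)[OF s(1)] by blast
    then have qq: "com G q1 q2" using cj_int_pow_com[of u t i j] ut Q_carrier Qf.S_sub by auto
    have "Kf.ev w \<noteq> \<one>" using Kf.ev_one[of w] w by (auto simp: red_append)
    then have xy1: "com G x1 y1"
      using Kf.commuting_transitive[OF Kf.ev_K[OF w(1)]] x1 y1 cx(3) cy(3) by blast
    have "com G q2 x1" "com G q1 y1" using cx(4)[of q2] cy(4)[of q1] cx(1) cy(1) c by auto
    then have "com G x1 y" "com G q1 y"
      using c qq xy1 by (auto simp: y1(3) Kf.com_sym intro!: Kf.com_mult)
    then have "com G y x" using c y by (auto simp: x1(3) Kf.com_sym intro!: Kf.com_mult)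
    then show False using xy Kf.com_sym by auto
  qed
  then have "Kf.ev w \<in> generate G {z}" by (intro Kf.word_eval_generate) auto
  then show ?thesis using Kf.generate_pow[OF S_carrier[OF z_S]] by auto
qed

text \<open>A letter cancels only against the same generator. Since the generator of
  \<open>y\<close> is absent from \<open>C\<close>, cancellation never reaches \<open>y\<close>, and
  only the portion to the left of \<open>y\<close> changes.\<close>

lemma left_mult_keep:
  assumes "red (A @ y # B)" "letters (A @ y # B) \<subseteq> S" "letters C \<subseteq> S" "fst y \<notin> letters C"
  shows "\<exists>A'. red (A' @ y # B) \<and> letters A' \<subseteq> letters A \<union> letters C \<and>
           Kf.ev (A' @ y # B) = Kf.ev C \<otimes> Kf.ev (A @ y # B)"
  using assms(3,4)
proof (induction C)
  case Nil
  then show ?case using assms by (intro exI[of _ A]) auto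
next
  case (Cons c C)
  then obtain A' where A': "red (A' @ y # B)" "letters A' \<subseteq> letters A \<union> letters C"
    "Kf.ev (A' @ y # B) = Kf.ev C \<otimes> Kf.ev (A @ y # B)" by auto
  have lA: "letters A \<subseteq> S" "fst y \<in> S" "letters B \<subseteq> S" using assms(2) by (simp_all add: image_Un)
  have "letters A' \<subseteq> S" using subset_trans[OF A'(2)] lA Cons.prems by simp
  then have "letters (A' @ y # B) \<subseteq> S" using lA by (simp add: image_Un)
  then have l: "letters (A' @ y # B) \<subseteq> carrier G" using Kf.S_sub by (rule subset_trans)
  have cc: "fst c \<in> carrier G" "Kf.ev C \<in> carrier G" "Kf.ev (A @ y # B) \<in> carrier G"
    using Cons.prems assms(2) Kf.S_sub by (auto simp del: word_eval.simps intro: Kf.ev_closed)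
  have "Kf.ev (lcons c (A' @ y # B)) = Kf.ev (c # C) \<otimes> Kf.ev (A @ y # B)"
    using l cc A'(3) by (subst Kf.word_eval_lcons) (auto simp: Kf.m_assoc)
  moreover have yc: "y \<noteq> flip c" using Cons.prems by auto
  have "\<exists>A''. lcons c (A' @ y # B) = A'' @ y # B \<and> letters A'' \<subseteq> insert (fst c) (letters A')"
  proof (cases A')
    case Nil
    then show ?thesis using yc by (intro exI[of _ "[c]"]) (auto simp: lcons_def)
  next
    case (Cons a t)
    then show ?thesis
      by (cases "a = flip c") (auto simp: lcons_def intro: exI[of _ t] exI[of _ "c # A'"])
  qed
  then obtain A'' where A'': "lcons c (A' @ y # B) = A'' @ y # B" "letters A'' \<subseteq> insert (fst c) (letters A')" by blast
  have "letters A'' \<subseteq> letters A \<union> letters (c # C)"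
    by (rule subset_trans[OF A''(2)]) (use A'(2) in auto)
  ultimately show ?case using red_lcons[OF A'(1), of c] unfolding A''(1) by blast
qed

text \<open>Comparing the first letters of \<open>v k\<close> and \<open>k (q v q\<^sup>-\<^sup>1)\<close> that are not fixed by \<open>q\<close>.\<close>

lemma centralizer_of_twisted:
  assumes q: "q \<in> Q" and k: "letters wk \<subseteq> S" "\<And>s. s \<in> letters wk \<Longrightarrow> com G q s"
    and v: "red wv" "letters wv \<subseteq> S" "com G (Kf.ev wv) (Kf.ev wk \<otimes> q)" and s: "s \<in> letters wv"
  shows "com G q s"
proof (rule ccontr)
  assume "\<not> com G q s"
  then have "\<exists>l\<in>set wv. \<not> com G q (fst l)" using s by auto
  then obtain u l t where ult: "wv = u @ l # t" "\<not> com G q (fst l)" "\<forall>l\<in>set u. com G q (fst l)"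
    using split_list_first_prop[of wv "\<lambda>l. \<not> com G q (fst l)"] by blast
  have qc: "q \<in> carrier G" using q Q_carrier by auto
  have c: "Kf.ev wk \<in> carrier G" "Kf.ev wv \<in> carrier G" using k v by auto
  have l: "letters u \<subseteq> S" "fst l \<in> S" "letters t \<subseteq> S" using v(2) ult(1) by auto
  \<comment> \<open>\<open>left_mult_keep\<close> multiplies from the left, so the product of
    \<open>ev wv\<close> and \<open>ev wk\<close> is obtained through its inverse.\<close>
  have r1: "red (winv t @ flip l # winv u)" using v(1) red_winv[of wv] unfolding ult(1) by simp
  have l0: "letters (winv t @ flip l # winv u) \<subseteq> S" using l by (simp add: image_Un)
  have "fst (flip l) \<notin> letters (winv wk)" using k(2) ult(2) by auto
  then obtain A where A: "red (A @ flip l # winv u)" "letters A \<subseteq> letters (winv t) \<union> letters (winv wk)"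
      "Kf.ev (A @ flip l # winv u) = Kf.ev (winv wk) \<otimes> Kf.ev (winv t @ flip l # winv u)"
    using left_mult_keep[OF r1 l0, of "winv wk"] k(1) by auto
  have lA: "letters A \<subseteq> S" using subset_trans[OF A(2), of S] l(3) k(1) by simp
  have l1: "letters (A @ flip l # winv u) \<subseteq> S" using lA l by (simp add: image_Un)
  have e1: "Kf.ev (u @ l # winv A) = Kf.ev wv \<otimes> Kf.ev wk"
  proof -
    have "u @ l # winv A = winv (A @ flip l # winv u)" by simp
    then have "Kf.ev (u @ l # winv A) = inv (Kf.ev (winv wk) \<otimes> Kf.ev (winv wv))"
      using Kf.ev_winv[OF l1] A(3) ult(1) by simp
    then show ?thesis using k(1) v(2) c by (simp add: Kf.ev_winv Kf.inv_mult_group)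
  qed
  have r1': "red (u @ l # winv A)" using A(1) red_winv[of "A @ flip l # winv u"] by simp
  have act_word: "act_word q wv = act_word q u @ (cj G q (fst l), snd l) # act_word q t" by (simp add: ult(1) act_word_def)
  \<comment> \<open>The conjugated letter is not fixed by \<open>q\<close> either, because
    \<open>q\<close> commutes with itself; hence it cannot be a letter of \<open>wk\<close>.\<close>
  have nl: "\<not> com G q (cj G q (fst l))"
  proof -
    have "cj G q q = q" using qc by (simp add: Kf.cj_eq_self)
    then show ?thesis using ult(2) qc S_carrier[OF l(2)] Kf.com_cj[of q q "fst l"] by simp
  qed
  have r2: "red (act_word q u @ (cj G q (fst l), snd l) # act_word q t)" using red_act_word[OF q v(2,1)] act_word by simp
  have l2: "letters (act_word q u @ (cj G q (fst l), snd l) # act_word q t) \<subseteq> S"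
    using letters_act_word_S[OF q v(2)] act_word by simp
  have "fst (cj G q (fst l), snd l) \<notin> letters wk" using k(2) nl by auto
  then obtain B where B: "red (B @ (cj G q (fst l), snd l) # act_word q t)" "letters B \<subseteq> letters (act_word q u) \<union> letters wk"
      "Kf.ev (B @ (cj G q (fst l), snd l) # act_word q t) = Kf.ev wk \<otimes> Kf.ev (act_word q wv)"
    using left_mult_keep[OF r2 l2 k(1)] act_word by auto
  have lu: "letters (act_word q u) = letters u"
  proof -
    have "cj G q (fst l) = fst l" if "l \<in> set u" for l
      using that ult(3) l(1) Kf.cj_eq_self[OF qc S_carrier, of "fst l"] by auto
    then show ?thesis by (force simp: letters_act_word)
  qed
  have "Kf.ev wv \<otimes> Kf.ev wk = Kf.ev wk \<otimes> cj G q (Kf.ev wv)"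
  proof -
    have "(Kf.ev wv \<otimes> Kf.ev wk \<otimes> q) \<otimes> inv q = (Kf.ev wk \<otimes> q \<otimes> Kf.ev wv) \<otimes> inv q"
      using v(3) qc c by (simp add: com_def Kf.m_assoc)
    then show ?thesis using qc c by (simp add: cj_def Kf.m_assoc)
  qed
  then have "Kf.ev (u @ l # winv A) = Kf.ev (B @ (cj G q (fst l), snd l) # act_word q t)"
    using e1 B(3) ev_act_word[OF q v(2)] by simp
  moreover have "letters (u @ l # winv A) \<subseteq> S" using l lA by (simp add: image_Un)
  moreover have "letters (B @ (cj G q (fst l), snd l) # act_word q t) \<subseteq> S"
  proof -
    have "letters B \<subseteq> S" using subset_trans[OF B(2), of S] lu l(1) k(1) by simp
    then show ?thesis using l2 by (simp add: image_Un)
  qed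
  ultimately have "u @ l # winv A = B @ (cj G q (fst l), snd l) # act_word q t"
    using Kf.ev_inj[OF r1' B(1)] by blast
  \<comment> \<open>Deleting all letters fixed by \<open>q\<close> leaves \<open>l\<close> in front
    on one side and its conjugate by \<open>q\<close> in front on the other.\<close>
  then have "filter (\<lambda>l. \<not> com G q (fst l)) (u @ l # winv A) =
      filter (\<lambda>l. \<not> com G q (fst l)) (B @ (cj G q (fst l), snd l) # act_word q t)" by simp
  moreover have "filter (\<lambda>l. \<not> com G q (fst l)) u = []" "filter (\<lambda>l. \<not> com G q (fst l)) B = []"
  proof -
    have "\<forall>s\<in>letters u \<union> letters wk. com G q s" using k(2) ult(3) by auto
    then have "\<forall>s\<in>letters B. com G q s" using subsetD[OF B(2)] unfolding lu by blast
    then show "filter (\<lambda>l. \<not> com G q (fst l)) u = []" "filter (\<lambda>l. \<not> com G q (fst l)) B = []"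
      using ult(3) by (auto simp: filter_empty_conv)
  qed
  ultimately have "fst l = cj G q (fst l)" using ult(2) nl by (auto simp: prod_eq_iff)
  then show False using ult(2) Kf.cj_eq_self[OF qc S_carrier[OF l(2)]] by simp
qed

lemma com_K_letters:
  assumes "q \<in> Q" "v \<in> Kf.K" "com G q v"
  obtains w where "red w" "letters w \<subseteq> S" "v = Kf.ev w" "\<And>s. s \<in> letters w \<Longrightarrow> com G q s"
proof -
  obtain w where "red w" "letters w \<subseteq> S" "v = Kf.ev w" using Kf.K_word[OF assms(2)] .
  then show thesis using com_letters assms that by blast
qed

text \<open>The parts of \<open>x\<close> and \<open>y\<close> in the free group \<open>Q\<close>
  commute with \<open>q\<close>, hence with each other. If moreover their parts in \<open>K\<close>
  are fixed by \<open>q\<close> and commute, then \<open>x\<close> and \<open>y\<close> commute,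
  which is excluded. For \<open>k \<noteq> \<one>\<close> this happens:
  \<open>centralizer_of_twisted\<close> shows that the parts in \<open>K\<close> commute with
  \<open>q\<close>, thus with \<open>k\<close>, thus with each other. For \<open>k = \<one>\<close>
  it happens if \<open>q\<close> fixes no letter but \<open>z\<close>, since the parts in
  \<open>K\<close> are then powers of \<open>z\<close>; otherwise \<open>stab\<close> gives the
  required form of \<open>q\<close>.\<close>

lemma nonabelian_centralizer_split:
  assumes w: "letters w \<subseteq> S" "w \<noteq> []" "red (w @ w)"
    and kq: "k \<in> Kf.K" "q \<in> Q" "q \<noteq> \<one>" "com G (k \<otimes> q) (Kf.ev w)"
    and x: "x \<in> carrier G" "com G x (k \<otimes> q)" and y: "y \<in> carrier G" "com G y (k \<otimes> q)"
    and xy: "\<not> com G x y"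
  shows "k = \<one> \<and> (\<exists>u\<in>Q. \<exists>t\<in>T. \<exists>j::int. q = cj G u (t [^] j))"
proof -
  note cw = centralizer_of_cyc_red[OF w kq(1,2,4)]
  have c: "k \<in> carrier G" "q \<in> carrier G" using kq K_carrier Q_carrier by auto
  have qk: "com G q k" using cw(4)[of q] cw(1) c by blast
  obtain x1 q1 where x1: "x1 \<in> Kf.K" "q1 \<in> Q" "x = x1 \<otimes> q1" using decomp x by blast
  obtain y1 q2 where y1: "y1 \<in> Kf.K" "q2 \<in> Q" "y = y1 \<otimes> q2" using decomp y by blast
  have c1: "x1 \<in> carrier G" "q1 \<in> carrier G" "y1 \<in> carrier G" "q2 \<in> carrier G"
    using x1 y1 K_carrier Q_carrier by auto
  have pi: "\<pi> (a \<otimes> b) = b" if "a \<in> Kf.K" "b \<in> Q" for a b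
    using hom_mult[OF pi_hom, of a b] that pi_Q pi_K K_carrier Q_carrier by simp
  have piq: "com G b q" if "a \<in> Kf.K" "b \<in> Q" "com G (a \<otimes> b) (k \<otimes> q)" for a b
  proof -
    have "\<pi> (a \<otimes> b) \<otimes> \<pi> (k \<otimes> q) = \<pi> (k \<otimes> q) \<otimes> \<pi> (a \<otimes> b)"
      using that c K_carrier Q_carrier hom_mult[OF pi_hom, symmetric] by (simp add: com_def)
    then show ?thesis using that kq by (simp add: pi com_def)
  qed
  have q12: "com G q1 q" "com G q2 q" using piq x1 y1 x y by auto
  have qq: "com G q1 q2" using Qf.commuting_transitive[OF kq(2,3)] x1 y1 q12 by blast
  \<comment> \<open>A part in \<open>Q\<close> commutes with \<open>q\<close>, so by
    \<open>stab_com\<close> it fixes every letter that \<open>q\<close> fixes; this makes the mixed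
    pairs commute.\<close>
  have key: False if h: "com G q x1" "com G q y1" "com G x1 y1"
  proof -
    obtain wx where wx: "red wx" "letters wx \<subseteq> S" "x1 = Kf.ev wx" "\<And>s. s \<in> letters wx \<Longrightarrow> com G q s"
      using com_K_letters[OF kq(2) x1(1) h(1)] by blast
    obtain wy where wy: "red wy" "letters wy \<subseteq> S" "y1 = Kf.ev wy" "\<And>s. s \<in> letters wy \<Longrightarrow> com G q s"
      using com_K_letters[OF kq(2) y1(1) h(2)] by blast
    have "com G q2 x1" unfolding wx(3)
      by (rule com_ev) (use wx c1 stab_com[OF _ kq(2,3) _ y1(2) q12(2)] in auto)
    moreover have "com G q1 y1" unfolding wy(3)
      by (rule com_ev) (use wy c1 stab_com[OF _ kq(2,3) _ x1(2) q12(1)] in auto)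
    ultimately have "com G x1 y" "com G q1 y"
      using c1 qq h(3) by (auto simp: y1(3) Kf.com_sym intro!: Kf.com_mult)
    then have "com G y x" using c1 y by (auto simp: x1(3) Kf.com_sym intro!: Kf.com_mult)
    then show False using xy Kf.com_sym by auto
  qed
  show ?thesis
  proof (cases "k = \<one>")
    case True
    have comq: "com G q a" if "a \<in> Kf.K" "b \<in> Q" "com G (a \<otimes> b) (k \<otimes> q)" "com G b q" for a b
      using that c K_carrier Q_carrier True Kf.com_cancel2[of q a b] by (auto simp: Kf.com_sym)
    have qx: "com G q x1" "com G q y1" using comq x1 y1 x y q12 by auto
    show ?thesis
    proof (cases "\<exists>s\<in>S. s \<noteq> z \<and> com G q s")
      case True
      then show ?thesis using stab kq(2) \<open>k = \<one>\<close> by blast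
    next
      case False
      have "\<exists>n::int. a = z [^] n" if a: "a \<in> Kf.K" "com G q a" for a
      proof -
        obtain wa where wa: "red wa" "letters wa \<subseteq> S" "a = Kf.ev wa" "\<And>s. s \<in> letters wa \<Longrightarrow> com G q s"
          using com_K_letters[OF kq(2) a] by blast
        have "letters wa \<subseteq> {z}" using wa(2,4) False by blast
        then have "a \<in> generate G {z}" unfolding wa(3) by (intro Kf.word_eval_generate) auto
        then show ?thesis using Kf.generate_pow[OF S_carrier[OF z_S]] by auto
      qed
      then obtain i j :: int where "x1 = z [^] i" "y1 = z [^] j" using x1 y1 qx by blast
      then have "com G x1 y1" using Kf.com_int_pows[OF S_carrier[OF z_S]] by simp
      then show ?thesis using key qx by blast
    qed
  next
    case False
    obtain wk where wk: "red wk" "letters wk \<subseteq> S" "k = Kf.ev wk" "\<And>s. s \<in> letters wk \<Longrightarrow> com G q s"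
      using com_K_letters[OF kq(2,1) qk] by blast
    have *: "com G q a \<and> com G a k" if a: "a \<in> Kf.K" "b \<in> Q" "com G (a \<otimes> b) (k \<otimes> q)" "com G b q" for a b
    proof -
      have ab: "a \<in> carrier G" "b \<in> carrier G" using a K_carrier Q_carrier by auto
      have "com G b k" unfolding wk(3)
        by (rule com_ev) (use wk ab stab_com[OF _ kq(2,3) _ a(2,4)] in auto)
      then have "com G b (k \<otimes> q)" using ab c a(4) by (intro Kf.com_mult)
      then have akq: "com G a (k \<otimes> q)"
        using ab c a(3) Kf.com_cancel2[of "k \<otimes> q" a b] by (auto simp: Kf.com_sym)
      obtain wa where wa: "red wa" "letters wa \<subseteq> S" "a = Kf.ev wa" using Kf.K_word[OF a(1)] .
      have "com G q a" unfolding wa(3)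
        by (rule com_ev) (use centralizer_of_twisted[OF kq(2) wk(2,4) wa(1,2)] akq wa wk(3) c in auto)
      moreover from this have "com G a k"
        using akq ab c Kf.com_cancel2[of a k q] by (auto simp: Kf.com_sym)
      ultimately show ?thesis by simp
    qed
    have "com G q x1" "com G x1 k" "com G q y1" "com G y1 k"
      using *[of x1 q1] *[of y1 q2] x1 y1 x y q12 by auto
    moreover from this have "com G x1 y1" using Kf.commuting_transitive[OF kq(1) False] x1 y1 by blast
    ultimately show ?thesis using key by blast
  qed
qed

text \<open>For \<open>q = \<one>\<close> the element lies in \<open>K\<close>. Otherwise the
  commutator of \<open>x\<close> and \<open>y\<close> supplies what
  \<open>nonabelian_centralizer_split\<close> requires: it is nontrivial, commutes with
  \<open>g\<close>, and lies in \<open>K\<close> because the images of \<open>x\<close> and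
  \<open>y\<close> in the free group \<open>Q\<close> both commute with \<open>q\<close>.\<close>

theorem nonabelian_centralizer:
  assumes g: "g \<in> carrier G" "g \<noteq> \<one>"
    and x: "x \<in> carrier G" "com G x g" and y: "y \<in> carrier G" "com G y g" and xy: "\<not> com G x y"
  shows "\<exists>h\<in>carrier G. \<exists>t\<in>insert z T. \<exists>n::int. g = cj G h (t [^] n)"
proof -
  obtain k q where kq: "k \<in> Kf.K" "q \<in> Q" "g = k \<otimes> q" using decomp g by blast
  have c: "k \<in> carrier G" "q \<in> carrier G" using kq K_carrier Q_carrier by auto
  have conj: "com G (cj G t a) (cj G t b) = com G a b" if "t \<in> carrier G" "a \<in> carrier G" "b \<in> carrier G" for t a b
    using Kf.com_cj that by blast
  show ?thesis
  proof (cases "q = \<one>")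
    case True
    then have "g \<in> Kf.K" using kq c by simp
    then obtain w t where w: "letters w \<subseteq> S" "t \<in> Kf.K" "red (w @ w)" "g = cj G t (Kf.ev w)"
      using Kf.cyclic_reduction by blast
    have tc: "t \<in> carrier G" "Kf.ev w \<in> carrier G" using w K_carrier by auto
    have w0: "w \<noteq> []" using w g tc by auto
    have gw: "cj G (inv t) g = Kf.ev w" using w(4) tc by simp
    have "\<exists>n::int. Kf.ev w = z [^] n"
      by (rule nonabelian_centralizer_K[OF w(1) w0 w(3), of "cj G (inv t) x" "cj G (inv t) y"])
        (use x y xy g tc conj[of "inv t"] gw[symmetric] in auto)
    then obtain n :: int where "g = cj G t (z [^] n)" using w(4) by auto
    then show ?thesis using tc(1) by blast
  next
    case False
    define k' where "k' = x \<otimes> y \<otimes> inv x \<otimes> inv y"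
    have k'c: "k' \<in> carrier G" using x y by (simp add: k'_def)
    have xyc: "x \<in> carrier G" "y \<in> carrier G" using x y by auto
    have k'1: "k' \<noteq> \<one>"
    proof
      assume "k' = \<one>"
      then have "k' \<otimes> (y \<otimes> x) = y \<otimes> x" using xyc by simp
      then show False using xy xyc by (simp add: k'_def com_def Kf.m_assoc)
    qed
    have gk': "com G g k'" unfolding k'_def
      using x y g by (intro Kf.com_mult Kf.com_inv) (auto simp: Kf.com_sym)
    have pig: "group_hom G G \<pi>"
      using pi_hom Kf.is_group by (simp add: group_hom_def group_hom_axioms_def)
    have pc: "\<pi> v \<in> Q \<and> com G (\<pi> v) q" if v: "v \<in> carrier G" "com G v g" for v
    proof -
      obtain a b where ab: "a \<in> Kf.K" "b \<in> Q" "v = a \<otimes> b" using decomp v by blast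
      have "\<pi> v = b" "\<pi> g = q" using ab kq hom_mult[OF pi_hom] K_carrier Q_carrier pi_K pi_Q by auto
      moreover have "\<pi> v \<otimes> \<pi> g = \<pi> g \<otimes> \<pi> v"
        using v g hom_mult[OF pi_hom, symmetric] by (simp add: com_def)
      ultimately show ?thesis using ab by (simp add: com_def)
    qed
    have "com G (\<pi> x) (\<pi> y)" using Qf.commuting_transitive[OF kq(2) False] pc[OF x] pc[OF y] by blast
    moreover have pxy: "\<pi> x \<in> carrier G" "\<pi> y \<in> carrier G" using pc x y Q_carrier by auto
    moreover have "\<pi> k' = \<pi> x \<otimes> \<pi> y \<otimes> inv (\<pi> x) \<otimes> inv (\<pi> y)"
      unfolding k'_def using xyc hom_mult[OF pi_hom] group_hom.hom_inv[OF pig] by simp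
    ultimately have "\<pi> k' = \<pi> y \<otimes> \<pi> x \<otimes> inv (\<pi> x) \<otimes> inv (\<pi> y)"
      by (simp add: com_def)
    then have pk': "\<pi> k' = \<one>" using pxy by (simp add: Kf.m_assoc)
    have "k' \<in> Kf.K"
    proof -
      obtain a b where ab: "a \<in> Kf.K" "b \<in> Q" "k' = a \<otimes> b" using decomp k'c by blast
      then have "\<pi> k' = b" using hom_mult[OF pi_hom] K_carrier Q_carrier pi_K pi_Q by auto
      then show ?thesis using ab pk' K_carrier by simp
    qed
    then obtain w t where w: "letters w \<subseteq> S" "t \<in> Kf.K" "red (w @ w)" "k' = cj G t (Kf.ev w)"
      using Kf.cyclic_reduction by blast
    have tc: "t \<in> carrier G" "Kf.ev w \<in> carrier G" using w K_carrier by auto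
    have w0: "w \<noteq> []" using w k'1 tc by auto
    have kw: "cj G (inv t) k' = Kf.ev w" using w(4) tc by simp
    have ti: "inv t \<in> Kf.K" using w Kf.K_subgroup by (simp add: subgroup.m_inv_closed)
    obtain k2 q2 where k2: "k2 \<in> Kf.K" "q2 \<in> Q" "cj G (inv t) g = k2 \<otimes> q2"
      using decomp[of "cj G (inv t) g"] g(1) tc(1) by (metis Kf.cj_closed Kf.inv_closed)
    \<comment> \<open>Conjugation by an element of \<open>K\<close> does not change the component in
      \<open>Q\<close>, since \<open>\<pi>\<close> kills \<open>K\<close>.\<close>
    have "q2 = \<pi> (cj G (inv t) g)"
      using k2 hom_mult[OF pi_hom, of k2 q2] K_carrier Q_carrier by (simp add: pi_K pi_Q)
    also have "\<dots> = q" using tc g kq c w(2) ti K_carrier Q_carrier hom_mult[OF pi_hom] pi_K pi_Q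
      by (simp add: cj_def)
    finally have q2: "q2 \<noteq> \<one>" using False by simp
    have "k2 = \<one> \<and> (\<exists>u\<in>Q. \<exists>t\<in>T. \<exists>j::int. q2 = cj G u (t [^] j))"
      by (rule nonabelian_centralizer_split[OF w(1) w0 w(3) k2(1,2) q2, of "cj G (inv t) x" "cj G (inv t) y"])
        (use x y xy g tc conj[of "inv t"] kw[symmetric] k2(3)[symmetric] gk' k'c in auto)
    then obtain u s j where usj: "k2 = \<one>" "u \<in> Q" "s \<in> T" "q2 = cj G u (s [^] (j::int))" by blast
    have uc: "u \<in> carrier G" "s \<in> carrier G" using usj Q_carrier Qf.S_sub by auto
    have "g = cj G t (cj G (inv t) g)" using tc g by simp
    also have "\<dots> = cj G (t \<otimes> u) (s [^] j)" using k2(3) usj uc tc by (simp add: Kf.cj_cj)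
    finally show ?thesis using usj uc tc by blast
  qed
qed

end

section \<open>The universal property of right-angled Artin groups\<close>

lemma lists_letters: "w \<in> lists (V \<times> UNIV) \<longleftrightarrow> letters w \<subseteq> V"
  by (auto simp: lists_eq_set)

lemma raag_step_lists: "raag_step V E \<subseteq> lists (V \<times> UNIV) \<times> lists (V \<times> UNIV)"
  by (auto simp: raag_step_def)

lemma raag_rel_induct [consumes 1, case_names refl step sym trans]:
  assumes "(u, v) \<in> raag_rel V E"
    and "\<And>u. u \<in> lists (V \<times> UNIV) \<Longrightarrow> P u u"
    and "\<And>u v. (u, v) \<in> raag_step V E \<Longrightarrow> P u v"
    and "\<And>u v. P u v \<Longrightarrow> P v u"
    and "\<And>u v w. P u v \<Longrightarrow> P v w \<Longrightarrow> P u w"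
  shows "P u v"
proof -
  have "P u v" if "(u, v) \<in> (raag_step V E \<union> (raag_step V E)\<inverse>)\<^sup>+" for u v
    using that by (induction rule: trancl_induct) (use assms(3-5) in blast)+
  then show ?thesis using assms(1,2) unfolding raag_rel_def by blast
qed

lemma trans_Id_on_Un: "trans r \<Longrightarrow> trans (Id_on A \<union> r)"
  by (auto simp: trans_def)

lemma raag_rel_equiv: "equiv (lists (V \<times> UNIV)) (raag_rel V E)"
proof (rule equivI)
  let ?R = "raag_step V E \<union> (raag_step V E)\<inverse>"
  have "?R \<subseteq> lists (V \<times> UNIV) \<times> lists (V \<times> UNIV)" using raag_step_lists[of V E] by blast
  then have "?R\<^sup>+ \<subseteq> lists (V \<times> UNIV) \<times> lists (V \<times> UNIV)" by (rule trancl_subset_Sigma)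
  then show "raag_rel V E \<subseteq> lists (V \<times> UNIV) \<times> lists (V \<times> UNIV)" unfolding raag_rel_def by blast
  show "refl_on (lists (V \<times> UNIV)) (raag_rel V E)" by (auto simp: refl_on_def raag_rel_def)
  have "sym (?R\<^sup>+)" by (intro sym_trancl) (auto simp: sym_def)
  then show "sym (raag_rel V E)" unfolding raag_rel_def by (auto simp: sym_def)
  have "trans (?R\<^sup>+)" by (rule trans_trancl)
  then show "trans (raag_rel V E)" unfolding raag_rel_def by (rule trans_Id_on_Un)
qed

lemma raag_step_context:
  assumes "(u, v) \<in> raag_step V E" "x \<in> lists (V \<times> UNIV)" "y \<in> lists (V \<times> UNIV)"
  shows "(x @ u @ y, x @ v @ y) \<in> raag_step V E"
proof -
  from assms(1) consider
    (1) xs ys a b where "u = xs @ [(a, b), (a, \<not> b)] @ ys" "v = xs @ ys"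
      "xs \<in> lists (V \<times> UNIV)" "ys \<in> lists (V \<times> UNIV)" "a \<in> V"
  | (2) xs ys a b c d where "u = xs @ [(a, b), (c, d)] @ ys" "v = xs @ [(c, d), (a, b)] @ ys"
      "xs \<in> lists (V \<times> UNIV)" "ys \<in> lists (V \<times> UNIV)" "a \<in> V" "c \<in> V" "E a c"
    unfolding raag_step_def by blast
  then show ?thesis
  proof cases
    case 1
    have "(x @ u @ y, x @ v @ y) = ((x @ xs) @ [(a, b), (a, \<not> b)] @ (ys @ y), (x @ xs) @ (ys @ y))"
      using 1 by simp
    moreover have "x @ xs \<in> lists (V \<times> UNIV)" "ys @ y \<in> lists (V \<times> UNIV)"
      using 1 assms by simp_all
    ultimately show ?thesis unfolding raag_step_def using 1(5) by blast
  next
    case 2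
    have "(x @ u @ y, x @ v @ y) = ((x @ xs) @ [(a, b), (c, d)] @ (ys @ y), (x @ xs) @ [(c, d), (a, b)] @ (ys @ y))"
      using 2 by simp
    moreover have "x @ xs \<in> lists (V \<times> UNIV)" "ys @ y \<in> lists (V \<times> UNIV)"
      using 2 assms by simp_all
    ultimately show ?thesis unfolding raag_step_def using 2(5-7) by blast
  qed
qed

lemma raag_rel_context:
  assumes "(u, v) \<in> raag_rel V E" "x \<in> lists (V \<times> UNIV)" "y \<in> lists (V \<times> UNIV)"
  shows "(x @ u @ y, x @ v @ y) \<in> raag_rel V E"
  using assms(1)
proof (induction rule: raag_rel_induct)
  case (refl u)
  then show ?case using assms unfolding raag_rel_def by (intro UnI1 Id_onI) simp
next
  case (step u v)
  then show ?case using raag_step_context[OF _ assms(2,3)] unfolding raag_rel_def by blast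
next
  case (sym u v)
  then show ?case using raag_rel_equiv by (meson equivE symE)
next
  case (trans u v w)
  then show ?case using raag_rel_equiv by (meson equivE transE)
qed

section \<open>The group structure on classes of words\<close>

definition word_class :: "'a set \<Rightarrow> ('a \<Rightarrow> 'a \<Rightarrow> bool) \<Rightarrow> ('a \<times> bool) list \<Rightarrow> ('a \<times> bool) list set" where
  "word_class V E w = raag_rel V E `` {w}"

definition vgen :: "'a set \<Rightarrow> ('a \<Rightarrow> 'a \<Rightarrow> bool) \<Rightarrow> 'a \<Rightarrow> ('a \<times> bool) list set" where
  "vgen V E v = word_class V E [(v, True)]"

lemma word_class_eq_iff:
  "u \<in> lists (V \<times> UNIV) \<Longrightarrow> v \<in> lists (V \<times> UNIV) \<Longrightarrow> word_class V E u = word_class V E v \<longleftrightarrow> (u, v) \<in> raag_rel V E"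
  unfolding word_class_def by (rule eq_equiv_class_iff[OF raag_rel_equiv])

lemma word_class_step: "(u, v) \<in> raag_step V E \<Longrightarrow> word_class V E u = word_class V E v"
  using raag_step_lists[of V E] by (subst word_class_eq_iff) (auto simp: raag_rel_def)

lemma RAAG_carrier: "carrier (RAAG V E) = word_class V E ` lists (V \<times> UNIV)"
  by (auto simp: RAAG_def quotient_def word_class_def)

lemma RAAG_one: "\<one>\<^bsub>RAAG V E\<^esub> = word_class V E []"
  by (simp add: RAAG_def word_class_def)

lemma RAAG_mult:
  assumes "u \<in> lists (V \<times> UNIV)" "v \<in> lists (V \<times> UNIV)"
  shows "word_class V E u \<otimes>\<^bsub>RAAG V E\<^esub> word_class V E v = word_class V E (u @ v)"
proof -
  have "congruent2 (raag_rel V E) (raag_rel V E) (\<lambda>x y. raag_rel V E `` {x @ y})"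
  proof (rule congruent2I'[where ?f = "\<lambda>x y. raag_rel V E `` {x @ y}"])
    fix y1 z1 y2 z2 assume *: "(y1, z1) \<in> raag_rel V E" "(y2, z2) \<in> raag_rel V E"
    then have l: "y1 \<in> lists (V \<times> UNIV)" "z1 \<in> lists (V \<times> UNIV)" "y2 \<in> lists (V \<times> UNIV)" "z2 \<in> lists (V \<times> UNIV)"
      using equiv_type[OF raag_rel_equiv, of V E] by auto
    have "(y1 @ y2, z1 @ y2) \<in> raag_rel V E" using raag_rel_context[OF *(1), of "[]" y2] l by simp
    moreover have "(z1 @ y2, z1 @ z2) \<in> raag_rel V E" using raag_rel_context[OF *(2), of z1 "[]"] l by simp
    ultimately have "(y1 @ y2, z1 @ z2) \<in> raag_rel V E" using raag_rel_equiv by (meson equivE transE)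
    then show "raag_rel V E `` {y1 @ y2} = raag_rel V E `` {z1 @ z2}"
      by (rule equiv_class_eq[OF raag_rel_equiv])
  qed
  from UN_equiv_class2[OF raag_rel_equiv raag_rel_equiv this assms]
  show ?thesis by (simp add: RAAG_def word_class_def)
qed

lemma winv_lists: "u \<in> lists (V \<times> UNIV) \<Longrightarrow> winv u \<in> lists (V \<times> UNIV)"
  by (simp add: lists_letters)

lemma raag_step_cancel:
  "xs \<in> lists (V \<times> UNIV) \<Longrightarrow> ys \<in> lists (V \<times> UNIV) \<Longrightarrow> a \<in> V \<Longrightarrow>
    (xs @ [(a, b), (a, \<not> b)] @ ys, xs @ ys) \<in> raag_step V E"
  unfolding raag_step_def by blast

lemma RAAG_inverse: "u \<in> lists (V \<times> UNIV) \<Longrightarrow> word_class V E (winv u @ u) = word_class V E []"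
proof (induction u)
  case (Cons a u)
  have "(winv u @ [(fst a, \<not> snd a), (fst a, \<not> \<not> snd a)] @ u, winv u @ u) \<in> raag_step V E"
    using Cons.prems winv_lists[of u V] by (intro raag_step_cancel) auto
  then have "(winv u @ [flip a, a] @ u, winv u @ u) \<in> raag_step V E" by (simp add: flip_def)
  then have "word_class V E (winv u @ [flip a, a] @ u) = word_class V E (winv u @ u)" by (rule word_class_step)
  then show ?case using Cons by simp
qed simp

lemma raag_group: "group (RAAG V E)"
proof (rule groupI)
  fix A B C assume "A \<in> carrier (RAAG V E)" "B \<in> carrier (RAAG V E)" "C \<in> carrier (RAAG V E)"
  then obtain u v w where uvw: "u \<in> lists (V \<times> UNIV)" "v \<in> lists (V \<times> UNIV)" "w \<in> lists (V \<times> UNIV)"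
    "A = word_class V E u" "B = word_class V E v" "C = word_class V E w" unfolding RAAG_carrier by blast
  then have "u @ v \<in> lists (V \<times> UNIV)" "v @ w \<in> lists (V \<times> UNIV)" by auto
  then show "A \<otimes>\<^bsub>RAAG V E\<^esub> B \<otimes>\<^bsub>RAAG V E\<^esub> C = A \<otimes>\<^bsub>RAAG V E\<^esub> (B \<otimes>\<^bsub>RAAG V E\<^esub> C)"
    using uvw by (simp add: RAAG_mult)
next
  fix A B assume "A \<in> carrier (RAAG V E)" "B \<in> carrier (RAAG V E)"
  then obtain u v where "u \<in> lists (V \<times> UNIV)" "v \<in> lists (V \<times> UNIV)"
    "A = word_class V E u" "B = word_class V E v" unfolding RAAG_carrier by blast
  then show "A \<otimes>\<^bsub>RAAG V E\<^esub> B \<in> carrier (RAAG V E)"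
    by (auto simp: RAAG_mult RAAG_carrier)
next
  show "\<one>\<^bsub>RAAG V E\<^esub> \<in> carrier (RAAG V E)" by (auto simp: RAAG_carrier RAAG_one)
next
  fix A assume "A \<in> carrier (RAAG V E)"
  then obtain u where u: "u \<in> lists (V \<times> UNIV)" "A = word_class V E u" unfolding RAAG_carrier by blast
  then show "\<one>\<^bsub>RAAG V E\<^esub> \<otimes>\<^bsub>RAAG V E\<^esub> A = A" by (simp add: RAAG_one RAAG_mult)
  show "\<exists>B\<in>carrier (RAAG V E). B \<otimes>\<^bsub>RAAG V E\<^esub> A = \<one>\<^bsub>RAAG V E\<^esub>"
    using u winv_lists[of u V]
    by (intro bexI[of _ "word_class V E (winv u)"]) (auto simp: RAAG_mult RAAG_inverse RAAG_one RAAG_carrier)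
qed

lemma vgen_carrier: "v \<in> V \<Longrightarrow> vgen V E v \<in> carrier (RAAG V E)"
  by (auto simp: vgen_def RAAG_carrier)

lemma inv_vgen:
  assumes "v \<in> V" shows "inv\<^bsub>RAAG V E\<^esub> (vgen V E v) = word_class V E [(v, False)]"
proof (rule group.inv_equality[OF raag_group])
  have "word_class V E (winv [(v, True)] @ [(v, True)]) = word_class V E []"
    using assms by (intro RAAG_inverse) auto
  then show "word_class V E [(v, False)] \<otimes>\<^bsub>RAAG V E\<^esub> vgen V E v = \<one>\<^bsub>RAAG V E\<^esub>"
    using assms by (simp add: vgen_def RAAG_mult RAAG_one flip_pair)
qed (use assms in \<open>auto simp: vgen_carrier, auto simp: RAAG_carrier\<close>)

lemma word_class_word_eval: "w \<in> lists (V \<times> UNIV) \<Longrightarrow> word_class V E w = word_eval (RAAG V E) (vgen V E) w"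
proof (induction w)
  case (Cons a w)
  have "ltr (RAAG V E) (vgen V E) a = word_class V E [a]"
    using Cons.prems inv_vgen[of "fst a" V E] by (cases a) (auto simp: ltr_def vgen_def)
  then show ?case using Cons RAAG_mult[of "[a]" V w E] by auto
qed (simp add: RAAG_one)

lemma raag_generated: "carrier (RAAG V E) = generate (RAAG V E) (vgen V E ` V)"
proof
  show "carrier (RAAG V E) \<subseteq> generate (RAAG V E) (vgen V E ` V)"
  proof
    fix A assume "A \<in> carrier (RAAG V E)"
    then obtain w where "w \<in> lists (V \<times> UNIV)" "A = word_class V E w" unfolding RAAG_carrier by blast
    then show "A \<in> generate (RAAG V E) (vgen V E ` V)"
      using group.word_eval_generate[OF raag_group[of V E], of "vgen V E" w "vgen V E ` V"]
      by (auto simp: word_class_word_eval lists_letters image_mono)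
  qed
  show "generate (RAAG V E) (vgen V E ` V) \<subseteq> carrier (RAAG V E)"
    using vgen_carrier by (intro group.generate_incl[OF raag_group]) auto
qed

lemma raag_com:
  assumes "a \<in> V" "c \<in> V" "E a c"
  shows "com (RAAG V E) (vgen V E a) (vgen V E c)"
proof -
  have "([] @ [(a, True), (c, True)] @ [], [] @ [(c, True), (a, True)] @ []) \<in> raag_step V E"
    using assms unfolding raag_step_def by blast
  then show ?thesis using assms word_class_step by (fastforce simp: com_def vgen_def RAAG_mult)
qed

lemma (in group) word_eval_raag_rel:
  assumes f: "f ` V \<subseteq> carrier G" and E: "\<And>a c. a \<in> V \<Longrightarrow> c \<in> V \<Longrightarrow> E a c \<Longrightarrow> com G (f a) (f c)"
    and "(u, v) \<in> raag_rel V E"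
  shows "word_eval G f u = word_eval G f v"
  using assms(3)
proof (induction rule: raag_rel_induct)
  case (step u v)
  have cl: "f ` letters w \<subseteq> carrier G" if "w \<in> lists (V \<times> UNIV)" for w
    using that f by (auto simp: lists_letters)
  from step consider
    (1) xs ys a b where "u = xs @ [(a, b), (a, \<not> b)] @ ys" "v = xs @ ys"
      "xs \<in> lists (V \<times> UNIV)" "ys \<in> lists (V \<times> UNIV)" "a \<in> V"
  | (2) xs ys a b c d where "u = xs @ [(a, b), (c, d)] @ ys" "v = xs @ [(c, d), (a, b)] @ ys"
      "xs \<in> lists (V \<times> UNIV)" "ys \<in> lists (V \<times> UNIV)" "a \<in> V" "c \<in> V" "E a c"
    unfolding raag_step_def by blast
  then show ?case
  proof cases
    case 1
    have fa: "f a \<in> carrier G" using f 1 by auto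
    have "word_eval G f u = word_eval G f xs \<otimes> word_eval G f ([(a, b), (a, \<not> b)] @ ys)"
      unfolding 1 using cl[OF 1(3)] cl[OF 1(4)] fa by (intro word_eval_append) auto
    also have "word_eval G f ([(a, b), (a, \<not> b)] @ ys) = word_eval G f ys"
      using cl[OF 1(4)] fa by (cases b) (auto simp: ltr_def)
    also have "word_eval G f xs \<otimes> word_eval G f ys = word_eval G f v"
      unfolding 1 using cl[OF 1(3)] cl[OF 1(4)] by (intro word_eval_append[symmetric]) auto
    finally show ?thesis .
  next
    case 2
    have fa: "f a \<in> carrier G" "f c \<in> carrier G" using f 2 by auto
    have ac: "com G (f a) (f c)" using E 2 by blast
    have i: "com G x (inv y)" "com G (inv y) x" if "com G x y" "x \<in> carrier G" "y \<in> carrier G" for x y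
      using com_inv that com_sym by auto
    have "com G (ltr G f (a, b)) (ltr G f (c, d))"
      using ac fa i[of "f a" "f c"] i[of "f c" "f a"] i[of "inv (f a)" "f c"]
      by (auto simp: ltr_def com_sym)
    then have "word_eval G f ([(a, b), (c, d)] @ ys) = word_eval G f ([(c, d), (a, b)] @ ys)"
      using cl[OF 2(4)] fa by (simp add: com_def flip: m_assoc)
    moreover have "word_eval G f u = word_eval G f xs \<otimes> word_eval G f ([(a, b), (c, d)] @ ys)"
      unfolding 2 using cl[OF 2(3)] cl[OF 2(4)] fa by (intro word_eval_append) auto
    moreover have "word_eval G f v = word_eval G f xs \<otimes> word_eval G f ([(c, d), (a, b)] @ ys)"
      unfolding 2 using cl[OF 2(3)] cl[OF 2(4)] fa by (intro word_eval_append) auto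
    ultimately show ?thesis by simp
  qed
qed auto

theorem raag_universal:
  assumes "group L" and f: "\<And>v. v \<in> V \<Longrightarrow> f v \<in> carrier L"
    and E: "\<And>a c. a \<in> V \<Longrightarrow> c \<in> V \<Longrightarrow> E a c \<Longrightarrow> com L (f a) (f c)"
  obtains h where "h \<in> hom (RAAG V E) L" "\<And>v. v \<in> V \<Longrightarrow> h (vgen V E v) = f v"
proof -
  interpret L: group L by fact
  have fV: "f ` V \<subseteq> carrier L" using f by auto
  \<comment> \<open>Any representative may be chosen: by \<open>word_eval_raag_rel\<close> the value
    in \<open>L\<close> depends on the class only.\<close>
  define h where "h A = word_eval L f (SOME w. w \<in> A)" for A
  have h: "h (word_class V E u) = word_eval L f u" if u: "u \<in> lists (V \<times> UNIV)" for u
  proof -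
    have "u \<in> word_class V E u" using equiv_class_self[OF raag_rel_equiv u] by (simp add: word_class_def)
    then have "(SOME w. w \<in> word_class V E u) \<in> word_class V E u" by (rule someI)
    then have "(u, SOME w. w \<in> word_class V E u) \<in> raag_rel V E" by (simp add: word_class_def)
    from L.word_eval_raag_rel[OF fV E this] show ?thesis by (simp add: h_def)
  qed
  have cl: "f ` letters w \<subseteq> carrier L" if "w \<in> lists (V \<times> UNIV)" for w
    using that f by (auto simp: lists_letters)
  have "h \<in> hom (RAAG V E) L"
  proof (rule homI)
    fix A assume "A \<in> carrier (RAAG V E)"
    then obtain u where "u \<in> lists (V \<times> UNIV)" "A = word_class V E u" unfolding RAAG_carrier by blast
    then show "h A \<in> carrier L" using h cl by simp
  next
    fix A B assume "A \<in> carrier (RAAG V E)" "B \<in> carrier (RAAG V E)"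
    then obtain u v where uv: "u \<in> lists (V \<times> UNIV)" "v \<in> lists (V \<times> UNIV)"
      "A = word_class V E u" "B = word_class V E v" unfolding RAAG_carrier by blast
    then have "u @ v \<in> lists (V \<times> UNIV)" by simp
    then show "h (A \<otimes>\<^bsub>RAAG V E\<^esub> B) = h A \<otimes>\<^bsub>L\<^esub> h B"
      using uv cl by (simp add: RAAG_mult h L.word_eval_append)
  qed
  moreover have "h (vgen V E v) = f v" if "v \<in> V" for v
    using that f by (simp add: vgen_def h ltr_def)
  ultimately show thesis using that by blast
qed

section \<open>The properties of the tree groups on which the counting argument rests\<close>

text \<open>\<open>P 0\<close> is the generator of the centre, \<open>P 1\<close> and \<open>P 2\<close> are those of the two branch vertices.\<close>

locale tree_raag = group G for G (structure) +
  fixes P :: "nat \<Rightarrow> 'a"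
  assumes P_carrier: "i \<le> 2 \<Longrightarrow> P i \<in> carrier G"
    and pow_conj: "\<lbrakk>i \<le> 2; j \<le> 2; g \<in> carrier G; (k::int) \<noteq> 0; cj G g (P i [^] k) = P j [^] (l::int)\<rbrakk> \<Longrightarrow> i = j \<and> k = l"
    and pow_centralizer: "\<lbrakk>i \<le> 2; g \<in> carrier G; (k::int) \<noteq> 0; com G g (P i [^] k)\<rbrakk> \<Longrightarrow> com G g (P i)"
    and nonabelian_centralizer: "\<lbrakk>g \<in> carrier G; g \<noteq> \<one>; x \<in> carrier G; y \<in> carrier G; com G x g; com G y g; \<not> com G x y\<rbrakk>
      \<Longrightarrow> \<exists>h\<in>carrier G. \<exists>i\<le>2. \<exists>k::int. k \<noteq> 0 \<and> g = cj G h (P i [^] k)"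
    and noncommuting_powers: "i \<le> 2 \<Longrightarrow> \<exists>x\<in>carrier G. \<exists>y\<in>carrier G. com G x (P i) \<and> com G y (P i) \<and>
      (\<forall>k>0. \<not> com G (x [^] (k::nat)) (y [^] k))"
    and adjacent: "\<lbrakk>i \<le> 2; j \<le> 2; g \<in> carrier G; h \<in> carrier G; com G (cj G g (P i)) (cj G h (P j)); cj G g (P i) \<noteq> cj G h (P j)\<rbrakk>
      \<Longrightarrow> (i = 0) \<noteq> (j = 0) \<and> (\<exists>u\<in>carrier G. cj G u (P i) = cj G g (P i) \<and> cj G u (P j) = cj G h (P j))"
    and P_com: "i \<le> 2 \<Longrightarrow> com G (P 0) (P i)"
    and edge_group: "\<lbrakk>i \<in> {1, 2}; x \<in> carrier G; com G x (P 0); com G x (P i)\<rbrakk> \<Longrightarrow> \<exists>(k::int) (l::int). x = P 0 [^] k \<otimes> P i [^] l"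
    and generated: "carrier G \<subseteq> generate G {s \<in> carrier G. \<exists>i\<le>2. com G s (P i)}"

section \<open>The structure of the groups of the trees\<close>

lemma hom_eq_on_generate:
  assumes "group G" "group L" "h \<in> hom G L" "h' \<in> hom G L" "Y \<subseteq> carrier G" "\<And>x. x \<in> Y \<Longrightarrow> h x = h' x"
    and "g \<in> generate G Y"
  shows "h g = h' g"
proof -
  interpret h: group_hom G L h using assms by (simp add: group_hom_def group_hom_axioms_def)
  interpret h': group_hom G L h' using assms by (simp add: group_hom_def group_hom_axioms_def)
  show ?thesis using assms(7)
  proof (induction rule: generate.induct)
    case (eng x y)
    then have "x \<in> carrier G" "y \<in> carrier G" using group.generate_in_carrier[OF assms(1,5)] by auto
    then show ?case using eng by simp
  qed (use assms in \<open>auto simp: subset_iff\<close>)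
qed

section \<open>Freeness from an action on reduced words\<close>

context
  fixes \<Omega> :: "('a \<times> bool) list set" and S :: "'a set"
  assumes \<Omega>: "\<Omega> = {w. red w \<and> letters w \<subseteq> S}"
begin

text \<open>Restricted to \<open>\<Omega>\<close> because the elements of \<open>BijGroup\<close>
  are extensional functions.\<close>

definition lmult :: "'a \<times> bool \<Rightarrow> ('a \<times> bool) list \<Rightarrow> ('a \<times> bool) list" where
  "lmult l = restrict (lcons l) \<Omega>"

lemma lcons_\<Omega>: "fst l \<in> S \<Longrightarrow> w \<in> \<Omega> \<Longrightarrow> lcons l w \<in> \<Omega>"
  using subset_trans[OF letters_lcons[of l w], of S] by (auto simp: \<Omega> red_lcons)

lemma lcons_cancel: "w \<in> \<Omega> \<Longrightarrow> lcons l (lcons (flip l) w) = w" "w \<in> \<Omega> \<Longrightarrow> lcons (flip l) (lcons l w) = w"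
  using lcons_lcons_flip[of w l] lcons_lcons_flip[of w "flip l"] by (auto simp: \<Omega>)

lemma lmult_Bij: "fst l \<in> S \<Longrightarrow> lmult l \<in> carrier (BijGroup \<Omega>)"
proof -
  assume l: "fst l \<in> S"
  have "bij_betw (lcons l) \<Omega> \<Omega>"
    by (rule bij_betw_byWitness[where f' = "lcons (flip l)"])
       (use l lcons_\<Omega>[of l] lcons_\<Omega>[of "flip l"] in \<open>auto simp: lcons_cancel\<close>)
  then show ?thesis by (simp add: BijGroup_def Bij_def lmult_def bij_betw_restrict_eq)
qed

lemma lmult_flip:
  assumes "fst l \<in> S" shows "inv\<^bsub>BijGroup \<Omega>\<^esub> (lmult l) = lmult (flip l)"
proof (rule group.inv_equality[OF group_BijGroup])
  have B: "lmult (flip l) \<in> Bij \<Omega>" "lmult l \<in> Bij \<Omega>"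
    using lmult_Bij[of "flip l"] lmult_Bij[of l] assms by (simp_all add: BijGroup_def)
  have "compose \<Omega> (lmult (flip l)) (lmult l) = (\<lambda>x\<in>\<Omega>. x)"
    using assms lcons_\<Omega>[of l] by (auto simp: compose_def lmult_def lcons_cancel fun_eq_iff)
  then show "lmult (flip l) \<otimes>\<^bsub>BijGroup \<Omega>\<^esub> lmult l = \<one>\<^bsub>BijGroup \<Omega>\<^esub>"
    using B by (simp add: BijGroup_def)
qed (use lmult_Bij assms in auto)

text \<open>Van der Waerden's trick: if \<open>G\<close> acts on the reduced words over \<open>S\<close> by left multiplication,
  then a reduced word can be recovered from its value by acting on the empty word.\<close>

lemma free_in_by_action:
  assumes "group G" "S \<subseteq> carrier G" "\<psi> \<in> hom G (BijGroup \<Omega>)" "\<And>s. s \<in> S \<Longrightarrow> \<psi> s = lmult (s, True)"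
  shows "free_in G S"
proof -
  interpret group G by fact
  interpret h: group_hom G "BijGroup \<Omega>" \<psi>
    using assms group_BijGroup by (simp add: group_hom_def group_hom_axioms_def)
  have l: "\<psi> (ltr G (\<lambda>x. x) l) = lmult l" if "fst l \<in> S" for l
    using that assms(2,4) lmult_flip[of "(fst l, True)"] by (cases l) (auto simp: ltr_def flip_def subsetD)
  have *: "\<psi> (word_eval G (\<lambda>x. x) w) [] = w" if "w \<in> \<Omega>" for w
    using that
  proof (induction w)
    case Nil
    then show ?case by (simp add: BijGroup_def)
  next
    case (Cons a w)
    have w: "w \<in> \<Omega>" "fst a \<in> S" "red (a # w)" using Cons.prems by (auto simp: \<Omega> red_Cons)
    have c: "word_eval G (\<lambda>x. x) w \<in> carrier G" "fst a \<in> carrier G" using w assms(2) by (auto simp: \<Omega> intro: word_eval_closed)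
    have 0: "[] \<in> \<Omega>" by (simp add: \<Omega>)
    have "\<psi> (word_eval G (\<lambda>x. x) (a # w)) = lmult a \<otimes>\<^bsub>BijGroup \<Omega>\<^esub> \<psi> (word_eval G (\<lambda>x. x) w)"
      using c l w by simp
    then have "\<psi> (word_eval G (\<lambda>x. x) (a # w)) [] = lmult a (\<psi> (word_eval G (\<lambda>x. x) w) [])"
      using lmult_Bij[of a] w h.hom_closed[OF c(1)] 0 by (simp add: BijGroup_def compose_def)
    then show ?case using Cons.IH w by (simp add: lmult_def lcons_red)
  qed
  show ?thesis
  proof
    show "S \<subseteq> carrier G" by fact
    fix u v assume "red u" "red v" "letters u \<subseteq> S" "letters v \<subseteq> S" "word_eval G (\<lambda>x. x) u = word_eval G (\<lambda>x. x) v"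
    moreover from this have "u \<in> \<Omega>" "v \<in> \<Omega>" unfolding \<Omega> by blast+
    ultimately show "u = v" by (metis *)
  qed
qed

end

section \<open>The splitting of the group of the tree into K and Q\<close>

locale P_raag =
  fixes d1 d2 :: nat and G (structure)
  assumes d_pos: "0 < d1" "0 < d2"
    and G_eq: "G = RAAG_P d1 d2"
begin

abbreviation "gen \<equiv> vgen (P_verts d1 d2) (P_edge d1 d2)"

definition leaves :: "nat \<Rightarrow> nat set" where
  "leaves i = (if i = 1 then {3..d1 + 2} else {d1 + 3..d1 + d2 + 2})"

lemma verts: "P_verts d1 d2 = {0, 1, 2} \<union> leaves 1 \<union> leaves 2"
  by (auto simp: P_verts_def leaves_def)

lemma leaves_simps [simp]: "0 \<notin> leaves i" "Suc 0 \<notin> leaves i" "2 \<notin> leaves i"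
  by (auto simp: leaves_def)

lemma leaf_not: "v \<in> leaves i \<Longrightarrow> v \<noteq> 0 \<and> v \<noteq> 1 \<and> v \<noteq> 2"
  by (auto simp: leaves_def split: if_splits)

lemma leaves_disjoint: "x \<in> leaves 1 \<Longrightarrow> x \<notin> leaves 2"
  by (auto simp: leaves_def)

sublocale group G
  unfolding G_eq RAAG_P_def by (rule raag_group)

lemma gen_carrier [simp]: "v \<in> P_verts d1 d2 \<Longrightarrow> gen v \<in> carrier G"
  unfolding G_eq RAAG_P_def by (rule vgen_carrier)

lemma P_verts_mem [simp]: "0 \<in> P_verts d1 d2" "Suc 0 \<in> P_verts d1 d2" "2 \<in> P_verts d1 d2"
  by (auto simp: P_verts_def)

lemma leaf_vert: "i \<in> {1, 2} \<Longrightarrow> v \<in> leaves i \<Longrightarrow> v \<in> P_verts d1 d2"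
  by (auto simp: P_verts_def leaves_def split: if_splits)

lemma small_vert: "i \<le> 2 \<Longrightarrow> i \<in> P_verts d1 d2"
  by (auto simp: P_verts_def)

lemma universal:
  assumes L: "group L" "\<And>v. v \<in> P_verts d1 d2 \<Longrightarrow> f v \<in> carrier L"
    and com: "com L (f 0) (f 1)" "com L (f 0) (f 2)" "\<And>i v. i \<in> {1, 2} \<Longrightarrow> v \<in> leaves i \<Longrightarrow> com L (f i) (f v)"
  obtains h where "h \<in> hom G L" "\<And>v. v \<in> P_verts d1 d2 \<Longrightarrow> h (gen v) = f v"
proof -
  have 0: "com L (f u) (f v)" if "P_edge0 d1 d2 u v" for u v
  proof -
    from that consider "u = 0" "v = 1" | "u = 0" "v = 2" | "u = 1" "v \<in> leaves 1" | "u = 2" "v \<in> leaves 2"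
      unfolding P_edge0_def leaves_def by fastforce
    then show ?thesis using com by cases auto
  qed
  have sym: "com L x y \<Longrightarrow> com L y x" for x y by (simp add: com_def)
  have "com L (f u) (f v)" if "P_edge d1 d2 u v" for u v
    using that 0[of u v] 0[of v u] sym by (auto simp: P_edge_def)
  then obtain h where "h \<in> hom (RAAG (P_verts d1 d2) (P_edge d1 d2)) L"
      "\<And>v. v \<in> P_verts d1 d2 \<Longrightarrow> h (gen v) = f v"
    using raag_universal[OF L(1), of "P_verts d1 d2" f "P_edge d1 d2"] L(2) by auto
  then show thesis using that unfolding G_eq RAAG_P_def by blast
qed

lemma gen_com: "P_edge d1 d2 u v \<Longrightarrow> u \<in> P_verts d1 d2 \<Longrightarrow> v \<in> P_verts d1 d2 \<Longrightarrow> com G (gen u) (gen v)"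
  unfolding G_eq RAAG_P_def by (rule raag_com)

lemma com_centre: "i \<le> 2 \<Longrightarrow> com G (gen 0) (gen i)"
proof (cases "i = 0")
  case False
  moreover assume "i \<le> 2"
  ultimately have "i = 1 \<or> i = 2" by linarith
  then show ?thesis using \<open>i \<le> 2\<close> by (intro gen_com) (auto simp: P_edge_def P_edge0_def small_vert)
qed simp

lemma com_leaf: "i \<in> {1, 2} \<Longrightarrow> v \<in> leaves i \<Longrightarrow> com G (gen i) (gen v)"
proof -
  assume "i \<in> {1, 2}" "v \<in> leaves i"
  then have "(i = 1 \<and> v \<in> {3..d1 + 2}) \<or> (i = 2 \<and> v \<in> {d1 + 3..d1 + d2 + 2})"
    by (auto simp: leaves_def)
  then show ?thesis by (intro gen_com) (auto simp: P_edge_def P_edge0_def P_verts_def)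
qed

lemma carrier_generated: "carrier G = generate G (gen ` P_verts d1 d2)"
  unfolding G_eq RAAG_P_def by (rule raag_generated)

text \<open>\<open>e v\<close> is the exponent sum of the generator \<open>v\<close>. Its target is
  abelian, so it is blind to conjugation and can tell apart conjugates of powers of different
  generators.\<close>

lemma exponent_hom:
  obtains e :: "nat \<Rightarrow> (nat \<times> bool) list set \<Rightarrow> int"
  where "\<And>v. e v \<in> hom G integer_group"
    "\<And>v w. w \<in> P_verts d1 d2 \<Longrightarrow> e v (gen w) = (if v = w then 1 else 0)"
    "\<And>v g k. g \<in> carrier G \<Longrightarrow> e v (g [^] (k::int)) = k * e v g"
    "\<And>v g x. g \<in> carrier G \<Longrightarrow> x \<in> carrier G \<Longrightarrow> e v (cj G g x) = e v x"
proof -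
  have "\<exists>h. h \<in> hom G integer_group \<and> (\<forall>w\<in>P_verts d1 d2. h (gen w) = (if v = w then 1 else 0))" for v
  proof -
    obtain h where "h \<in> hom G integer_group" "\<And>w. w \<in> P_verts d1 d2 \<Longrightarrow> h (gen w) = (if v = w then 1 else 0)"
      by (rule universal[OF group_integer_group, of "\<lambda>w. if v = w then 1 else 0"]) (simp_all add: com_def)
    then show ?thesis by blast
  qed
  then obtain e where e: "\<And>v. e v \<in> hom G integer_group"
    "\<And>v w. w \<in> P_verts d1 d2 \<Longrightarrow> e v (gen w) = (if v = w then 1 else 0)" by metis
  have gh: "group_hom G integer_group (e v)" for v
    using e(1)[of v] by (simp add: group_hom_def group_hom_axioms_def)
  have p: "x [^]\<^bsub>integer_group\<^esub> (k::int) = k * x" for x k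
  proof (cases "k < 0")
    case True
    have n: "x [^]\<^bsub>integer_group\<^esub> (n::nat) = int n * x" for n
      by (induction n) (auto simp: algebra_simps)
    show ?thesis using True by (simp add: int_pow_def2 n)
  next
    case False
    have n: "x [^]\<^bsub>integer_group\<^esub> (n::nat) = int n * x" for n
      by (induction n) (auto simp: algebra_simps)
    show ?thesis using False by (simp add: int_pow_def2 n)
  qed
  show thesis
  proof (rule that[of e])
    fix v g and k :: int assume "g \<in> carrier G"
    then show "e v (g [^] k) = k * e v g" using group_hom.hom_int_pow[OF gh] p by simp
  next
    fix v g x assume "g \<in> carrier G" "x \<in> carrier G"
    then show "e v (cj G g x) = e v x"
      using hom_mult[OF e(1)] group_hom.hom_inv[OF gh] by (simp add: cj_def)
  qed (use e in auto)
qed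

definition T where "T = {gen 1, gen 2}"
text \<open>The vertex \<open>x = 0\<close> contributes only \<open>gen 0\<close>, which
  \<open>Q\<close> centralizes; all other elements are conjugates of leaves.\<close>

definition S where "S = {cj G u (gen x) | u x. u \<in> generate G T \<and> x \<in> P_verts d1 d2 \<and> x \<notin> {1, 2}}"

abbreviation "Q \<equiv> generate G T"
abbreviation "K \<equiv> generate G S"

lemma T_carrier: "T \<subseteq> carrier G"
  by (simp add: T_def)

lemma Q_carrier: "q \<in> Q \<Longrightarrow> q \<in> carrier G"
  using generate_in_carrier[OF T_carrier] by blast

lemma S_carrier: "S \<subseteq> carrier G"
  using Q_carrier by (auto simp: S_def)

lemma K_carrier: "k \<in> K \<Longrightarrow> k \<in> carrier G"
  using generate_in_carrier[OF S_carrier] by blast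

lemma Q_subgroup: "subgroup Q G"
  by (rule generate_is_subgroup[OF T_carrier])

lemma K_subgroup: "subgroup K G"
  by (rule generate_is_subgroup[OF S_carrier])

lemma Q_com_centre: "q \<in> Q \<Longrightarrow> com G q (gen 0)"
  using com_generate[of T "gen 0" q] T_carrier com_centre[of 1] com_centre[of 2]
  by (auto simp: T_def com_sym[of q] simp flip: One_nat_def)

lemma S_act: "u \<in> Q \<Longrightarrow> s \<in> S \<Longrightarrow> cj G u s \<in> S"
proof -
  assume u: "u \<in> Q" and "s \<in> S"
  then obtain v x where vx: "s = cj G v (gen x)" "v \<in> Q" "x \<in> P_verts d1 d2" "x \<notin> {1, 2}"
    unfolding S_def by blast
  then have "cj G u s = cj G (u \<otimes> v) (gen x)" using u Q_carrier by (simp add: cj_cj)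
  moreover have "u \<otimes> v \<in> Q" using u vx Q_subgroup by (simp add: subgroup.m_closed)
  ultimately show ?thesis using vx unfolding S_def by blast
qed

lemma gen_S: "x \<in> P_verts d1 d2 \<Longrightarrow> x \<notin> {1, 2} \<Longrightarrow> gen x \<in> S"
  unfolding S_def by (rule CollectI, rule exI[of _ \<one>], rule exI[of _ x]) (auto simp: generate.one)

lemma leaf_S: "i \<in> {1, 2} \<Longrightarrow> gen ` ({0} \<union> leaves i) \<subseteq> S"
proof
  fix s assume i: "i \<in> {1, 2}" and "s \<in> gen ` ({0} \<union> leaves i)"
  then obtain v where "v = 0 \<or> v \<in> leaves i" "s = gen v" by blast
  moreover have "v \<in> P_verts d1 d2 \<and> v \<notin> {1, 2}"
  proof (cases "v = 0")
    case False
    then have "v \<in> leaves i" using calculation(1) by blast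
    then show ?thesis using leaf_vert[OF i] leaf_not by blast
  qed simp
  ultimately show "s \<in> S" using gen_S by blast
qed

text \<open>The branch vertices act on reduced words by left multiplication and all other generators
  trivially. Every edge of the tree has an end that acts trivially, so the relations hold.\<close>

lemma T_free: "free_in G T"
proof -
  define \<Omega> where "\<Omega> = {w. red w \<and> letters w \<subseteq> T}"
  interpret B: group "BijGroup \<Omega>" by (rule group_BijGroup)
  define f where "f v = (if v \<in> {1, 2} then lmult \<Omega> (gen v, True) else \<one>\<^bsub>BijGroup \<Omega>\<^esub>)" for v
  have cl: "lmult \<Omega> (gen v, True) \<in> carrier (BijGroup \<Omega>)" if "v \<in> {1, 2}" for v
    by (rule lmult_Bij[OF \<Omega>_def]) (use that in \<open>auto simp: T_def\<close>)
  then have f: "f v \<in> carrier (BijGroup \<Omega>)" for v by (simp add: f_def)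
  obtain \<psi> where \<psi>: "\<psi> \<in> hom G (BijGroup \<Omega>)" "\<And>v. v \<in> P_verts d1 d2 \<Longrightarrow> \<psi> (gen v) = f v"
  proof (rule universal[OF group_BijGroup, of f])
    fix i v assume "i \<in> {1, 2::nat}" "v \<in> leaves i"
    then have "f v = \<one>\<^bsub>BijGroup \<Omega>\<^esub>" by (auto simp: f_def)
    then show "com (BijGroup \<Omega>) (f i) (f v)" using f by simp
  qed (use f in \<open>auto simp: f_def[of 0]\<close>)
  show ?thesis
    by (rule free_in_by_action[OF \<Omega>_def is_group T_carrier \<psi>(1)]) (auto simp: T_def \<psi>(2) f_def)
qed

text \<open>The same operation as \<open>act_word\<close>, which becomes available only after
  \<open>S\<close> is known to be free.\<close>

definition conj_letters where "conj_letters q w = map (\<lambda>l. (cj G q (fst l), snd l)) w"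

text \<open>The semidirect product structure is imitated on reduced words over \<open>S\<close>:
  branch vertices permute the letters by conjugation, the centre and the leaves act by left
  multiplication. The relations hold because a branch vertex commutes with the centre and its own
  leaves, hence fixes these letters.\<close>

lemma S_free: "free_in G S"
proof -
  define \<Omega> where "\<Omega> = {w. red w \<and> letters w \<subseteq> S}"
  interpret B: group "BijGroup \<Omega>" by (rule group_BijGroup)
  define c where "c q = restrict (conj_letters q) \<Omega>" for q
  have red_cm: "red (conj_letters q w)" if "q \<in> Q" "w \<in> \<Omega>" for q w
  proof -
    have "successively (\<lambda>x y. (cj G q (fst y), snd y) \<noteq> flip (cj G q (fst x), snd x)) w"
    proof (rule successively_mono)
      show "successively (\<lambda>x y. y \<noteq> flip x) w" using that(2) by (simp add: red_def \<Omega>_def)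
      fix x y assume "x \<in> set w" "y \<in> set w" "y \<noteq> flip x"
      moreover from this have "fst x \<in> carrier G" "fst y \<in> carrier G"
        using that(2) S_carrier by (auto simp: \<Omega>_def)
      ultimately show "(cj G q (fst y), snd y) \<noteq> flip (cj G q (fst x), snd x)"
        using cj_eq_iff[of q "fst y" "fst x"] Q_carrier[OF that(1)]
        by (auto simp: prod_eq_iff)
    qed
    then show ?thesis by (simp add: red_def conj_letters_def successively_map)
  qed
  have letters_cm: "letters (conj_letters q w) = cj G q ` letters w" for q w by (simp add: conj_letters_def image_image)
  have cm_\<Omega>: "conj_letters q w \<in> \<Omega>" if "q \<in> Q" "w \<in> \<Omega>" for q w
    using red_cm[OF that] that S_act unfolding \<Omega>_def mem_Collect_eq letters_cm by blast
  have cm_cm: "conj_letters q (conj_letters r w) = conj_letters (q \<otimes> r) w" if "q \<in> Q" "r \<in> Q" "w \<in> \<Omega>" for q r w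
    unfolding conj_letters_def map_map using that Q_carrier S_carrier
    by (intro map_cong) (auto simp: \<Omega>_def cj_cj subset_iff)
  have cm_one: "conj_letters \<one> w = w" if "w \<in> \<Omega>" for w
    unfolding conj_letters_def using that S_carrier by (intro map_idI) (auto simp: \<Omega>_def subset_iff)
  have c_Bij: "c q \<in> carrier (BijGroup \<Omega>)" if q: "q \<in> Q" for q
  proof -
    have qi: "inv q \<in> Q" using q Q_subgroup by (simp add: subgroup.m_inv_closed)
    have "bij_betw (conj_letters q) \<Omega> \<Omega>"
      by (rule bij_betw_byWitness[where f' = "conj_letters (inv q)"])
         (use q qi cm_\<Omega> Q_carrier in \<open>auto simp: cm_cm cm_one\<close>)
    then show ?thesis by (simp add: BijGroup_def Bij_def c_def bij_betw_restrict_eq)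
  qed
  have c_mult: "c q \<otimes>\<^bsub>BijGroup \<Omega>\<^esub> c r = c (q \<otimes> r)" if "q \<in> Q" "r \<in> Q" for q r
    using that c_Bij[of q] c_Bij[of r] cm_\<Omega> cm_cm
    by (auto simp: BijGroup_def compose_def c_def fun_eq_iff)
  have c_one: "c \<one> = \<one>\<^bsub>BijGroup \<Omega>\<^esub>" using cm_one by (auto simp: c_def BijGroup_def fun_eq_iff)
  have lmult_Bij: "lmult \<Omega> (s, True) \<in> carrier (BijGroup \<Omega>)" if "s \<in> S" for s
    by (rule lmult_Bij[OF \<Omega>_def]) (use that in auto)
  have cm_lcons: "conj_letters q (lcons (s, True) w) = lcons (cj G q s, True) (conj_letters q w)"
    if "q \<in> Q" "s \<in> S" "w \<in> \<Omega>" for q s w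
  proof (cases w)
    case (Cons a t)
    then have "fst a \<in> S" using that by (auto simp: \<Omega>_def)
    then have "cj G q (fst a) = cj G q s \<longleftrightarrow> fst a = s"
      using that Q_carrier S_carrier by (intro cj_eq_iff) auto
    then show ?thesis using Cons by (auto simp: conj_letters_def lcons_def flip_def prod_eq_iff)
  qed (auto simp: conj_letters_def lcons_def)
  have c_lc: "c q \<otimes>\<^bsub>BijGroup \<Omega>\<^esub> lmult \<Omega> (s, True) = lmult \<Omega> (cj G q s, True) \<otimes>\<^bsub>BijGroup \<Omega>\<^esub> c q"
    if "q \<in> Q" "s \<in> S" for q s
    using that c_Bij[OF that(1)] lmult_Bij[OF that(2)] lmult_Bij[OF S_act[OF that]] cm_\<Omega> lcons_\<Omega>[OF \<Omega>_def] cm_lcons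
    by (auto simp: BijGroup_def compose_def c_def lmult_def[OF \<Omega>_def] fun_eq_iff)
  define f where "f v = (if v \<in> {1, 2} then c (gen v) else lmult \<Omega> (gen v, True))" for v
  have gQ: "v \<in> {1, 2} \<Longrightarrow> gen v \<in> Q" for v by (auto simp: T_def intro: generate.incl)
  have f: "f v \<in> carrier (BijGroup \<Omega>)" if "v \<in> P_verts d1 d2" for v
    using that c_Bij[OF gQ] lmult_Bij[OF gen_S] by (auto simp: f_def)
  have com: "com (BijGroup \<Omega>) (f i) (f v)"
    if "i \<in> {1, 2}" "v \<in> P_verts d1 d2" "v \<notin> {1, 2}" "com G (gen i) (gen v)" for i v
  proof -
    have "cj G (gen i) (gen v) = gen v" using that by (subst cj_eq_self) auto
    then show ?thesis using c_lc[OF gQ gen_S, of i v] that by (auto simp: f_def com_def)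
  qed
  obtain \<psi> where \<psi>: "\<psi> \<in> hom G (BijGroup \<Omega>)" "\<And>v. v \<in> P_verts d1 d2 \<Longrightarrow> \<psi> (gen v) = f v"
  proof (rule universal[OF group_BijGroup, of f])
    show "com (BijGroup \<Omega>) (f 0) (f 1)" "com (BijGroup \<Omega>) (f 0) (f 2)"
      using com[of 1 0] com[of 2 0] com_centre[of 1] com_centre[of 2] by (auto simp: com_def)
    fix i v assume "i \<in> {1, 2::nat}" "v \<in> leaves i"
    then show "com (BijGroup \<Omega>) (f i) (f v)"
      using com[of i v] com_leaf[of i v] leaf_vert[of i v] leaf_not[of v i] by simp
  qed (use f in auto)
  interpret h: group_hom G "BijGroup \<Omega>" \<psi>
    using \<psi>(1) is_group group_BijGroup by (simp add: group_hom_def group_hom_axioms_def)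
  have \<psi>Q: "\<psi> u = c u" if "u \<in> Q" for u
    using that
  proof (induction rule: generate.induct)
    case one
    then show ?case by (simp add: c_one)
  next
    case (incl t)
    then show ?case by (auto simp: T_def \<psi>(2) f_def)
  next
    case (inv t)
    then have t: "t \<in> Q" "inv t \<in> Q" "t \<in> carrier G" using T_carrier by (auto intro: generate.intros)
    have "\<psi> t = c t" using inv by (auto simp: T_def \<psi>(2) f_def)
    moreover have "c (inv t) \<otimes>\<^bsub>BijGroup \<Omega>\<^esub> c t = \<one>\<^bsub>BijGroup \<Omega>\<^esub>"
      using t by (simp add: c_mult c_one)
    then have "inv\<^bsub>BijGroup \<Omega>\<^esub> (c t) = c (inv t)"
      using c_Bij t by (intro B.inv_equality) auto
    ultimately show ?case using t by simp
  next
    case (eng x y)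
    then show ?case using Q_carrier c_mult by simp
  qed
  \<comment> \<open>Conjugating left multiplication by \<open>gen x\<close> with the letter
    permutation \<open>c u\<close> gives left multiplication by the conjugate letter, so all of
    \<open>S\<close>, and not only its generators, acts as van der Waerden's argument
    demands.\<close>
  have \<psi>S: "\<psi> s = lmult \<Omega> (s, True)" if sS: "s \<in> S" for s
  proof -
    obtain u x where ux: "s = cj G u (gen x)" "u \<in> Q" "x \<in> P_verts d1 d2" "x \<notin> {1, 2}"
      using sS unfolding S_def by blast
    have uc: "u \<in> carrier G" using ux Q_carrier by simp
    have "\<psi> s = (c u \<otimes>\<^bsub>BijGroup \<Omega>\<^esub> lmult \<Omega> (gen x, True)) \<otimes>\<^bsub>BijGroup \<Omega>\<^esub> inv\<^bsub>BijGroup \<Omega>\<^esub> (c u)"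
      unfolding ux(1) cj_def using ux uc by (simp add: \<psi>Q \<psi>(2) f_def)
    also have "c u \<otimes>\<^bsub>BijGroup \<Omega>\<^esub> lmult \<Omega> (gen x, True) = lmult \<Omega> (s, True) \<otimes>\<^bsub>BijGroup \<Omega>\<^esub> c u"
      using c_lc[OF ux(2) gen_S[OF ux(3,4)]] ux(1) by simp
    finally show ?thesis using lmult_Bij[OF sS] c_Bij[OF ux(2)] by (simp add: B.m_assoc)
  qed
  show ?thesis by (rule free_in_by_action[OF \<Omega>_def is_group S_carrier \<psi>(1) \<psi>S])
qed


sublocale Kf: free_in G S by (rule S_free)
sublocale Qf: free_in G T by (rule T_free)

lemma gen_Q: "i \<in> {1, 2} \<Longrightarrow> gen i \<in> Q"
  by (auto simp: T_def intro: generate.incl)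

lemma Q_normalizes_K:
  assumes "u \<in> Q" "k \<in> K" shows "cj G u k \<in> K"
proof -
  have u: "u \<in> carrier G" using Q_carrier assms by simp
  show ?thesis using assms(2)
  proof (induction rule: generate.induct)
    case one
    then show ?case using u by (simp add: generate.one)
  next
    case (incl s)
    then show ?case using S_act[OF assms(1)] by (auto intro: generate.incl)
  next
    case (inv s)
    then have "cj G u (inv s) = inv (cj G u s)" using u S_carrier by (intro cj_inv) auto
    then show ?case using inv S_act[OF assms(1)] by (auto intro: generate.inv)
  next
    case (eng x y)
    then show ?case using u K_carrier by (auto simp: cj_mult intro: generate.eng)
  qed
qed

lemma decomposition:
  assumes "g \<in> carrier G" shows "\<exists>k\<in>K. \<exists>q\<in>Q. g = k \<otimes> q"
proof -
  have g: "g \<in> generate G (gen ` P_verts d1 d2)" using assms carrier_generated by simp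
  have K: "\<exists>k\<in>K. \<exists>q\<in>Q. x = k \<otimes> q" if "x \<in> K" for x
    using that K_carrier by (intro bexI[of _ x] bexI[of _ \<one>]) (auto simp: generate.one)
  have Q: "\<exists>k\<in>K. \<exists>q\<in>Q. x = k \<otimes> q" if "x \<in> Q" for x
    using that Q_carrier by (intro bexI[of _ \<one>] bexI[of _ x]) (auto simp: generate.one)
  show ?thesis using g
  proof (induction rule: generate.induct)
    case one
    show ?case by (rule K[OF generate.one])
  next
    case (incl x)
    then obtain v where v: "v \<in> P_verts d1 d2" "x = gen v" by blast
    show ?case
    proof (cases "v \<in> {1, 2}")
      case True
      then show ?thesis unfolding v(2) by (rule Q[OF gen_Q])
    next
      case False
      then show ?thesis unfolding v(2) by (intro K generate.incl gen_S v)
    qed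
  next
    case (inv x)
    then obtain v where v: "v \<in> P_verts d1 d2" "x = gen v" by blast
    show ?case
    proof (cases "v \<in> {1, 2}")
      case True
      then show ?thesis unfolding v(2) by (intro Q generate.inv) (auto simp: T_def)
    next
      case False
      then show ?thesis unfolding v(2) by (intro K generate.inv gen_S v)
    qed
  next
    case (eng x y)
    then obtain k q k' q' where *: "k \<in> K" "q \<in> Q" "x = k \<otimes> q" "k' \<in> K" "q' \<in> Q" "y = k' \<otimes> q'" by blast
    have c: "k \<in> carrier G" "q \<in> carrier G" "k' \<in> carrier G" "q' \<in> carrier G"
      using * K_carrier Q_carrier by auto
    have "x \<otimes> y = (k \<otimes> cj G q k') \<otimes> (q \<otimes> q')" using * c by (simp add: cj_def m_assoc)
    moreover have "k \<otimes> cj G q k' \<in> K" "q \<otimes> q' \<in> Q"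
      using * Q_normalizes_K K_subgroup Q_subgroup by (simp_all add: subgroup.m_closed)
    ultimately show ?case by blast
  qed
qed

definition \<pi> where
  "\<pi> = (SOME h. h \<in> hom G G \<and> (\<forall>v\<in>P_verts d1 d2. h (gen v) = (if v \<in> {1, 2} then gen v else \<one>)))"

lemma \<pi>: "\<pi> \<in> hom G G" "v \<in> P_verts d1 d2 \<Longrightarrow> \<pi> (gen v) = (if v \<in> {1, 2} then gen v else \<one>)"
proof -
  obtain h where "h \<in> hom G G" "\<And>v. v \<in> P_verts d1 d2 \<Longrightarrow> h (gen v) = (if v \<in> {1, 2} then gen v else \<one>)"
  proof (rule universal[OF is_group, of "\<lambda>v. if v \<in> {1, 2} then gen v else \<one>"])
    fix i v assume "i \<in> {1, 2::nat}" "v \<in> leaves i"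
    then show "com G (if i \<in> {1, 2} then gen i else \<one>) (if v \<in> {1, 2} then gen v else \<one>)"
      using leaf_not[of v i] by auto
  qed auto
  then have "\<exists>h. h \<in> hom G G \<and> (\<forall>v\<in>P_verts d1 d2. h (gen v) = (if v \<in> {1, 2} then gen v else \<one>))" by blast
  from someI_ex[OF this] show "\<pi> \<in> hom G G" "v \<in> P_verts d1 d2 \<Longrightarrow> \<pi> (gen v) = (if v \<in> {1, 2} then gen v else \<one>)"
    unfolding \<pi>_def by blast+
qed

lemma hom_id: "h \<in> hom G G \<Longrightarrow> Y \<subseteq> carrier G \<Longrightarrow> (\<And>x. x \<in> Y \<Longrightarrow> h x = x) \<Longrightarrow> g \<in> generate G Y \<Longrightarrow> h g = g"
  using hom_eq_on_generate[OF is_group is_group, of h "\<lambda>x. x" Y g] by (auto simp: hom_def)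

lemma hom_one: "h \<in> hom G G \<Longrightarrow> Y \<subseteq> carrier G \<Longrightarrow> (\<And>x. x \<in> Y \<Longrightarrow> h x = \<one>) \<Longrightarrow> g \<in> generate G Y \<Longrightarrow> h g = \<one>"
  using hom_eq_on_generate[OF is_group is_group, of h "\<lambda>x. \<one>" Y g] by (auto simp: hom_def)

lemma hom_cj: "h \<in> hom G G \<Longrightarrow> g \<in> carrier G \<Longrightarrow> x \<in> carrier G \<Longrightarrow> h (cj G g x) = cj G (h g) (h x)"
  using group_hom.hom_inv[of G G h g] is_group
  by (simp add: cj_def hom_mult group_hom_def group_hom_axioms_def)

lemma hom_cl: "h \<in> hom G G \<Longrightarrow> g \<in> carrier G \<Longrightarrow> h g \<in> carrier G"
  by (auto simp: hom_def)

lemma \<pi>_Q: "u \<in> Q \<Longrightarrow> \<pi> u = u"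
  using \<pi>(2)[of 1] \<pi>(2)[of 2] by (rule_tac hom_id[OF \<pi>(1) T_carrier]) (auto simp: T_def)

lemma \<pi>_K: "k \<in> K \<Longrightarrow> \<pi> k = \<one>"
proof (rule hom_one[OF \<pi>(1) S_carrier])
  fix s assume "s \<in> S"
  then obtain u x where ux: "s = cj G u (gen x)" "u \<in> Q" "x \<in> P_verts d1 d2" "x \<notin> {1, 2}"
    unfolding S_def by blast
  then show "\<pi> s = \<one>" using Q_carrier[OF ux(2)] \<pi>_Q by (simp add: hom_cj[OF \<pi>(1)] \<pi>(2))
qed

text \<open>The endomorphism that fixes the branch vertices, sends every leaf of \<open>i\<close> to
  \<open>gen i\<close> and kills the rest turns commutation with the leaf into commutation with
  \<open>gen i\<close> inside the free group \<open>Q\<close>.\<close>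

lemma leaf_stab:
  assumes "i \<in> {1, 2}" "x \<in> leaves i" "u \<in> Q"
  shows "com G u (gen x) \<longleftrightarrow> (\<exists>j::int. u = gen i [^] j)"
proof
  have gx: "gen x \<in> carrier G" "gen i \<in> carrier G" using assms leaf_vert[of i x] small_vert[of i] by auto
  {
    assume "\<exists>j::int. u = gen i [^] j"
    then obtain j :: int where "u = gen i [^] j" ..
    then show "com G u (gen x)"
      using com_int_pow[of "gen x" "gen i" j] com_leaf[OF assms(1,2)] gx by (simp add: com_sym)
  next
    assume c: "com G u (gen x)"
    define f where "f v = (if v \<in> {1, 2} then gen v else if v \<in> leaves i then gen i else \<one>)" for v
    have fi: "f v \<in> carrier G" for v using gx by (auto simp: f_def)
    obtain h where h: "h \<in> hom G G" "\<And>v. v \<in> P_verts d1 d2 \<Longrightarrow> h (gen v) = f v"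
    proof (rule universal[OF is_group, of f])
      fix j v assume jv: "j \<in> {1, 2::nat}" "v \<in> leaves j"
      show "com G (f j) (f v)"
      proof (cases "v \<in> leaves i")
        case True
        then have "i = j" using jv assms leaves_disjoint by auto
        then show ?thesis using jv True leaf_not[of v i] by (auto simp: f_def)
      next
        case False
        then show ?thesis using jv leaf_not[of v j] fi by (auto simp: f_def)
      qed
    qed (use fi in \<open>auto simp: f_def\<close>)
    have "h u = u"
      by (rule hom_id[OF h(1) T_carrier _ assms(3)]) (auto simp: T_def h(2) f_def)
    moreover have "h (gen x) = gen i" using h(2) leaf_vert[OF assms(1,2)] leaf_not[OF assms(2)] assms(2)
      by (simp add: f_def)
    moreover have "h (u \<otimes> gen x) = h (gen x \<otimes> u)" using c by (simp add: com_def)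
    ultimately have "com G u (gen i)"
      using gx Q_carrier[OF assms(3)] hom_mult[OF h(1)] by (simp add: com_def)
    then have "com G u (gen i [^] (1::int))" using gx by simp
    then show "\<exists>j::int. u = gen i [^] j"
      using Qf.centralizer_basis[of "gen i" u 1] assms by (auto simp: T_def)
  }
qed

lemma S_cases:
  assumes "s \<in> S"
  obtains "s = gen 0" | u i x where "u \<in> Q" "i \<in> {1, 2}" "x \<in> leaves i" "s = cj G u (gen x)"
proof -
  obtain u x where ux: "s = cj G u (gen x)" "u \<in> Q" "x \<in> P_verts d1 d2" "x \<notin> {1, 2}"
    using assms unfolding S_def by blast
  show thesis
  proof (cases "x = 0")
    case True
    then show thesis using that(1) ux Q_com_centre Q_carrier by (simp add: cj_eq_self)
  next
    case False
    then have "x \<in> leaves 1 \<or> x \<in> leaves 2" using ux by (auto simp: verts)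
    then show thesis using that(2) ux by blast
  qed
qed

sublocale PS: perm_split G S T \<pi> "gen 0"
proof
  fix s assume s: "s \<in> S" "s \<noteq> gen 0"
  then obtain u i x where uix: "u \<in> Q" "i \<in> {1, 2}" "x \<in> leaves i" "s = cj G u (gen x)"
    using S_cases by metis
  have u: "u \<in> carrier G" "inv u \<in> Q" "gen i \<in> carrier G" "gen x \<in> carrier G"
    using uix Q_carrier Q_subgroup small_vert[of i] leaf_vert[OF uix(2,3)] by (auto simp: subgroup.m_inv_closed)
  have "com G q s \<longleftrightarrow> (\<exists>j::int. q = cj G u (gen i [^] j))" if q: "q \<in> Q" for q
  proof -
    have qc: "q \<in> carrier G" using q Q_carrier by simp
    have "com G q s \<longleftrightarrow> com G (cj G (inv u) q) (gen x)"
      unfolding uix(4) using com_cj[of "inv u" q "cj G u (gen x)"] u qc by simp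
    also have "\<dots> \<longleftrightarrow> (\<exists>j::int. cj G (inv u) q = gen i [^] j)"
      by (rule leaf_stab[OF uix(2,3) Qf.cj_K[OF u(2) q]])
    also have "\<dots> \<longleftrightarrow> (\<exists>j::int. q = cj G u (gen i [^] j))"
    proof -
      have "cj G (inv u) q = gen i [^] j \<longleftrightarrow> q = cj G u (gen i [^] j)" for j :: int
        using u qc by (metis cj_cancel int_pow_closed)
      then show ?thesis by simp
    qed
    finally show ?thesis .
  qed
  moreover have "gen i \<in> T" using uix(2) by (auto simp: T_def)
  ultimately show "\<exists>u\<in>Q. \<exists>t\<in>T. \<forall>q\<in>Q. com G q s \<longleftrightarrow> (\<exists>j::int. q = cj G u (t [^] j))"
    using uix(1) by blast
qed (use \<pi> \<pi>_Q \<pi>_K S_act decomposition gen_S[of 0] Q_com_centre in auto)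

section \<open>Centralizers of vertices and commuting pairs of vertices\<close>

lemma pow_conjugate:
  assumes "i \<in> P_verts d1 d2" "j \<in> P_verts d1 d2" "g \<in> carrier G" "(k::int) \<noteq> 0"
    "cj G g (gen i [^] k) = gen j [^] (l::int)"
  shows "i = j \<and> k = l"
proof -
  obtain e where e: "\<And>v. e v \<in> hom G integer_group"
    "\<And>v w. w \<in> P_verts d1 d2 \<Longrightarrow> e v (gen w) = (if v = w then 1 else 0)"
    "\<And>v g k. g \<in> carrier G \<Longrightarrow> e v (g [^] (k::int)) = k * e v g"
    "\<And>v g x. g \<in> carrier G \<Longrightarrow> x \<in> carrier G \<Longrightarrow> e v (cj G g x) = e v x"
    using exponent_hom by blast
  have "e i (cj G g (gen i [^] k)) = k" using e(2)[OF assms(1), of i] assms(1,3) by (simp add: e(3,4))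
  moreover have "e i (gen j [^] l) = (if i = j then l else 0)" using e(2)[OF assms(2), of i] assms by (simp add: e(3))
  ultimately show ?thesis using assms(4,5) by (auto split: if_splits)
qed

text \<open>\<open>Q\<close> commutes with \<open>gen 0\<close>, so the part of \<open>g\<close> in
  \<open>K\<close> commutes with a power of the basis element \<open>gen 0\<close> and is itself a
  power of it.\<close>

lemma centralizer_centre:
  assumes "g \<in> carrier G" "com G g (gen 0 [^] (k::int))" "k \<noteq> 0"
  shows "\<exists>j::int. \<exists>q\<in>Q. g = gen 0 [^] j \<otimes> q"
proof -
  obtain a q where aq: "a \<in> K" "q \<in> Q" "g = a \<otimes> q" using decomposition assms by blast
  have c: "a \<in> carrier G" "q \<in> carrier G" "gen 0 \<in> carrier G" using aq K_carrier Q_carrier by auto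
  have "com G q (gen 0 [^] k)" using Q_com_centre[OF aq(2)] c by (intro com_int_pow)
  then have "com G a (gen 0 [^] k)"
    using com_cancel2[of "gen 0 [^] k" a q] assms c aq by (simp add: com_sym)
  then obtain j :: int where "a = gen 0 [^] j"
    using Kf.centralizer_basis[of "gen 0" a k] aq assms gen_S[of 0] by auto
  then show ?thesis using aq by blast
qed

text \<open>Projection to \<open>Q\<close> shows that the part in \<open>Q\<close> is a power of
  \<open>gen i\<close>, so \<open>gen i [^] n\<close> fixes every letter of the part in
  \<open>K\<close>. For a letter that is the conjugate by \<open>u\<close> of a leaf of
  \<open>i'\<close>, the stabilizer is the conjugate by \<open>u\<close> of the powers of
  \<open>gen i'\<close>. Exponent sums give \<open>i = i'\<close>; then \<open>u\<close> is a power
  of \<open>gen i\<close>, and the letter is the leaf itself.\<close>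

lemma centralizer_branch:
  assumes i: "i \<in> {1, 2}" and g: "g \<in> carrier G" "com G g (gen i [^] (n::int))" "n \<noteq> 0"
  shows "\<exists>w. \<exists>j::int. letters w \<subseteq> gen ` ({0} \<union> leaves i) \<and> g = Kf.ev w \<otimes> gen i [^] j"
proof -
  obtain a q where aq: "a \<in> K" "q \<in> Q" "g = a \<otimes> q" using decomposition g by blast
  have c: "a \<in> carrier G" "q \<in> carrier G" "gen i \<in> carrier G"
    using aq K_carrier Q_carrier small_vert[of i] i by auto
  have pQ: "gen i [^] k \<in> Q" for k :: int using gen_Q[OF i] Q_subgroup by (simp add: subgroup_int_pow_closed)
  have "\<pi> g = q" using aq c hom_mult[OF \<pi>(1)] \<pi>_K \<pi>_Q by simp
  moreover have "\<pi> (g \<otimes> gen i [^] n) = \<pi> (gen i [^] n \<otimes> g)" using g by (simp add: com_def)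
  ultimately have "com G q (gen i [^] n)"
    using g c hom_mult[OF \<pi>(1)] \<pi>_Q[OF pQ] by (simp add: com_def)
  moreover have giT: "gen i \<in> T" using i by (auto simp: T_def)
  ultimately obtain j :: int where j: "q = gen i [^] j"
    using Qf.centralizer_basis[OF _ aq(2)] g(3) by blast
  have "com G (gen i [^] n) q" unfolding j using c com_int_pows by blast
  then have "com G (gen i [^] n) a"
    using com_cancel2[of "gen i [^] n" a q] g c aq by (simp add: com_sym)
  then obtain w where w: "red w" "letters w \<subseteq> S" "a = Kf.ev w" "\<And>s. s \<in> letters w \<Longrightarrow> com G (gen i [^] n) s"
    using PS.com_K_letters[OF pQ aq(1)] by blast
  have "s \<in> gen ` ({0} \<union> leaves i)" if s: "s \<in> letters w" for s
  proof -
    have "s \<in> S" using s w by blast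
    then show ?thesis
    proof (cases rule: S_cases)
      case (2 u i' x)
      have u: "u \<in> carrier G" "inv u \<in> Q" "gen i' \<in> carrier G" "gen x \<in> carrier G"
        using 2 Q_carrier Q_subgroup small_vert[of i'] leaf_vert[of i' x] by (auto simp: subgroup.m_inv_closed)
      have "com G (cj G (inv u) (gen i [^] n)) (gen x)"
        using com_cj[of "inv u" "gen i [^] n" s] w(4)[OF s] 2(4) u c by simp
      then obtain l :: int where l: "cj G (inv u) (gen i [^] n) = gen i' [^] l"
        using leaf_stab[OF 2(2,3) Qf.cj_K[OF u(2) pQ]] by blast
      then have il: "i = i'" "n = l" using pow_conjugate[of i i' "inv u" n l] small_vert i 2 u g by auto
      then have "com G (inv u) (gen i [^] n)" using l u c by (simp add: cj_eq_self)
      then obtain b :: int where "inv u = gen i [^] b"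
        using Qf.centralizer_basis[OF giT u(2) _ g(3)] by blast
      then have "com G (inv u) (gen x)" using leaf_stab[OF 2(2,3) u(2)] il by blast
      then have "com G (inv (inv u)) (gen x)" using com_inv[of "gen x" "inv u"] u by (simp add: com_sym)
      then have "cj G u (gen x) = gen x" using u by (simp add: cj_eq_self)
      then show ?thesis using 2 il by auto
    qed auto
  qed
  then show ?thesis using aq(3) j w(3) by blast
qed

text \<open>The centralizer of \<open>gen i\<close> modulo \<open>gen i\<close> is free of rank \<open>brank i + 1\<close>.\<close>

definition brank :: "nat \<Rightarrow> nat" where
  "brank i = (if i = 0 then 1 else if i = 1 then d1 else d2)"

text \<open>By \<open>centralizer_centre\<close> the conjugate is a power of \<open>gen 0\<close>
  times some \<open>q\<close> in \<open>Q\<close>. The exponent sum at 0 fixes the power, and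
  applying \<open>\<pi>\<close> identifies \<open>q\<close>. For \<open>j \<noteq> 0\<close> the
  element \<open>\<pi> h\<close> does the job of \<open>h\<close> and also fixes
  \<open>gen 0\<close>, so one conjugator serves both ends of the edge.\<close>

lemma adjacent_centre:
  assumes j: "j \<le> 2" and h: "h \<in> carrier G" and "com G (gen 0) (cj G h (gen j))" "gen 0 \<noteq> cj G h (gen j)"
  shows "j \<noteq> 0 \<and> (\<exists>u\<in>carrier G. cj G u (gen 0) = gen 0 \<and> cj G u (gen j) = cj G h (gen j))"
proof -
  have c: "gen 0 \<in> carrier G" "gen j \<in> carrier G" using small_vert j by auto
  have "com G (cj G h (gen j)) (gen 0 [^] (1::int))" using assms c by (simp add: com_sym)
  then obtain k :: int and q where kq: "q \<in> Q" "cj G h (gen j) = gen 0 [^] k \<otimes> q"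
    using centralizer_centre[of "cj G h (gen j)" 1] c h by auto
  obtain e where e: "\<And>v. e v \<in> hom G integer_group"
    "\<And>v w. w \<in> P_verts d1 d2 \<Longrightarrow> e v (gen w) = (if v = w then 1 else 0)"
    "\<And>v g k. g \<in> carrier G \<Longrightarrow> e v (g [^] (k::int)) = k * e v g"
    "\<And>v g x. g \<in> carrier G \<Longrightarrow> x \<in> carrier G \<Longrightarrow> e v (cj G g x) = e v x"
    using exponent_hom by blast
  have e0: "e 0 q = 0"
  proof -
    have "e 0 q = (\<lambda>_. 0) q"
      by (rule hom_eq_on_generate[OF is_group group_integer_group e(1) _ T_carrier _ kq(1)])
         (auto simp: hom_def T_def e(2))
    then show ?thesis by simp
  qed
  have qc: "q \<in> carrier G" using kq Q_carrier by simp
  have "e 0 (cj G h (gen j)) = k" unfolding kq(2) using c qc e0 hom_mult[OF e(1)[of 0]] by (simp add: e(2,3))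
  then have k: "k = (if j = 0 then 1 else 0)" using h c small_vert[OF j] by (simp add: e(2,4))
  have p: "\<pi> (gen 0) = \<one>" "\<pi> q = q" using \<pi>(2)[of 0] \<pi>_Q kq by auto
  have "group_hom G G \<pi>" using \<pi>(1) is_group by (simp add: group_hom_def group_hom_axioms_def)
  then have "\<pi> (gen 0 [^] k) = \<one>" using group_hom.hom_int_pow[of G G \<pi> "gen 0" k] c p by simp
  then have q: "q = cj G (\<pi> h) (\<pi> (gen j))"
    using arg_cong[OF kq(2), of \<pi>] c qc h p hom_mult[OF \<pi>(1)] by (simp add: hom_cj[OF \<pi>(1)])
  have ph: "\<pi> h \<in> carrier G" using \<pi>(1) h by (rule hom_cl)
  show ?thesis
  proof (cases "j = 0")
    case True
    then have "q = \<one>" using q p ph by simp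
    then have "cj G h (gen j) = gen 0" using kq k True c by simp
    then show ?thesis using assms by simp
  next
    case False
    then have j2: "\<pi> (gen j) = gen j" using j \<pi>(2)[of j] small_vert by auto
    obtain a b where ab: "a \<in> K" "b \<in> Q" "h = a \<otimes> b" using decomposition h by blast
    then have "\<pi> h = b" using hom_mult[OF \<pi>(1)] K_carrier Q_carrier \<pi>_K \<pi>_Q by simp
    then have "com G (\<pi> h) (gen 0)" using Q_com_centre ab by simp
    then have "cj G (\<pi> h) (gen 0) = gen 0" using ph c by (simp add: cj_eq_self)
    moreover have "cj G (\<pi> h) (gen j) = cj G h (gen j)" using q kq k False j2 qc by simp
    ultimately show ?thesis using ph False by blast
  qed
qed

text \<open>After \<open>\<pi>\<close> and exponent sums, the conjugate is \<open>ev w\<close> times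
  \<open>gen i\<close>, and \<open>j = i\<close>. The retraction \<open>r\<close> onto the subgroup
  of the centre and the leaves of \<open>i\<close> kills \<open>gen i\<close> and its conjugates but
  fixes \<open>ev w\<close>, so \<open>ev w\<close> is trivial.\<close>

lemma branches_not_adjacent:
  assumes i: "i \<in> {1, 2}" and j: "j \<in> {1, 2}" and h: "h \<in> carrier G" and "com G (gen i) (cj G h (gen j))"
  shows "gen i = cj G h (gen j)"
proof -
  have c: "gen i \<in> carrier G" "gen j \<in> carrier G" using small_vert i j by auto
  have "com G (cj G h (gen j)) (gen i [^] (1::int))" using assms c by (simp add: com_sym)
  then obtain w l where w: "letters w \<subseteq> gen ` ({0} \<union> leaves i)" "cj G h (gen j) = Kf.ev w \<otimes> gen i [^] (l::int)"
    using centralizer_branch[OF i, of "cj G h (gen j)" 1] c h by auto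
  have wS: "letters w \<subseteq> S" using w(1) leaf_S[OF i] by (rule subset_trans)
  have wc: "Kf.ev w \<in> K" using Kf.ev_K[OF wS] .
  have pQ: "gen i [^] l \<in> Q" using gen_Q[OF i] Q_subgroup by (simp add: subgroup_int_pow_closed)
  have ph: "\<pi> h \<in> carrier G" using \<pi>(1) h by (rule hom_cl)
  have "\<pi> (cj G h (gen j)) = gen i [^] l"
    unfolding w(2) using wc K_carrier c hom_mult[OF \<pi>(1)] \<pi>_K \<pi>_Q[OF pQ] by simp
  then have "cj G (\<pi> h) (gen j [^] (1::int)) = gen i [^] l"
    using h c hom_cj[OF \<pi>(1)] \<pi>_Q[OF gen_Q[OF j]] by simp
  then have il: "j = i" "l = 1" using pow_conjugate[of j i "\<pi> h" 1 l] small_vert i j ph by auto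
  define f where "f v = (if v \<in> {0} \<union> leaves i then gen v else \<one>)" for v
  have f: "f v \<in> carrier G" if "v \<in> P_verts d1 d2" for v using that by (auto simp: f_def)
  obtain r where r: "r \<in> hom G G" "\<And>v. v \<in> P_verts d1 d2 \<Longrightarrow> r (gen v) = f v"
  proof (rule universal[OF is_group, of f])
    fix i' v assume "i' \<in> {1, 2::nat}" "v \<in> leaves i'"
    then show "com G (f i') (f v)" using f[OF leaf_vert, of i' v] leaf_not[of i' i] by (auto simp: f_def)
  qed (use f in \<open>auto simp: f_def[of "Suc 0"] f_def[of 2]\<close>)
  have rw: "r (Kf.ev w) = Kf.ev w"
  proof (rule hom_id[OF r(1)])
    show "Kf.ev w \<in> generate G (letters w)" by (rule word_eval_generate) simp
    show "letters w \<subseteq> carrier G" using wS S_carrier by blast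
    fix x assume "x \<in> letters w"
    then obtain v where "v \<in> {0} \<union> leaves i" "x = gen v" using w(1) by blast
    then show "r x = x" using r(2)[of v] leaf_vert[OF i, of v] by (auto simp: f_def)
  qed
  have "f i = \<one>" using leaf_not[of i i] i by (auto simp: f_def)
  then have ri: "r (gen i) = \<one>" using r(2)[of i] small_vert i by auto
  have rh: "r h \<in> carrier G" using r(1) h by (rule hom_cl)
  have "r (cj G h (gen j)) = \<one>" using il ri rh h c by (simp add: hom_cj[OF r(1)])
  moreover have "r (cj G h (gen j)) = Kf.ev w"
    unfolding w(2) using il ri rw wc K_carrier c hom_mult[OF r(1)] by simp
  ultimately have "Kf.ev w = \<one>" by simp
  then show ?thesis using w(2) il c by simp
qed

theorem P_tree_raag: "tree_raag G gen"
proof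
  fix i :: nat assume i: "i \<le> 2"
  show gi: "gen i \<in> carrier G" using small_vert i by simp
  show "com G (gen 0) (gen i)" by (rule com_centre[OF i])
  show "i = j \<and> k = l" if "j \<le> 2" "g \<in> carrier G" "k \<noteq> 0" "cj G g (gen i [^] k) = gen j [^] l"
    for j g and k l :: int
    using pow_conjugate[OF small_vert small_vert] that i by blast
  show "com G g (gen i)" if g: "g \<in> carrier G" and k: "k \<noteq> 0" and com: "com G g (gen i [^] k)" for g and k :: int
  proof (cases "i = 0")
    case True
    then obtain j :: int and q where "q \<in> Q" "g = gen 0 [^] j \<otimes> q" using centralizer_centre g k com by blast
    then show ?thesis using True Q_com_centre[of q] Q_carrier[of q] com_mult[of "gen 0" "gen 0 [^] j" q] com_int_pow[of "gen 0" "gen 0" j]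
      by (simp add: com_sym)
  next
    case False
    then have i': "i \<in> {1, 2}" using i by auto
    then obtain w and j :: int where w: "letters w \<subseteq> gen ` ({0} \<union> leaves i)" "g = Kf.ev w \<otimes> gen i [^] j"
      using centralizer_branch g k com by blast
    have wS: "letters w \<subseteq> S" using w(1) leaf_S[OF i'] by (rule subset_trans)
    have "com G (gen i) s" if "s \<in> letters w" for s
      using that w(1) com_leaf[OF i'] com_centre[OF i] by (auto simp: com_sym)
    then have "com G (gen i) (Kf.ev w)" using PS.com_ev[OF gi wS] by blast
    then show ?thesis using w gi Kf.ev_closed[OF wS] com_mult[of "gen i" "Kf.ev w" "gen i [^] j"] com_int_pow[of "gen i" "gen i" j]
      by (simp add: com_sym)
  qed
  show "\<exists>x\<in>carrier G. \<exists>y\<in>carrier G. com G x (gen i) \<and> com G y (gen i) \<and> (\<forall>k>0. \<not> com G (x [^] (k::nat)) (y [^] k))"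
  proof -
    \<comment> \<open>If equal powers of two elements of a free basis commuted, a nontrivial power
      of one would be a power of the other, contradicting exponent sums.\<close>
    have key: "\<not> com G (gen a [^] (k::nat)) (gen b [^] k)"
      if ab: "a \<noteq> b" "0 < k" "a \<in> P_verts d1 d2" "b \<in> P_verts d1 d2" "free_in G Y" "gen a \<in> Y" "gen b \<in> Y" for a b k Y
    proof
      interpret Y: free_in G Y by fact
      assume "com G (gen a [^] k) (gen b [^] k)"
      then have "com G (gen a [^] k) (gen b [^] int k)" by (simp add: int_pow_int)
      moreover have "gen a [^] k \<in> Y.K"
        using Y.S_K[OF ab(6)] Y.K_subgroup by (simp add: subgroup_int_pow_closed flip: int_pow_int)
      ultimately obtain j :: int where "gen a [^] k = gen b [^] j"
        using Y.centralizer_basis[OF ab(7)] ab(2) by fastforce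
      then have "cj G \<one> (gen a [^] int k) = gen b [^] j" using ab by (simp add: int_pow_int)
      then show False using pow_conjugate[of a b \<one> "int k" j] ab by simp
    qed
    show ?thesis
    proof (cases "i = 0")
      case True
      have "com G (gen 1) (gen 0)" "com G (gen 2) (gen 0)" using com_centre[of 1] com_centre[of 2] by (auto simp: com_sym)
      moreover have "\<forall>k>0. \<not> com G (gen 1 [^] (k::nat)) (gen 2 [^] k)"
        using key[of 1 2 _ T] T_free by (auto simp: T_def)
      ultimately show ?thesis unfolding True by (intro bexI[of _ "gen 1"] bexI[of _ "gen 2"]) auto
    next
      case False
      then have i': "i \<in> {1, 2}" using i by auto
      \<comment> \<open>The centralizer of a branch vertex is nonabelian because it contains the
        centre and at least one leaf, two different elements of the basis \<open>S\<close>.\<close>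
      have "leaves i \<noteq> {}" using d_pos i' by (auto simp: leaves_def)
      then obtain x where x: "x \<in> leaves i" by blast
      have xv: "x \<in> P_verts d1 d2" "x \<notin> {1, 2}" "x \<noteq> 0" using leaf_vert[OF i' x] leaf_not[OF x] by auto
      have "\<forall>k>0. \<not> com G (gen 0 [^] (k::nat)) (gen x [^] k)"
        using key[of 0 x _ S] S_free gen_S xv by auto
      moreover have "com G (gen 0) (gen i)" "com G (gen x) (gen i)"
        using com_centre[OF i] com_leaf[OF i' x] by (auto simp: com_sym)
      ultimately show ?thesis using xv by (intro bexI[of _ "gen 0"] bexI[of _ "gen x"]) auto
    qed
  qed
  show "(i = 0) \<noteq> (j = 0) \<and> (\<exists>u\<in>carrier G. cj G u (gen i) = cj G g (gen i) \<and> cj G u (gen j) = cj G h (gen j))"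
    if j: "j \<le> 2" and g: "g \<in> carrier G" and h: "h \<in> carrier G"
      and com: "com G (cj G g (gen i)) (cj G h (gen j))" and ne: "cj G g (gen i) \<noteq> cj G h (gen j)" for j g h
  proof -
    have gj: "gen j \<in> carrier G" using small_vert j by simp
    \<comment> \<open>Translation by \<open>inv x\<close> moves one of the two vertices into
      standard position, where the preceding results apply.\<close>
    have *: "com G (gen a) (cj G (inv x \<otimes> y) (gen b)) \<and> gen a \<noteq> cj G (inv x \<otimes> y) (gen b)"
      if "gen a \<in> carrier G" "gen b \<in> carrier G" "x \<in> carrier G" "y \<in> carrier G"
        "com G (cj G x (gen a)) (cj G y (gen b))" "cj G x (gen a) \<noteq> cj G y (gen b)" for a b x y
      using that com_cj[of "inv x" "cj G x (gen a)" "cj G y (gen b)"] cj_eq_iff[of "inv x" "cj G x (gen a)" "cj G y (gen b)"]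
      by (simp add: cj_cj[symmetric])
    have **: "b \<noteq> 0 \<and> (\<exists>u\<in>carrier G. cj G u (gen 0) = cj G x (gen 0) \<and> cj G u (gen b) = cj G y (gen b))"
      if asm: "b \<le> 2" "gen b \<in> carrier G" "x \<in> carrier G" "y \<in> carrier G"
        "com G (cj G x (gen 0)) (cj G y (gen b))" "cj G x (gen 0) \<noteq> cj G y (gen b)" for b x y
    proof -
      obtain u where u: "b \<noteq> 0" "u \<in> carrier G" "cj G u (gen 0) = gen 0" "cj G u (gen b) = cj G (inv x \<otimes> y) (gen b)"
        using adjacent_centre[of b "inv x \<otimes> y"] asm *[of 0 b x y] by auto
      have "cj G (x \<otimes> u) (gen 0) = cj G x (gen 0)" using u asm by (simp add: cj_cj[symmetric])
      moreover have "cj G (x \<otimes> u) (gen b) = cj G y (gen b)" using u asm by (simp add: cj_cj[symmetric])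
      ultimately show ?thesis using u asm by blast
    qed
    show ?thesis
    proof (cases "i = 0")
      case True
      then show ?thesis using **[of j g h] j gj g h com ne by auto
    next
      case i0: False
      show ?thesis
      proof (cases "j = 0")
        case True
        then show ?thesis using **[of i h g] i gi g h com ne com_sym[of "cj G g (gen i)"] by auto
      next
        case False
        then have ij: "i \<in> {1, 2}" "j \<in> {1, 2}" using i j i0 by auto
        have "gen i = cj G (inv g \<otimes> h) (gen j)"
          by (rule branches_not_adjacent) (use ij *[of i j g h] gi gj g h com ne in auto)
        then show ?thesis using *[of i j g h] gi gj g h com ne by auto
      qed
    qed
  qed
next
  show "\<exists>(k::int) (l::int). x = gen 0 [^] k \<otimes> gen j [^] l"
    if j: "j \<in> {1, 2}" and x: "x \<in> carrier G" "com G x (gen 0)" "com G x (gen j)" for j x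
  proof -
    have gj: "gen j \<in> carrier G" using small_vert j by auto
    have "com G x (gen 0 [^] (1::int))" using x by simp
    then obtain k :: int and q where kq: "q \<in> Q" "x = gen 0 [^] k \<otimes> q"
      using centralizer_centre[of x 1] x by auto
    have qc: "q \<in> carrier G" using kq Q_carrier by simp
    have "com G (gen j) (gen 0 [^] k)" using com_centre[of j] j gj by (intro com_int_pow) (auto simp: com_sym)
    then have "com G (gen j) q" using com_cancel[of "gen j" "gen 0 [^] k" q] x kq qc gj by (simp add: com_sym)
    then have "com G q (gen j [^] (1::int))" using gj by (simp add: com_sym)
    moreover have "gen j \<in> T" using j by (auto simp: T_def)
    ultimately show ?thesis using Qf.centralizer_basis[of "gen j" q 1] kq by auto
  qed
next
  fix g x y assume *: "g \<in> carrier G" "g \<noteq> \<one>" "x \<in> carrier G" "y \<in> carrier G" "com G x g" "com G y g" "\<not> com G x y"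
  obtain h t k where h: "h \<in> carrier G" "t \<in> insert (gen 0) T" "g = cj G h (t [^] (k::int))"
    using PS.nonabelian_centralizer[OF *(1,2,3,5,4,6,7)] by blast
  then have "k \<noteq> 0" using *(2) by (auto intro: ccontr)
  moreover have "\<exists>i\<le>2. t = gen i"
  proof -
    have "t = gen 0 \<or> t = gen 1 \<or> t = gen 2" using h(2) by (auto simp: T_def)
    then show ?thesis by (metis le0 le_refl one_le_numeral)
  qed
  ultimately show "\<exists>h\<in>carrier G. \<exists>i\<le>2. \<exists>k::int. k \<noteq> 0 \<and> g = cj G h (gen i [^] k)" using h by blast
next
  have "gen v \<in> carrier G \<and> (\<exists>i\<le>2. com G (gen v) (gen i))" if v: "v \<in> P_verts d1 d2" for v
  proof -
    consider "v \<le> 2" | i where "i \<in> {1, 2}" "v \<in> leaves i" using v unfolding verts by auto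
    then show ?thesis
    proof cases
      case 1
      then show ?thesis using v by (intro conjI gen_carrier exI[of _ v]) auto
    next
      case (2 i)
      then show ?thesis using v com_leaf[OF 2] by (intro conjI gen_carrier exI[of _ i]) (auto simp: com_sym)
    qed
  qed
  then have "gen ` P_verts d1 d2 \<subseteq> {s \<in> carrier G. \<exists>i\<le>2. com G s (gen i)}" by blast
  then show "carrier G \<subseteq> generate G {s \<in> carrier G. \<exists>i\<le>2. com G s (gen i)}"
    by (subst (1) carrier_generated) (rule mono_generate)
qed

end

section \<open>Counting homomorphisms to the group of order two\<close>

text \<open>Homomorphisms from \<open>D\<close> to the group of order two that are trivial on
  \<open>Z\<close>, with \<open>bool\<close> under \<open>\<noteq>\<close> as that group. The value
  False outside \<open>D\<close> makes each of them a single function, so that they can be counted.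
  If \<open>D\<close> modulo \<open>Z\<close> is free of rank r, there are 2^r of them.\<close>

definition Z2hom :: "('a, 'c) monoid_scheme \<Rightarrow> 'a set \<Rightarrow> 'a set \<Rightarrow> ('a \<Rightarrow> bool) set" where
  "Z2hom G D Z = {\<theta>. (\<forall>x. x \<notin> D \<longrightarrow> \<not> \<theta> x) \<and>
     (\<forall>x\<in>D. \<forall>y\<in>D. \<theta> (x \<otimes>\<^bsub>G\<^esub> y) = (\<theta> x \<noteq> \<theta> y)) \<and> (\<forall>x\<in>Z. \<not> \<theta> x)}"

lemma card_supported_predicates:
  assumes "finite A" shows "card {w. \<forall>x. w x \<longrightarrow> x \<in> A} = 2 ^ card A"
proof -
  have "bij_betw Collect {w. \<forall>x. w x \<longrightarrow> x \<in> A} (Pow A)"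
    by (rule bij_betw_byWitness[where f' = "\<lambda>A x. x \<in> A"]) auto
  from bij_betw_same_card[OF this] show ?thesis by (simp add: card_Pow[OF assms])
qed

text \<open>The group \<open>C\<close> is generated by the central element \<open>p\<close> and the family \<open>bb\<close>, and it is free
  on \<open>bb\<close> modulo \<open>p\<close>.  Schreier's index formula for the image of \<open>D\<close> in that free group is obtained
  by computing the group of cocycles of \<open>C\<close> on the cosets of \<open>D\<close> twice: a cocycle is determined by its
  arbitrary values on \<open>bb\<close>, and also by a homomorphism on \<open>D\<close> together with its values on a transversal.\<close>

locale coset_cocycles = group G for G (structure) +
  fixes C D :: "'a set" and p and B :: "'i set" and bb :: "'i \<Rightarrow> 'a"
  assumes C: "subgroup C G" and D: "subgroup D G" "D \<subseteq> C" and p: "p \<in> D" "\<And>g. g \<in> C \<Longrightarrow> com G g p"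
    and gen: "C \<subseteq> generate G (insert p (bb ` B))" "bb ` B \<subseteq> C" and fin: "finite B" "finite ((\<lambda>g. D #> g) ` C)"
    and univ: "\<And>\<phi>. (\<And>b. b \<in> B \<Longrightarrow> \<phi> b \<in> carrier (BijGroup ((\<lambda>g. D #> g) ` C \<times> (UNIV :: bool set)))) \<Longrightarrow>
       \<exists>\<psi>\<in>hom G (BijGroup ((\<lambda>g. D #> g) ` C \<times> UNIV)). (\<forall>b\<in>B. \<psi> (bb b) = \<phi> b) \<and>
         \<psi> p = \<one>\<^bsub>BijGroup ((\<lambda>g. D #> g) ` C \<times> UNIV)\<^esub>"
begin

definition Y where "Y = (\<lambda>g. D #> g) ` C"

lemma Y_fin: "finite Y"
  using fin by (simp add: Y_def)

text \<open>The 1-cocycles of \<open>C\<close>, trivial at \<open>p\<close>, with coefficients in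
  the Z/2-valued functions on the cosets of \<open>D\<close>. This is a coinduced module, so the
  second count below is Shapiro's lemma at the level of cocycles.\<close>

definition ZZ :: "('a \<Rightarrow> 'a set \<Rightarrow> bool) set" where
  "ZZ = {z. (\<forall>g y. z g y \<longrightarrow> g \<in> C \<and> y \<in> Y) \<and> (\<forall>g\<in>C. \<forall>h\<in>C. \<forall>y\<in>Y. z (g \<otimes> h) y = (z g y \<noteq> z h (y #> g)))
     \<and> (\<forall>y\<in>Y. \<not> z p y)}"

definition cochains :: "('i \<times> 'a set \<Rightarrow> bool) set" where
  "cochains = {w. \<forall>x. w x \<longrightarrow> x \<in> B \<times> Y}"

text \<open>The coset \<open>D\<close> is left out because its representative is
  \<open>\<one>\<close>, where every cocycle vanishes.\<close>

definition UU :: "('a set \<Rightarrow> bool) set" where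
  "UU = {u. \<forall>y. u y \<longrightarrow> y \<in> Y - {D}}"

lemma C_carrier: "g \<in> C \<Longrightarrow> g \<in> carrier G"
  using C by (simp add: subgroup.mem_carrier)

lemma D_carrier: "D \<subseteq> carrier G"
  using D C_carrier by auto

lemma C_closed: "g \<in> C \<Longrightarrow> h \<in> C \<Longrightarrow> g \<otimes> h \<in> C" "g \<in> C \<Longrightarrow> inv g \<in> C" "\<one> \<in> C" "p \<in> C"
  using C D p by (auto simp: subgroup.m_closed subgroup.m_inv_closed subgroup.one_closed)

lemma Y_act:
  assumes "y \<in> Y" "g \<in> C"
  shows "y #> g \<in> Y" "h \<in> C \<Longrightarrow> (y #> g) #> h = y #> (g \<otimes> h)" "y #> \<one> = y" "y #> p = y"
proof -
  obtain c where c: "c \<in> C" "y = D #> c" using assms(1) unfolding Y_def by blast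
  have "y #> g = D #> (c \<otimes> g)" unfolding c(2) using assms c C_carrier D_carrier by (intro coset_mult_assoc) auto
  then show "y #> g \<in> Y" using c assms C_closed by (auto simp: Y_def)
  have ys: "y \<subseteq> carrier G" unfolding c(2) using D_carrier c C_carrier by (intro r_coset_subset_G) auto
  then show "h \<in> C \<Longrightarrow> (y #> g) #> h = y #> (g \<otimes> h)" "y #> \<one> = y"
    using assms C_carrier by (auto simp: coset_mult_assoc)
  have "y #> p = D #> (c \<otimes> p)" unfolding c(2) using c C_carrier D_carrier C_closed(4) by (intro coset_mult_assoc) auto
  also have "\<dots> = D #> (p \<otimes> c)" using p(2)[OF c(1)] by (simp add: com_def)
  also have "\<dots> = (D #> p) #> c" using c C_carrier D_carrier C_closed(4) by (intro coset_mult_assoc[symmetric]) auto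
  also have "D #> p = D" using D p C_carrier C_closed by (intro coset_join2) auto
  finally show "y #> p = y" using c by simp
qed

lemma Y_cancel: "y \<in> Y \<Longrightarrow> g \<in> C \<Longrightarrow> (y #> inv g) #> g = y" "y \<in> Y \<Longrightarrow> g \<in> C \<Longrightarrow> (y #> g) #> inv g = y"
  using Y_act C_closed C_carrier by (simp_all)

lemma D_Y: "D \<in> Y"
  using coset_mult_one[OF D_carrier] C_closed(3) unfolding Y_def by force

lemma C_induct:
  assumes "g \<in> C" "subgroup A G" "p \<in> A" "\<And>b. b \<in> B \<Longrightarrow> bb b \<in> A"
  shows "g \<in> A"
proof -
  have "generate G (insert p (bb ` B)) \<subseteq> A" using assms by (intro generate_subgroup_incl) auto
  then show ?thesis using gen assms by blast
qed

lemma ZZ_D: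
  assumes "z \<in> ZZ"
  shows "z g y \<Longrightarrow> g \<in> C" "z g y \<Longrightarrow> y \<in> Y" "y \<in> Y \<Longrightarrow> \<not> z p y"
    "g \<in> C \<Longrightarrow> h \<in> C \<Longrightarrow> y \<in> Y \<Longrightarrow> z (g \<otimes> h) y = (z g y \<noteq> z h (y #> g))"
proof -
  note zz = assms[unfolded ZZ_def mem_Collect_eq]
  show "z g y \<Longrightarrow> g \<in> C" "z g y \<Longrightarrow> y \<in> Y" using conjunct1[OF zz] by blast+
  show "y \<in> Y \<Longrightarrow> \<not> z p y" using conjunct2[OF conjunct2[OF zz]] by blast
  show "g \<in> C \<Longrightarrow> h \<in> C \<Longrightarrow> y \<in> Y \<Longrightarrow> z (g \<otimes> h) y = (z g y \<noteq> z h (y #> g))"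
    by (rule bspec[OF bspec[OF bspec[OF conjunct1[OF conjunct2[OF zz]]]]])
qed

lemma ZZ_one: "z \<in> ZZ \<Longrightarrow> y \<in> Y \<Longrightarrow> \<not> z \<one> y"
  using ZZ_D(4)[of z \<one> \<one> y] C_closed Y_act(3)[of y \<one>] by auto

lemma ZZ_inv: "z \<in> ZZ \<Longrightarrow> y \<in> Y \<Longrightarrow> g \<in> C \<Longrightarrow> z (inv g) y = z g (y #> inv g)"
  using ZZ_D(4)[of z g "inv g" "y #> inv g"] ZZ_one[of z "y #> inv g"] C_closed C_carrier Y_act(1)[of y "inv g"] Y_cancel(1)[of y g]
  by auto

definition restr :: "('a \<Rightarrow> 'a set \<Rightarrow> bool) \<Rightarrow> 'i \<times> 'a set \<Rightarrow> bool" where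
  "restr z x = (x \<in> B \<times> Y \<and> z (bb (fst x)) (snd x))"

text \<open>The elements at which two cocycles agree form a subgroup, and it contains the generators
  of \<open>C\<close>.\<close>

lemma restr_inj: "inj_on restr ZZ"
proof (rule inj_onI)
  fix z z' assume z: "z \<in> ZZ" "z' \<in> ZZ" "restr z = restr z'"
  have b: "z (bb b) y = z' (bb b) y" if "b \<in> B" "y \<in> Y" for b y
    using fun_cong[OF z(3), of "(b, y)"] that by (simp add: restr_def)
  have "subgroup {g \<in> C. \<forall>y\<in>Y. z g y = z' g y} G"
  proof (rule subgroupI)
    have "\<one> \<in> {g \<in> C. \<forall>y\<in>Y. z g y = z' g y}" using C_closed(3) ZZ_one[OF z(1)] ZZ_one[OF z(2)] by simp
    then show "{g \<in> C. \<forall>y\<in>Y. z g y = z' g y} \<noteq> {}" by blast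
  qed (use C_carrier C_closed ZZ_D(4)[OF z(1)] ZZ_D(4)[OF z(2)] ZZ_inv[OF z(1)] ZZ_inv[OF z(2)] Y_act(1) in auto)
  then have sg: "subgroup {g \<in> C. \<forall>y\<in>Y. z g y = z' g y} G" .
  have pA: "p \<in> {g \<in> C. \<forall>y\<in>Y. z g y = z' g y}"
    using ZZ_D(3)[OF z(1)] ZZ_D(3)[OF z(2)] C_closed(4) by simp
  have bA: "bb x \<in> {g \<in> C. \<forall>y\<in>Y. z g y = z' g y}" if "x \<in> B" for x
    using b[OF that] gen(2) that by blast
  have *: "z g y = z' g y" if g: "g \<in> C" and y: "y \<in> Y" for g y
  proof -
    have "g \<in> {g \<in> C. \<forall>y\<in>Y. z g y = z' g y}" by (rule C_induct[OF g sg pA bA])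
    then show ?thesis using y by blast
  qed
  show "z = z'"
  proof (intro ext)
    fix g y show "z g y = z' g y"
      using *[of g y] ZZ_D(1,2)[OF z(1), of g y] ZZ_D(1,2)[OF z(2), of g y] by blast
  qed
qed

text \<open>Prescribed values on the generators define permutations of
  \<open>Y \<times> UNIV\<close> that shift the coset and flip the bit. The freeness hypothesis
  \<open>univ\<close> extends them to a homomorphism, and the flips performed by an arbitrary
  element of \<open>C\<close> form the desired cocycle.\<close>

lemma restr_image: "restr ` ZZ = cochains"
proof
  show "restr ` ZZ \<subseteq> cochains" by (auto simp: restr_def cochains_def)
  show "cochains \<subseteq> restr ` ZZ"
  proof
    fix w assume w: "w \<in> cochains"
    define \<Omega> where "\<Omega> = Y \<times> (UNIV :: bool set)"
    \<comment> \<open>Cosets are multiplied on the right whereas permutations compose on the left;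
      hence the inverse, which makes \<open>bb b\<close> send \<open>y #> bb b\<close> back to
      \<open>y\<close>. The bit is changed by \<open>w\<close> at this target coset.\<close>
    define \<beta> where "\<beta> b = restrict (\<lambda>(y, e). (y #> inv (bb b), e \<noteq> w (b, y #> inv (bb b)))) \<Omega>" for b
    have bC: "bb b \<in> C" if "b \<in> B" for b using gen(2) that by blast
    have "bij_betw (\<lambda>(y, e). (y #> inv (bb b), e \<noteq> w (b, y #> inv (bb b)))) \<Omega> \<Omega>" if "b \<in> B" for b
      by (rule bij_betw_byWitness[where f' = "\<lambda>(y, e). (y #> bb b, e \<noteq> w (b, y))"])
         (use bC[OF that] Y_act(1) Y_cancel C_closed in \<open>auto simp: \<Omega>_def\<close>)
    then have "\<beta> b \<in> carrier (BijGroup \<Omega>)" if "b \<in> B" for b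
      using that by (simp add: BijGroup_def Bij_def \<beta>_def bij_betw_restrict_eq)
    then obtain \<psi> where \<psi>: "\<psi> \<in> hom G (BijGroup \<Omega>)" "\<And>b. b \<in> B \<Longrightarrow> \<psi> (bb b) = \<beta> b" "\<psi> p = \<one>\<^bsub>BijGroup \<Omega>\<^esub>"
      using univ[of \<beta>] unfolding \<Omega>_def Y_def by blast
    interpret h: group_hom G "BijGroup \<Omega>" \<psi>
      using \<psi>(1) is_group group_BijGroup by (simp add: group_hom_def group_hom_axioms_def)
    have \<psi>m: "\<psi> (g \<otimes> h) x = \<psi> g (\<psi> h x)" if "g \<in> C" "h \<in> C" "x \<in> \<Omega>" for g h x
    proof -
      have "\<psi> g \<in> Bij \<Omega>" "\<psi> h \<in> Bij \<Omega>" using h.hom_closed C_carrier that by (auto simp: BijGroup_def)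
      then show ?thesis using that C_carrier by (simp add: BijGroup_def compose_def)
    qed
    have \<psi>1: "\<psi> \<one> x = x" if "x \<in> \<Omega>" for x using that by (simp add: BijGroup_def)
    \<comment> \<open>The elements acting in skew form, with a flip that does not depend on the bit.
      They form a subgroup containing the generators, so they exhaust \<open>C\<close>.\<close>
    define A where "A = {g \<in> C. \<forall>y\<in>Y. \<exists>t. \<forall>e. \<psi> g (y #> g, e) = (y, e \<noteq> t)}"
    have Am: "\<psi> (g \<otimes> h) (y #> (g \<otimes> h), e) = (y, (e \<noteq> t) \<noteq> s)"
      if "g \<in> C" "h \<in> C" "y \<in> Y" "\<forall>e. \<psi> g (y #> g, e) = (y, e \<noteq> s)" "\<forall>e. \<psi> h (y #> g #> h, e) = (y #> g, e \<noteq> t)"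
      for g h y e s t
    proof -
      have "y #> (g \<otimes> h) = y #> g #> h" using Y_act(2)[OF that(3,1,2)] by simp
      moreover have "(y #> g #> h, e) \<in> \<Omega>" using that Y_act(1) by (auto simp: \<Omega>_def)
      ultimately show ?thesis using that by (simp add: \<psi>m)
    qed
    have "subgroup A G"
    proof (rule subgroupI)
      show "A \<subseteq> carrier G" using C_carrier by (auto simp: A_def)
      have "\<one> \<in> A" unfolding A_def using C_closed Y_act(3) \<psi>1 by (auto simp: \<Omega>_def intro!: exI[of _ False])
      then show "A \<noteq> {}" by blast
    next
      fix g assume g: "g \<in> A"
      then have gC: "g \<in> C" by (simp add: A_def)
      show "inv g \<in> A" unfolding A_def
      proof (intro CollectI conjI ballI C_closed gC)
        fix y assume y: "y \<in> Y"
        have y': "y #> inv g \<in> Y" using y gC Y_act(1) C_closed by blast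
        then obtain t where t: "\<forall>e. \<psi> g (y #> inv g #> g, e) = (y #> inv g, e \<noteq> t)" using g unfolding A_def by blast
        have "\<psi> (inv g) (y #> inv g, e) = (y, e \<noteq> t)" for e
        proof -
          have "\<psi> (inv g) (\<psi> g (y, e \<noteq> t)) = \<psi> (inv g \<otimes> g) (y, e \<noteq> t)"
            using \<psi>m[of "inv g" g "(y, e \<noteq> t)"] gC C_closed y by (simp add: \<Omega>_def)
          also have "\<dots> = (y, e \<noteq> t)" using \<psi>1 y gC C_carrier by (simp add: \<Omega>_def)
          also have "\<psi> g (y, e \<noteq> t) = (y #> inv g, e)" using t Y_cancel(1)[OF y gC] by auto
          finally show ?thesis .
        qed
        then show "\<exists>t. \<forall>e. \<psi> (inv g) (y #> inv g, e) = (y, e \<noteq> t)" by blast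
      qed
    next
      fix g h assume gh: "g \<in> A" "h \<in> A"
      then have C: "g \<in> C" "h \<in> C" by (simp_all add: A_def)
      show "g \<otimes> h \<in> A" unfolding A_def
      proof (intro CollectI conjI ballI C_closed C)
        fix y assume y: "y \<in> Y"
        obtain s where s: "\<forall>e. \<psi> g (y #> g, e) = (y, e \<noteq> s)" using gh(1) y unfolding A_def by blast
        have "y #> g \<in> Y" using y C Y_act(1) by blast
        then obtain t where t: "\<forall>e. \<psi> h (y #> g #> h, e) = (y #> g, e \<noteq> t)" using gh(2) unfolding A_def by blast
        have "\<psi> (g \<otimes> h) (y #> (g \<otimes> h), e) = (y, e \<noteq> (t \<noteq> s))" for e
          using Am[OF C y s t, of e] by auto
        then show "\<exists>t. \<forall>e. \<psi> (g \<otimes> h) (y #> (g \<otimes> h), e) = (y, e \<noteq> t)" by blast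
      qed
    qed
    moreover have "p \<in> A" unfolding A_def using C_closed(4) Y_act(4)[OF _ C_closed(4)] \<psi>(3)
      by (auto simp: \<Omega>_def BijGroup_def intro!: exI[of _ False])
    moreover have \<beta>: "\<psi> (bb b) (y #> bb b, e) = (y, e \<noteq> w (b, y))" if "b \<in> B" "y \<in> Y" for b y e
      using \<psi>(2)[OF that(1)] Y_act(1)[OF that(2) bC[OF that(1)]] Y_cancel(2)[OF that(2) bC[OF that(1)]]
      by (simp add: \<beta>_def \<Omega>_def)
    then have "bb b \<in> A" if "b \<in> B" for b unfolding A_def using that bC by blast
    ultimately have "C \<subseteq> A" using C_induct by blast
    then obtain z0 where z0: "\<And>g y e. g \<in> C \<Longrightarrow> y \<in> Y \<Longrightarrow> \<psi> g (y #> g, e) = (y, e \<noteq> z0 g y)"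
    proof -
      have "\<forall>g y. \<exists>t. g \<in> C \<and> y \<in> Y \<longrightarrow> (\<forall>e. \<psi> g (y #> g, e) = (y, e \<noteq> t))"
        using \<open>C \<subseteq> A\<close> unfolding A_def by blast
      then show ?thesis using that by metis
    qed
    define z where "z g y = (g \<in> C \<and> y \<in> Y \<and> z0 g y)" for g y
    have z: "\<psi> g (y #> g, e) = (y, e \<noteq> z g y)" if "g \<in> C" "y \<in> Y" for g y e
      using z0 that by (simp add: z_def)
    have "z \<in> ZZ" unfolding ZZ_def
    proof (intro CollectI conjI ballI)
      show "\<forall>g y. z g y \<longrightarrow> g \<in> C \<and> y \<in> Y" by (simp add: z_def)
      fix y assume y: "y \<in> Y"
      show "\<not> z p y" using z[OF C_closed(4) y, of False] \<psi>(3) y Y_act(4)[OF y C_closed(4)] by (simp add: BijGroup_def \<Omega>_def)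
      fix g h assume gh: "g \<in> C" "h \<in> C"
      have "\<psi> (g \<otimes> h) (y #> (g \<otimes> h), False) = (y, (False \<noteq> z h (y #> g)) \<noteq> z g y)"
        by (rule Am[OF gh y]) (use z gh y Y_act(1)[OF y gh(1)] in simp_all)
      then show "z (g \<otimes> h) y = (z g y \<noteq> z h (y #> g))" using z[OF C_closed(1)[OF gh] y, of False] by auto
    qed
    moreover have "restr z = w"
    proof (rule ext)
      fix x show "restr z x = w x"
      proof (cases "x \<in> B \<times> Y")
        case True
        then obtain b y where x: "x = (b, y)" "b \<in> B" "y \<in> Y" by blast
        then show ?thesis using \<beta>[OF x(2,3), of False] z[OF bC[OF x(2)] x(3), of False] by (simp add: restr_def)
      next
        case False
        then have "\<not> w x" "\<not> restr z x" using w by (auto simp only: restr_def cochains_def mem_Collect_eq)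
        then show ?thesis by simp
      qed
    qed
    ultimately show "w \<in> restr ` ZZ" by blast
  qed
qed

lemma card_ZZ: "card ZZ = 2 ^ (card B * card Y)"
proof -
  have "card ZZ = card cochains" using card_image[OF restr_inj] restr_image by simp
  also have "\<dots> = 2 ^ card (B \<times> Y)" unfolding cochains_def
    by (rule card_supported_predicates) (use fin Y_fin in simp)
  finally show ?thesis by (simp add: card_cartesian_product)
qed

text \<open>The representative of \<open>D\<close> must be \<open>\<one>\<close>: this makes
  \<open>dd d D = d\<close> for \<open>d\<close> in \<open>D\<close>, so that a cocycle restricts to
  a homomorphism on \<open>D\<close> without correction.\<close>

definition tr :: "'a set \<Rightarrow> 'a" where
  "tr y = (if y = D then \<one> else SOME c. c \<in> C \<and> D #> c = y)"

lemma tr: "y \<in> Y \<Longrightarrow> tr y \<in> C \<and> D #> tr y = y"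
proof (cases "y = D")
  case True
  then show ?thesis using C_closed(3) coset_mult_one[OF D_carrier] by (simp add: tr_def)
next
  case False
  assume "y \<in> Y"
  then have "\<exists>c. c \<in> C \<and> D #> c = y" unfolding Y_def by blast
  from someI_ex[OF this] show ?thesis using False by (simp add: tr_def)
qed

text \<open>The Schreier element of \<open>g\<close> at \<open>y\<close>, which lies in
  \<open>D\<close>.\<close>

definition dd :: "'a \<Rightarrow> 'a set \<Rightarrow> 'a" where
  "dd g y = tr y \<otimes> g \<otimes> inv (tr (y #> g))"

lemma dd_D: "g \<in> C \<Longrightarrow> y \<in> Y \<Longrightarrow> dd g y \<in> D"
proof -
  assume g: "g \<in> C" and y: "y \<in> Y"
  have t: "tr y \<in> C" "D #> tr y = y" "tr (y #> g) \<in> C" "D #> tr (y #> g) = y #> g"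
    using tr y Y_act(1)[OF y g] by auto
  have "D #> (tr y \<otimes> g) = y #> g" using t g C_carrier D_carrier by (simp flip: coset_mult_assoc)
  then have "D #> (tr y \<otimes> g) = D #> tr (y #> g)" using t by simp
  then have "tr y \<otimes> g \<in> D #> tr (y #> g)"
    using rcos_self[OF _ D(1), of "tr y \<otimes> g"] t g C_carrier by auto
  then show ?thesis unfolding dd_def
    using subgroup.rcos_module_imp[OF D(1) is_group, of "tr (y #> g)" "tr y \<otimes> g"] t C_carrier by simp
qed

lemma dd_eq: "g \<in> C \<Longrightarrow> y \<in> Y \<Longrightarrow> tr y \<otimes> g = dd g y \<otimes> tr (y #> g)"
  using tr[of y] tr[OF Y_act(1)[of y g]] C_carrier by (simp add: dd_def m_assoc)

definition split :: "('a \<Rightarrow> 'a set \<Rightarrow> bool) \<Rightarrow> ('a \<Rightarrow> bool) \<times> ('a set \<Rightarrow> bool)" where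
  "split z = ((\<lambda>d. d \<in> D \<and> z d D), (\<lambda>y. y \<in> Y \<and> z (tr y) D))"

lemma D_act: "d \<in> D \<Longrightarrow> D #> d = D"
  using D D_carrier by (intro coset_join2) auto

text \<open>The two sides of \<open>tr y \<otimes> g = dd g y \<otimes> tr (y #> g)\<close> are
  expanded by the cocycle rule at the coset \<open>D\<close>.\<close>

lemma ZZ_formula:
  assumes z: "z \<in> ZZ" and "g \<in> C" "y \<in> Y"
  shows "z g y = (z (tr y) D \<noteq> (z (dd g y) D \<noteq> z (tr (y #> g)) D))"
proof -
  have t: "tr y \<in> C" "D #> tr y = y" "tr (y #> g) \<in> C" using tr assms Y_act(1)[OF assms(3,2)] by auto
  have d: "dd g y \<in> D" using dd_D assms by blast
  have "z (tr y \<otimes> g) D = (z (tr y) D \<noteq> z g y)" using ZZ_D(4)[OF z t(1) assms(2) D_Y] t by simp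
  moreover have "z (dd g y \<otimes> tr (y #> g)) D = (z (dd g y) D \<noteq> z (tr (y #> g)) D)"
    using ZZ_D(4)[OF z _ t(3) D_Y, of "dd g y"] d D(2) D_act[OF d] by auto
  ultimately show ?thesis using dd_eq[OF assms(2,3)] by auto
qed

lemma split_inj: "inj_on split ZZ"
proof (rule inj_onI)
  fix z z' assume z: "z \<in> ZZ" "z' \<in> ZZ" "split z = split z'"
  have 1: "z d D = z' d D" if "d \<in> D" for d
    using fun_cong[OF arg_cong[OF z(3), of fst], of d] that by (simp add: split_def)
  have 2: "z (tr y) D = z' (tr y) D" if "y \<in> Y" for y
    using fun_cong[OF arg_cong[OF z(3), of snd], of y] that by (simp add: split_def)
  show "z = z'"
  proof (intro ext)
    fix g y show "z g y = z' g y"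
    proof (cases "g \<in> C \<and> y \<in> Y")
      case True
      then have "g \<in> C" "y \<in> Y" by auto
      then show ?thesis
        using ZZ_formula[OF z(1), of g y] ZZ_formula[OF z(2), of g y] 1[OF dd_D] 2[of y] 2[OF Y_act(1)[of y g]] by simp
    next
      case False
      then show ?thesis using ZZ_D(1,2)[OF z(1), of g y] ZZ_D(1,2)[OF z(2), of g y] by auto
    qed
  qed
qed

text \<open>Conversely, \<open>ZZ_formula\<close> is taken as the definition of \<open>z\<close>. It
  is a cocycle because Schreier elements multiply:
  \<open>dd (g \<otimes> h) y = dd g y \<otimes> dd h (y #> g)\<close>.\<close>

lemma split_image: "split ` ZZ = Z2hom G D {p} \<times> UU"
proof
  show "split ` ZZ \<subseteq> Z2hom G D {p} \<times> UU"
  proof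
    fix x assume "x \<in> split ` ZZ"
    then obtain z where z: "z \<in> ZZ" "x = split z" by blast
    have "z (a \<otimes> b) D = (z a D \<noteq> z b D)" if "a \<in> D" "b \<in> D" for a b
      using ZZ_D(4)[OF z(1), of a b D] that D(2) D_Y D_act by auto
    then have "fst x \<in> Z2hom G D {p}"
      using ZZ_D(3)[OF z(1) D_Y] subgroup.m_closed[OF D(1)] by (auto simp: z(2) split_def Z2hom_def)
    moreover have "snd x \<in> UU" using ZZ_one[OF z(1) D_Y] by (auto simp: z(2) split_def UU_def tr_def)
    ultimately show "x \<in> Z2hom G D {p} \<times> UU" by (simp add: mem_Times_iff)
  qed
  show "Z2hom G D {p} \<times> UU \<subseteq> split ` ZZ"
  proof
    fix x assume "x \<in> Z2hom G D {p} \<times> UU"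
    then obtain \<theta> u where x: "x = (\<theta>, u)" "\<theta> \<in> Z2hom G D {p}" "u \<in> UU" by blast
    have \<theta>: "\<theta> d \<Longrightarrow> d \<in> D" "a \<in> D \<Longrightarrow> b \<in> D \<Longrightarrow> \<theta> (a \<otimes> b) = (\<theta> a \<noteq> \<theta> b)" "\<not> \<theta> p" for a b d
      using x(2) unfolding Z2hom_def by blast+
    have u: "u y \<Longrightarrow> y \<in> Y" "\<not> u D" for y using x(3) unfolding UU_def by blast+
    have \<theta>1: "\<not> \<theta> \<one>" using \<theta>(2)[of \<one> \<one>] subgroup.one_closed[OF D(1)] by simp
    define z where "z g y = (g \<in> C \<and> y \<in> Y \<and> (u y \<noteq> (\<theta> (dd g y) \<noteq> u (y #> g))))" for g y
    have "z \<in> ZZ" unfolding ZZ_def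
    proof (intro CollectI conjI ballI)
      show "\<forall>g y. z g y \<longrightarrow> g \<in> C \<and> y \<in> Y" by (simp add: z_def)
      fix y assume y: "y \<in> Y"
      have "dd p y = p"
      proof -
        have t: "tr y \<in> C" using tr y by blast
        have "dd p y = tr y \<otimes> p \<otimes> inv (tr y)" using Y_act(4)[OF y C_closed(4)] by (simp add: dd_def)
        also have "tr y \<otimes> p = p \<otimes> tr y" using p(2)[OF t] by (simp add: com_def)
        finally show ?thesis using t C_closed(4) C_carrier by (simp add: m_assoc)
      qed
      then show "\<not> z p y" using \<theta>(3) Y_act(4)[OF y C_closed(4)] by (simp add: z_def)
      fix g h assume gh: "g \<in> C" "h \<in> C"
      have yg: "y #> g \<in> Y" using Y_act(1) y gh by blast
      have t: "tr y \<in> carrier G" "tr (y #> g) \<in> carrier G" "tr (y #> g #> h) \<in> carrier G"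
        using tr C_carrier y yg Y_act(1)[OF yg gh(2)] by auto
      have "dd (g \<otimes> h) y = dd g y \<otimes> dd h (y #> g)"
        unfolding dd_def using t gh C_carrier Y_act(2)[OF y gh] by (simp add: m_assoc)
      then have "\<theta> (dd (g \<otimes> h) y) = (\<theta> (dd g y) \<noteq> \<theta> (dd h (y #> g)))"
        using \<theta>(2) dd_D gh y yg by simp
      then show "z (g \<otimes> h) y = (z g y \<noteq> z h (y #> g))"
        using gh y yg C_closed(1) Y_act(2)[OF y gh] unfolding z_def by auto
    qed
    moreover have "split z = x"
    proof -
      have "(d \<in> D \<and> z d D) = \<theta> d" for d
      proof (cases "d \<in> D")
        case True
        then have "dd d D = d" using D_act D_carrier by (auto simp: dd_def tr_def)
        then show ?thesis using True D_Y D(2) u(2) D_act[OF True] by (auto simp: z_def)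
      qed (use \<theta> in auto)
      moreover have "(y \<in> Y \<and> z (tr y) D) = u y" for y
      proof (cases "y \<in> Y")
        case True
        then have t: "tr y \<in> C" "D #> tr y = y" using tr by auto
        then have "dd (tr y) D = \<one>" using C_carrier by (simp add: dd_def tr_def[of D])
        then show ?thesis using True t D_Y u(2) \<theta>1 by (simp add: z_def)
      qed (use u in auto)
      ultimately show ?thesis by (simp add: split_def x(1) fun_eq_iff)
    qed
    ultimately show "x \<in> split ` ZZ" by blast
  qed
qed

text \<open>The two counts of \<open>ZZ\<close> give the exponent (r + 1) |Y| - (|Y| - 1) = r |Y| +
  1, which is Schreier's rank formula for a subgroup of index |Y| in a free group of rank r +
  1.\<close>

theorem card_Z2hom:
  assumes "card B = r + 1"
  shows "card (Z2hom G D {p}) = 2 ^ (r * card Y + 1)"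
proof -
  have "card ZZ = card (Z2hom G D {p} \<times> UU)" using card_image[OF split_inj] split_image by simp
  also have "\<dots> = card (Z2hom G D {p}) * card UU" by (rule card_cartesian_product)
  also have "card UU = 2 ^ (card (Y - {D}))" unfolding UU_def
    by (rule card_supported_predicates) (use fin Y_fin in simp)
  also have "card (Y - {D}) = card Y - 1" using D_Y by (rule card_Diff_singleton)
  finally have "card (Z2hom G D {p}) * 2 ^ (card Y - 1) = 2 ^ ((r + 1) * card Y)" using card_ZZ assms by simp
  also have "(r + 1) * card Y = r * card Y + 1 + (card Y - 1)"
  proof -
    have "0 < card Y" using D_Y Y_fin card_gt_0_iff by blast
    then show ?thesis by simp
  qed
  finally show ?thesis by (simp only: power_add) simp
qed

end

text \<open>\<open>B\<close> is a basis of the centralizer modulo \<open>gen i\<close>: the two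
  branch vertices for the centre, and the centre together with the leaves for a branch vertex.
  Freeness comes from the universal property of the RAAG: no two members of \<open>B\<close> are
  adjacent, so their images may be arbitrary when all other generators go to the identity.
  Everything is then transported by conjugation with \<open>g\<close>.\<close>

lemma (in P_raag) branch_rank:
  assumes i: "i \<le> 2" and g: "g \<in> carrier G" and D: "subgroup D G" "D \<subseteq> Cent (cj G g (gen i))" "cj G g (gen i) \<in> D"
    and fin: "finite ((\<lambda>x. D #> x) ` Cent (cj G g (gen i)))"
  shows "card (Z2hom G D {cj G g (gen i)}) = 2 ^ (brank i * card ((\<lambda>x. D #> x) ` Cent (cj G g (gen i))) + 1)"
proof -
  define B where "B = (if i = 0 then {1, 2} else {0} \<union> leaves i)"
  define v where "v = cj G g (gen i)"
  have gi: "gen i \<in> carrier G" using small_vert i by simp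
  have vc: "v \<in> carrier G" using g gi by (simp add: v_def)
  have i': "i \<noteq> 0 \<Longrightarrow> i \<in> {1, 2}" using i by auto
  have BV: "B \<subseteq> P_verts d1 d2" using leaf_vert[OF i'] by (auto simp: B_def)
  have Bcom: "com G (gen b) (gen i)" if "b \<in> B" for b
  proof (cases "i = 0")
    case True
    then show ?thesis using that com_centre[of b] by (auto simp: B_def com_sym[of "gen b"])
  next
    case False
    then show ?thesis using that com_centre[OF i] com_leaf[OF i'[OF False], of b] by (auto simp: B_def com_sym[of _ "gen i"])
  qed
  have Bi: "b \<noteq> i" if "b \<in> B" for b
    using that leaf_not[of b i] i' by (auto simp: B_def split: if_splits)
  have univ: "\<exists>\<psi>\<in>hom G L. (\<forall>b\<in>B. \<psi> (gen b) = f b) \<and> \<psi> (gen i) = \<one>\<^bsub>L\<^esub>"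
    if L: "group L" and f: "\<And>b. b \<in> B \<Longrightarrow> f b \<in> carrier L" for L :: "('x, 'y) monoid_scheme" and f
  proof -
    interpret L: group L by fact
    define f' where "f' b = (if b \<in> B then f b else \<one>\<^bsub>L\<^esub>)" for b
    have f': "f' b \<in> carrier L" for b using f by (simp add: f'_def)
    have 1: "com L (f' a) (f' b)" if "a \<notin> B \<or> b \<notin> B" for a b
      using that f f' by (auto simp: f'_def)
    obtain \<psi> where "\<psi> \<in> hom G L" "\<And>v. v \<in> P_verts d1 d2 \<Longrightarrow> \<psi> (gen v) = f' v"
    proof (rule universal[OF L, of f'])
      show "com L (f' 0) (f' 1)" "com L (f' 0) (f' 2)" by (rule 1; auto simp: B_def)+
      fix j w assume "j \<in> {1, 2::nat}" "w \<in> leaves j"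
      then show "com L (f' j) (f' w)" using leaf_not[of w j] by (intro 1) (auto simp: B_def)
    qed (use f' in auto)
    then show ?thesis using BV Bi small_vert i by (intro bexI[of _ \<psi>]) (auto simp: f'_def)
  qed
  have rank: "card B = brank i + 1"
    using i by (auto simp: B_def brank_def leaves_def numeral_2_eq_2 le_Suc_eq)
  have Cv: "Cent v = cj G g ` Cent (gen i)"
  proof
    show "cj G g ` Cent (gen i) \<subseteq> Cent v" using g gi com_cj[OF g] by (auto simp: Cent_def v_def)
    show "Cent v \<subseteq> cj G g ` Cent (gen i)"
    proof
      fix x assume "x \<in> Cent v"
      then have x: "x \<in> carrier G" "com G x v" by (auto simp: Cent_def)
      then have "com G (cj G (inv g) x) (gen i)" using com_cj[of "inv g" x v] g gi by (simp add: v_def)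
      then have "cj G (inv g) x \<in> Cent (gen i)" using x g by (simp add: Cent_def)
      then show "x \<in> cj G g ` Cent (gen i)" using x g by (metis cj_cancel(1) image_eqI)
    qed
  qed
  have Cgen: "Cent (gen i) \<subseteq> generate G (insert (gen i) (gen ` B))"
  proof
    fix x assume "x \<in> Cent (gen i)"
    then have x: "x \<in> carrier G" "com G x (gen i [^] (1::int))" using gi by (auto simp: Cent_def)
    let ?W = "generate G (insert (gen i) (gen ` B))"
    have W: "subgroup ?W G" using BV gi by (intro generate_is_subgroup) auto
    show "x \<in> ?W"
    proof (cases "i = 0")
      case True
      then obtain k :: int and q where kq: "q \<in> Q" "x = gen 0 [^] k \<otimes> q" using centralizer_centre[of x 1] x by auto
      have "Q \<subseteq> ?W" using True by (intro mono_generate) (auto simp: T_def B_def)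
      then have "q \<in> ?W" using kq by blast
      moreover have "gen 0 [^] k \<in> ?W" using True W by (intro subgroup_int_pow_closed generate.incl) auto
      ultimately show ?thesis using kq W by (simp add: subgroup.m_closed)
    next
      case False
      then obtain w and k :: int where w: "letters w \<subseteq> gen ` ({0} \<union> leaves i)" "x = Kf.ev w \<otimes> gen i [^] k"
        using centralizer_branch[OF i'[OF False] x] by auto
      have "Kf.ev w \<in> generate G (gen ` ({0} \<union> leaves i))" using w by (intro word_eval_generate) auto
      also have "\<dots> \<subseteq> ?W" using False by (intro mono_generate) (auto simp: B_def)
      finally have "Kf.ev w \<in> ?W" .
      moreover have "gen i [^] k \<in> ?W" using W by (intro subgroup_int_pow_closed generate.incl) auto
      ultimately show ?thesis using w W by (simp add: subgroup.m_closed)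
    qed
  qed
  have cjgen: "cj G g x \<in> generate G (insert v ((\<lambda>b. cj G g (gen b)) ` B))" if "x \<in> generate G (insert (gen i) (gen ` B))" for x
  proof -
    have "insert (gen i) (gen ` B) \<subseteq> carrier G" using BV gi by auto
    then have "cj G g ` generate G (insert (gen i) (gen ` B)) = generate G (cj G g ` insert (gen i) (gen ` B))"
      using group_hom.generate_img[of G G "cj G g" "insert (gen i) (gen ` B)"] cj_hom[OF g] is_group
      by (simp add: group_hom_def group_hom_axioms_def)
    also have "cj G g ` insert (gen i) (gen ` B) = insert v ((\<lambda>b. cj G g (gen b)) ` B)"
      by (simp add: v_def image_image)
    finally show ?thesis using that by blast
  qed
  interpret coset_cocycles G "Cent v" D v B "\<lambda>b. cj G g (gen b)"
  proof (intro coset_cocycles.intro coset_cocycles_axioms.intro)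
    show "group G" by (rule is_group)
    show "subgroup (Cent v) G" using Cent_subgroup vc by blast
    show "subgroup D G" "D \<subseteq> Cent v" "v \<in> D" "finite ((\<lambda>x. D #> x) ` Cent v)" using D fin by (simp_all add: v_def)
    show "com G x v" if "x \<in> Cent v" for x using that by (simp add: Cent_def)
    show "Cent v \<subseteq> generate G (insert v ((\<lambda>b. cj G g (gen b)) ` B))"
      unfolding Cv using cjgen Cgen by blast
    show "(\<lambda>b. cj G g (gen b)) ` B \<subseteq> Cent v"
      unfolding Cv using Bcom BV by (auto simp: Cent_def)
    show "finite B" by (simp add: B_def leaves_def)
    fix \<phi> :: "nat \<Rightarrow> _"
    let ?L = "BijGroup ((\<lambda>x. D #> x) ` Cent v \<times> (UNIV :: bool set))"
    assume \<phi>: "\<And>b. b \<in> B \<Longrightarrow> \<phi> b \<in> carrier ?L"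
    have "\<exists>\<psi>\<in>hom G ?L. (\<forall>b\<in>B. \<psi> (gen b) = \<phi> b) \<and> \<psi> (gen i) = \<one>\<^bsub>?L\<^esub>"
      by (rule univ[OF group_BijGroup \<phi>])
    then obtain \<psi> where \<psi>: "\<psi> \<in> hom G ?L" "\<forall>b\<in>B. \<psi> (gen b) = \<phi> b" "\<psi> (gen i) = \<one>\<^bsub>?L\<^esub>" by blast
    have "\<psi> \<circ> cj G (inv g) \<in> hom G ?L" 
      using \<psi>(1) cj_hom[of "inv g"] g by (auto simp: hom_def Pi_iff)
    moreover have "(\<psi> \<circ> cj G (inv g)) (cj G g (gen b)) = \<phi> b" if b: "b \<in> B" for b
    proof -
      have "gen b \<in> carrier G" using b BV by auto
      then show ?thesis using \<psi>(2) b g by simp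
    qed
    moreover have "(\<psi> \<circ> cj G (inv g)) v = \<one>\<^bsub>?L\<^esub>" using \<psi> g gi by (simp add: v_def)
    ultimately show "\<exists>\<psi>\<in>hom G ?L. (\<forall>b\<in>B. \<psi> (cj G g (gen b)) = \<phi> b) \<and> \<psi> v = \<one>\<^bsub>?L\<^esub>" by blast
  qed
  show ?thesis unfolding v_def[symmetric] using card_Z2hom[OF rank] unfolding Y_def .
qed

section \<open>Indices of subgroups\<close>

text \<open>This is how numbers of cosets are compared throughout, also between different groups:
  only the coincidences within the two families matter.\<close>

lemma card_image_same_kernel:
  assumes "\<And>u v. u \<in> U \<Longrightarrow> v \<in> U \<Longrightarrow> f u = f v \<longleftrightarrow> g u = g v"
  shows "card (f ` U) = card (g ` U)" "finite (f ` U) \<longleftrightarrow> finite (g ` U)"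
proof -
  define h where "h = (\<lambda>y. g (SOME u. u \<in> U \<and> f u = y))"
  have h: "h (f u) = g u" if "u \<in> U" for u
  proof -
    have "(SOME v. v \<in> U \<and> f v = f u) \<in> U \<and> f (SOME v. v \<in> U \<and> f v = f u) = f u"
      by (rule someI[of _ u]) (use that in simp)
    then show ?thesis using assms that unfolding h_def by blast
  qed
  have "bij_betw h (f ` U) (g ` U)"
    unfolding bij_betw_def
  proof
    show "inj_on h (f ` U)" by (rule inj_onI) (use h assms in auto)
    show "h ` f ` U = g ` U" using h by (force simp: image_iff)
  qed
  then show "card (f ` U) = card (g ` U)" "finite (f ` U) \<longleftrightarrow> finite (g ` U)"
    by (rule bij_betw_same_card, rule bij_betw_finite)
qed

context group
begin

text \<open>\<open>A\<close> is not assumed to lie in \<open>U\<close>; counted are the right cosets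
  of \<open>A\<close> that meet \<open>U\<close>, which is the usual index of
  \<open>A \<inter> U\<close> in \<open>U\<close>.\<close>

definition index :: "'a set \<Rightarrow> 'a set \<Rightarrow> nat" where
  "index A U = card ((\<lambda>u. A #> u) ` U)"

lemma rcos_eq_iff:
  assumes "subgroup A G" "u \<in> carrier G" "v \<in> carrier G"
  shows "A #> u = A #> v \<longleftrightarrow> u \<otimes> inv v \<in> A"
proof
  assume "A #> u = A #> v"
  then have "u \<in> A #> v" using rcos_self[OF assms(2,1)] by simp
  then show "u \<otimes> inv v \<in> A" by (rule subgroup.rcos_module_imp[OF assms(1) is_group assms(3)])
next
  assume "u \<otimes> inv v \<in> A"
  then have "u \<in> A #> v" using subgroup.rcos_module_rev[OF assms(1) is_group assms(3,2)] by blast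
  then show "A #> u = A #> v" using repr_independence[OF _ assms(3,1)] by metis
qed

lemma index_Int:
  assumes "subgroup A G" "subgroup U G"
  shows "index A U = index (A \<inter> U) U" "finite ((\<lambda>u. A #> u) ` U) \<longleftrightarrow> finite ((\<lambda>u. (A \<inter> U) #> u) ` U)"
proof -
  have "A #> u = A #> v \<longleftrightarrow> (A \<inter> U) #> u = (A \<inter> U) #> v" if "u \<in> U" "v \<in> U" for u v
    using that assms subgroups_Inter_pair[OF assms] subgroup.mem_carrier[OF assms(2)]
    by (simp add: rcos_eq_iff subgroup.m_closed subgroup.m_inv_closed)
  from card_image_same_kernel[where f = "\<lambda>u. A #> u" and g = "\<lambda>u. (A \<inter> U) #> u", OF this]
  show "index A U = index (A \<inter> U) U" "finite ((\<lambda>u. A #> u) ` U) \<longleftrightarrow> finite ((\<lambda>u. (A \<inter> U) #> u) ` U)"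
    by (simp_all add: index_def)
qed

lemma index_mult:
  assumes A: "subgroup A G" and B: "subgroup B G" and U: "subgroup U G" and sub: "A \<subseteq> B" "B \<subseteq> U"
  shows "index A U = index B U * index A B"
proof -
  define t where "t M = (SOME u. u \<in> U \<and> B #> u = M)" for M
  have t: "t M \<in> U \<and> B #> t M = M" if "M \<in> (\<lambda>u. B #> u) ` U" for M
  proof -
    have "\<exists>u. u \<in> U \<and> B #> u = M" using that by blast
    from someI_ex[OF this] show ?thesis by (simp add: t_def)
  qed
  have c: "x \<in> U \<Longrightarrow> x \<in> carrier G" "x \<in> B \<Longrightarrow> x \<in> carrier G" "x \<in> B \<Longrightarrow> x \<in> U" for x
    using subgroup.mem_carrier[OF U] subgroup.mem_carrier[OF B] sub by auto
  have Ac: "A \<subseteq> carrier G" by (rule subgroup.subset[OF A])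
  let ?f = "\<lambda>(M, N). N #> t M"
  have f: "(A #> b) #> t M = A #> (b \<otimes> t M)" if "M \<in> (\<lambda>u. B #> u) ` U" "b \<in> B" for M b
    using that t c Ac by (intro coset_mult_assoc) auto
  have Bt: "B #> (b \<otimes> t M) = M" if "M \<in> (\<lambda>u. B #> u) ` U" "b \<in> B" for M b
  proof -
    have "B #> (b \<otimes> t M) = (B #> b) #> t M" using that t c subgroup.subset[OF B] by (intro coset_mult_assoc[symmetric]) auto
    also have "B #> b = B" using that B c by (intro coset_join2) auto
    finally show ?thesis using t that by simp
  qed
  have "bij_betw ?f ((\<lambda>u. B #> u) ` U \<times> (\<lambda>u. A #> u) ` B) ((\<lambda>u. A #> u) ` U)"
    unfolding bij_betw_def
  proof
    show "inj_on ?f ((\<lambda>u. B #> u) ` U \<times> (\<lambda>u. A #> u) ` B)"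
    proof (rule inj_onI, clarify)
      fix u b u' b' assume *: "u \<in> U" "u' \<in> U" "b \<in> B" "b' \<in> B"
        "(A #> b) #> t (B #> u) = (A #> b') #> t (B #> u')"
      define M where "M = B #> u"
      define M' where "M' = B #> u'"
      have M: "M \<in> (\<lambda>u. B #> u) ` U" "M' \<in> (\<lambda>u. B #> u) ` U" using * by (auto simp: M_def M'_def)
      have tc: "t M \<in> carrier G" "t M' \<in> carrier G" using t M c by auto
      have "A #> (b \<otimes> t M) = A #> (b' \<otimes> t M')" using * M f by (simp add: M_def[symmetric] M'_def[symmetric])
      then have 1: "(b \<otimes> t M) \<otimes> inv (b' \<otimes> t M') \<in> A" using * tc c by (subst (asm) rcos_eq_iff[OF A]) auto
      then have "B #> (b \<otimes> t M) = B #> (b' \<otimes> t M')" using * tc c sub by (subst rcos_eq_iff[OF B]) auto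
      then have MM: "M = M'" using Bt M * by simp
      have "b \<otimes> inv b' \<in> A" using 1 tc * c by (simp add: MM inv_mult_group m_assoc)
      then have "A #> b = A #> b'" using * c by (subst rcos_eq_iff[OF A]) auto
      then show "B #> u = B #> u' \<and> A #> b = A #> b'" using MM by (simp add: M_def M'_def)
    qed
    show "?f ` ((\<lambda>u. B #> u) ` U \<times> (\<lambda>u. A #> u) ` B) = (\<lambda>u. A #> u) ` U"
    proof (intro equalityI subsetI)
      fix x assume "x \<in> ?f ` ((\<lambda>u. B #> u) ` U \<times> (\<lambda>u. A #> u) ` B)"
      then obtain M b where *: "M \<in> (\<lambda>u. B #> u) ` U" "b \<in> B" "x = (A #> b) #> t M" by auto
      then have "x = A #> (b \<otimes> t M)" "b \<otimes> t M \<in> U" using f t c U by (auto simp: subgroup.m_closed)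
      then show "x \<in> (\<lambda>u. A #> u) ` U" by blast
    next
      fix x assume "x \<in> (\<lambda>u. A #> u) ` U"
      then obtain u where u: "u \<in> U" "x = A #> u" by blast
      define M where "M = B #> u"
      have M: "M \<in> (\<lambda>u. B #> u) ` U" using u by (auto simp: M_def)
      have tM: "t M \<in> carrier G" "B #> u = B #> t M" using t[OF M] c by (auto simp: M_def)
      then have b: "u \<otimes> inv (t M) \<in> B" using u c by (subst (asm) rcos_eq_iff[OF B]) auto
      have "x = (A #> (u \<otimes> inv (t M))) #> t M" using f[OF M b] u c tM by (simp add: m_assoc)
      then show "x \<in> ?f ` ((\<lambda>u. B #> u) ` U \<times> (\<lambda>u. A #> u) ` B)" using M b by force
    qed
  qed
  from bij_betw_same_card[OF this] show ?thesis
    by (simp add: index_def card_cartesian_product)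
qed

definition cyc :: "'a \<Rightarrow> 'a set" where
  "cyc v = range (\<lambda>k::int. v [^] k)"

lemma cyc_subgroup: "v \<in> carrier G \<Longrightarrow> subgroup (cyc v) G"
  using generate_is_subgroup[of "{v}"] generate_pow[of v] by (simp add: cyc_def full_SetCompr_eq)

lemma cyc_carrier: "v \<in> carrier G \<Longrightarrow> x \<in> cyc v \<Longrightarrow> x \<in> carrier G"
  by (auto simp: cyc_def)

lemma cyc_self: "v \<in> carrier G \<Longrightarrow> v \<in> cyc v"
  unfolding cyc_def by (rule range_eqI[of _ _ 1]) simp

lemma cyc_com: "v \<in> carrier G \<Longrightarrow> x \<in> carrier G \<Longrightarrow> com G x v \<Longrightarrow> c \<in> cyc v \<Longrightarrow> com G x c"
  by (auto simp: cyc_def intro: com_int_pow)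

lemma com_product_subgroup:
  assumes A: "subgroup A G" and B: "subgroup B G" and "\<And>a b. a \<in> A \<Longrightarrow> b \<in> B \<Longrightarrow> com G a b"
  shows "subgroup {a \<otimes> b | a b. a \<in> A \<and> b \<in> B} G"
proof (rule subgroupI)
  have c: "x \<in> A \<Longrightarrow> x \<in> carrier G" "x \<in> B \<Longrightarrow> x \<in> carrier G" for x
    using subgroup.mem_carrier[OF A] subgroup.mem_carrier[OF B] by auto
  show "{a \<otimes> b | a b. a \<in> A \<and> b \<in> B} \<subseteq> carrier G" using c by auto
  show "{a \<otimes> b | a b. a \<in> A \<and> b \<in> B} \<noteq> {}" using subgroup.one_closed[OF A] subgroup.one_closed[OF B] by blast
  fix x assume "x \<in> {a \<otimes> b | a b. a \<in> A \<and> b \<in> B}"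
  then obtain a b where ab: "x = a \<otimes> b" "a \<in> A" "b \<in> B" by blast
  have i: "inv a \<in> A" "inv b \<in> B" using ab A B by (simp_all add: subgroup.m_inv_closed)
  have "inv x = inv a \<otimes> inv b" using ab c assms(3)[OF i] by (simp add: inv_mult_group com_def)
  then show "inv x \<in> {a \<otimes> b | a b. a \<in> A \<and> b \<in> B}" using i by blast
  fix y assume "y \<in> {a \<otimes> b | a b. a \<in> A \<and> b \<in> B}"
  then obtain d e where de: "y = d \<otimes> e" "d \<in> A" "e \<in> B" by blast
  have "x \<otimes> y = a \<otimes> (b \<otimes> d) \<otimes> e" using ab de c by (simp add: m_assoc)
  also have "b \<otimes> d = d \<otimes> b" using assms(3)[OF de(2) ab(3)] by (simp add: com_def)
  also have "a \<otimes> (d \<otimes> b) \<otimes> e = (a \<otimes> d) \<otimes> (b \<otimes> e)" using ab de c by (simp add: m_assoc)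
  finally have "x \<otimes> y = (a \<otimes> d) \<otimes> (b \<otimes> e)" .
  moreover have "a \<otimes> d \<in> A" "b \<otimes> e \<in> B" using ab de A B by (simp_all add: subgroup.m_closed)
  ultimately show "x \<otimes> y \<in> {a \<otimes> b | a b. a \<in> A \<and> b \<in> B}" by blast
qed

end

section \<open>Vertices and edges of the Bass--Serre tree\<close>

text \<open>The vertices of the Bass--Serre tree are the conjugates of the \<open>P i\<close>; the stabilizer of a vertex is its
  centralizer, and two distinct vertices are adjacent iff they commute.\<close>

locale finite_index_tree_raag = tree_raag G P for G (structure) and P +
  fixes H and m :: "nat \<Rightarrow> nat"
  assumes H: "subgroup H G" "finite (rcosets H)"
    and rank: "\<lbrakk>i \<le> 2; g \<in> carrier G; subgroup D G; D \<subseteq> Cent (cj G g (P i)); cj G g (P i) \<in> D;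
      finite ((\<lambda>x. D #> x) ` Cent (cj G g (P i)))\<rbrakk> \<Longrightarrow>
      card (Z2hom G D {cj G g (P i)}) = 2 ^ (m i * card ((\<lambda>x. D #> x) ` Cent (cj G g (P i))) + 1)"
begin

definition vertices where "vertices = {cj G g (P i) | g i. g \<in> carrier G \<and> i \<le> 2}"

definition vtype where "vtype v = (THE i. i \<le> 2 \<and> (\<exists>g\<in>carrier G. v = cj G g (P i)))"

lemma H_carrier: "h \<in> H \<Longrightarrow> h \<in> carrier G"
  by (rule subgroup.mem_carrier[OF H(1)])

lemma verticesI: "g \<in> carrier G \<Longrightarrow> i \<le> 2 \<Longrightarrow> cj G g (P i) \<in> vertices"
  unfolding vertices_def by blast

lemma verticesE: assumes "v \<in> vertices" obtains g i where "g \<in> carrier G" "i \<le> 2" "v = cj G g (P i)"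
  using assms unfolding vertices_def by blast

lemma vertices_carrier [simp]: "v \<in> vertices \<Longrightarrow> v \<in> carrier G"
  unfolding vertices_def using P_carrier by auto

lemma conj_P_eq:
  assumes "i \<le> 2" "j \<le> 2" "g \<in> carrier G" "h \<in> carrier G" "(k::int) \<noteq> 0"
    "cj G g (P i) [^] k = cj G h (P j) [^] (l::int)"
  shows "i = j \<and> k = l \<and> cj G g (P i) = cj G h (P j)"
proof -
  have c: "P i \<in> carrier G" "P j \<in> carrier G" using P_carrier assms by auto
  have "cj G g (P i [^] k) = cj G h (P j [^] l)" using assms c by (simp add: cj_int_pow)
  then have "cj G (inv h) (cj G g (P i [^] k)) = P j [^] l" using assms c by simp
  then have e: "cj G (inv h \<otimes> g) (P i [^] k) = P j [^] l" using assms c by (simp add: cj_cj)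
  then have ij: "i = j" "k = l" using pow_conj[of i j "inv h \<otimes> g" k l] assms by auto
  then have "com G (inv h \<otimes> g) (P i [^] k)" using e assms c by (simp add: cj_eq_self)
  then have "com G (inv h \<otimes> g) (P i)" using pow_centralizer[of i "inv h \<otimes> g" k] assms by simp
  then have "cj G (inv h \<otimes> g) (P i) = P i" using assms c by (simp add: cj_eq_self)
  then have "cj G h (cj G (inv h \<otimes> g) (P i)) = cj G h (P i)" by simp
  then show ?thesis using ij assms c by (simp add: cj_cj[symmetric])
qed

lemma vtype_cj: "g \<in> carrier G \<Longrightarrow> i \<le> 2 \<Longrightarrow> vtype (cj G g (P i)) = i"
  unfolding vtype_def
proof (rule the_equality)
  fix j assume g: "g \<in> carrier G" "i \<le> 2" and "j \<le> 2 \<and> (\<exists>h\<in>carrier G. cj G g (P i) = cj G h (P j))"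
  then obtain h where "j \<le> 2" "h \<in> carrier G" "cj G g (P i) [^] (1::int) = cj G h (P j) [^] (1::int)" by auto
  then show "j = i" using conj_P_eq[of i j g h 1 1] g by simp
qed blast

lemma vertices_vtype: assumes "v \<in> vertices" shows "vtype v \<le> 2" "\<exists>g\<in>carrier G. v = cj G g (P (vtype v))"
proof -
  obtain g i where g: "g \<in> carrier G" "i \<le> 2" "v = cj G g (P i)" using assms by (rule verticesE)
  then show "vtype v \<le> 2" "\<exists>g\<in>carrier G. v = cj G g (P (vtype v))" by (auto simp: vtype_cj)
qed

lemma vertices_pow_eq:
  assumes "v \<in> vertices" "w \<in> vertices" "(k::int) \<noteq> 0" "v [^] k = w [^] (l::int)"
  shows "v = w" "k = l"
proof -
  obtain g i where g: "g \<in> carrier G" "i \<le> 2" "v = cj G g (P i)" using assms(1) by (rule verticesE)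
  obtain h j where h: "h \<in> carrier G" "j \<le> 2" "w = cj G h (P j)" using assms(2) by (rule verticesE)
  show "v = w" "k = l" using conj_P_eq[of i j g h k l] assms g h by auto
qed

lemma vertices_pow_one: "v \<in> vertices \<Longrightarrow> v [^] (k::int) = \<one> \<Longrightarrow> k = 0"
  using vertices_pow_eq(2)[of v v k 0] by (cases "k = 0") auto

lemma vertices_pow_com:
  assumes "v \<in> vertices" "x \<in> carrier G" "(k::int) \<noteq> 0" shows "com G x (v [^] k) \<longleftrightarrow> com G x v"
proof
  obtain g i where g: "g \<in> carrier G" "i \<le> 2" "v = cj G g (P i)" using assms(1) by (rule verticesE)
  have c: "P i \<in> carrier G" using P_carrier g by simp
  assume "com G x (v [^] k)"
  then have "com G x (cj G g (P i [^] k))" using g c by (simp add: cj_int_pow)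
  then have "com G (cj G (inv g) x) (P i [^] k)"
    using com_cj[of "inv g" x "cj G g (P i [^] k)"] assms g c by simp
  then have "com G (cj G (inv g) x) (P i)" using pow_centralizer[of i "cj G (inv g) x" k] g assms by simp
  then show "com G x v" using com_cj[of "inv g" x v] assms g c by simp
qed (use assms com_int_pow in auto)

lemma cj_vertices: "v \<in> vertices \<Longrightarrow> g \<in> carrier G \<Longrightarrow> cj G g v \<in> vertices" "v \<in> vertices \<Longrightarrow> g \<in> carrier G \<Longrightarrow> vtype (cj G g v) = vtype v"
proof -
  assume g: "g \<in> carrier G" and "v \<in> vertices"
  then obtain h i where h: "h \<in> carrier G" "i \<le> 2" "v = cj G h (P i)" by (metis verticesE)
  then have e: "cj G g v = cj G (g \<otimes> h) (P i)" using g P_carrier by (simp add: cj_cj)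
  show "cj G g v \<in> vertices" unfolding e using g h by (intro verticesI) auto
  have "vtype (cj G g v) = i" unfolding e using g h by (intro vtype_cj) auto
  then show "vtype (cj G g v) = vtype v" using h by (simp add: vtype_cj)
qed

section \<open>Powers of vertices as seen from inside H\<close>

lemma pow_in_H:
  assumes "x \<in> carrier G" shows "\<exists>k>0. x [^] (k::nat) \<in> H"
proof -
  have "range (\<lambda>n::nat. H #> (x [^] n)) \<subseteq> rcosets H"
    using assms subgroup.subset[OF H(1)] by (auto intro!: rcosetsI)
  then have "finite (range (\<lambda>n::nat. H #> (x [^] n)))" using H finite_subset by blast
  then have ninj: "\<not> inj (\<lambda>n::nat. H #> (x [^] n))" using finite_imageD infinite_UNIV_nat by blast
  obtain i j where ij: "i < j" "H #> (x [^] (i::nat)) = H #> (x [^] j)" 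
  proof -
    from ninj obtain a b where "a \<noteq> b" "H #> (x [^] (a::nat)) = H #> (x [^] b)" unfolding inj_def by blast
    then show ?thesis using that[of a b] that[of b a] by (cases "a < b") auto
  qed
  then have "x [^] j \<otimes> inv (x [^] i) \<in> H" using assms H by (metis rcos_eq_iff nat_pow_closed)
  moreover have "x [^] j = x [^] (j - i) \<otimes> x [^] i" using ij assms by (simp add: nat_pow_mult)
  ultimately have "x [^] (j - i) \<in> H" using assms by (simp add: m_assoc)
  then show ?thesis using ij by (intro exI[of _ "j - i"]) auto
qed

text \<open>Formulated inside \<open>H\<close> alone, so that isomorphisms of \<open>H\<close>
  preserve it. It singles out the nontrivial powers of vertices that lie in
  \<open>H\<close>.\<close>

definition special where
  "special x \<longleftrightarrow> x \<in> H \<and> x \<noteq> \<one> \<and> (\<exists>a\<in>H. \<exists>b\<in>H. com G a x \<and> com G b x \<and> \<not> com G a b)"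

lemma special_vertex: "special x \<Longrightarrow> \<exists>v\<in>vertices. \<exists>k::int. k \<noteq> 0 \<and> x = v [^] k"
proof -
  assume "special x"
  then obtain a b where "x \<in> H" "x \<noteq> \<one>" "a \<in> H" "b \<in> H" "com G a x" "com G b x" "\<not> com G a b"
    unfolding special_def by blast
  then obtain h i k where "h \<in> carrier G" "i \<le> 2" "(k::int) \<noteq> 0" "x = cj G h (P i [^] k)"
    using nonabelian_centralizer[of x a b] H_carrier by blast
  then have "x = cj G h (P i) [^] k" "cj G h (P i) \<in> vertices" using P_carrier verticesI by (auto simp: cj_int_pow)
  then show ?thesis using \<open>k \<noteq> 0\<close> by blast
qed

text \<open>The noncommuting pair in the centralizer of \<open>v\<close> need not lie in
  \<open>H\<close>. Raising both to the common power \<open>r * s\<close> brings them into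
  \<open>H\<close>, and \<open>noncommuting_powers\<close> keeps them from commuting.\<close>

lemma vertex_special:
  assumes v: "v \<in> vertices" and "v [^] (k::int) \<in> H" "k \<noteq> 0"
  shows "special (v [^] k)"
proof -
  obtain g i where g: "g \<in> carrier G" "i \<le> 2" "v = cj G g (P i)" using v by (rule verticesE)
  obtain x y where xy: "x \<in> carrier G" "y \<in> carrier G" "com G x (P i)" "com G y (P i)"
    "\<forall>k>0. \<not> com G (x [^] (k::nat)) (y [^] k)" using noncommuting_powers[OF g(2)] by blast
  define a where "a = cj G g x"
  define b where "b = cj G g y"
  have ab: "a \<in> carrier G" "b \<in> carrier G" "com G a v" "com G b v"
    using xy g P_carrier by (auto simp: a_def b_def com_cj)
  obtain r s where r: "0 < r" "a [^] (r::nat) \<in> H" and s: "0 < s" "b [^] (s::nat) \<in> H" using pow_in_H ab by metis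
  have pw: "c [^] (n::nat) \<in> H" if "c \<in> H" for c n
    using that H(1) by (simp add: subgroup_int_pow_closed flip: int_pow_int)
  have "a [^] (r * s) \<in> H" using pw[OF r(2), of s] ab by (simp add: nat_pow_pow)
  moreover have "b [^] (r * s) \<in> H" using pw[OF s(2), of r] ab by (simp add: nat_pow_pow mult.commute)
  moreover have "\<not> com G (a [^] (r * s)) (b [^] (r * s))"
    using xy g r s com_cj[of g "x [^] (r * s)" "y [^] (r * s)"] by (simp add: a_def b_def cj_nat_pow[symmetric])
  moreover have "com G (c [^] (r * s)) (v [^] k)" if "c \<in> carrier G" "com G c v" for c
  proof -
    have "com G v (c [^] (r * s))" using that v com_nat_pow[of v c] com_sym by auto
    then show ?thesis using com_int_pow[of "c [^] (r * s)" v k] that v com_sym by auto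
  qed
  moreover have "v [^] k \<noteq> \<one>" using vertices_pow_one v assms by blast
  ultimately show ?thesis unfolding special_def using ab assms by blast
qed

text \<open>The index of \<open>H \<inter> cyc v\<close> in \<open>cyc v\<close>, denoted z(v) in
  the outline of the argument.\<close>

definition centre_index where "centre_index v = card ((\<lambda>x. H #> x) ` cyc v)"

lemma finite_cosets: "U \<subseteq> carrier G \<Longrightarrow> finite ((\<lambda>x. H #> x) ` U)"
  using subgroup.subset[OF H(1)] by (intro finite_subset[OF _ H(2)]) (auto intro!: rcosetsI)

lemma centre_index_pos: "v \<in> vertices \<Longrightarrow> 0 < centre_index v"
  unfolding centre_index_def using finite_cosets[of "cyc v"] cyc_carrier[of v] by (auto simp: card_gt_0_iff cyc_def)

lemma H_cyc_nontrivial: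
  assumes "v \<in> vertices" obtains k :: int where "0 < k" "v [^] k \<in> H" "v [^] k \<noteq> \<one>"
proof -
  obtain k where "0 < k" "v [^] (k::nat) \<in> H" using pow_in_H assms by (meson vertices_carrier)
  then have "0 < int k" "v [^] int k \<in> H" by (simp_all add: int_pow_int)
  then show thesis using that[of "int k"] vertices_pow_one[OF assms, of "int k"] by auto
qed

lemma H_cyc_inj: "v \<in> vertices \<Longrightarrow> w \<in> vertices \<Longrightarrow> H \<inter> cyc v = H \<inter> cyc w \<Longrightarrow> v = w"
proof -
  assume v: "v \<in> vertices" "w \<in> vertices" "H \<inter> cyc v = H \<inter> cyc w"
  obtain k :: int where k: "0 < k" "v [^] k \<in> H" using H_cyc_nontrivial[OF v(1)] by blast
  then have "v [^] k \<in> cyc w" using v(3) unfolding cyc_def by blast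
  then obtain l :: int where "v [^] k = w [^] l" by (auto simp: cyc_def)
  then show "v = w" using vertices_pow_eq(1)[of v w k l] v k by simp
qed

lemma same_vertex:
  assumes "v \<in> vertices" "w \<in> vertices" "(k::int) \<noteq> 0" "(l::int) \<noteq> 0" "(a::int) \<noteq> 0"
    "(v [^] k) [^] a = (w [^] l) [^] (b::int)"
  shows "v = w"
proof -
  have "v [^] (k * a) = w [^] (l * b)" using assms by (simp add: int_pow_pow)
  then show ?thesis using vertices_pow_eq(1)[of v w "k * a" "l * b"] assms by simp
qed

section \<open>Pairs of vertices, their stabilizers, and sums over orbits\<close>

abbreviation cj2 where "cj2 g e \<equiv> (cj G g (fst e), cj G g (snd e))"

text \<open>The index of the stabilizer in \<open>H\<close> of a pair in its full stabilizer. A pair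
  is an edge, or a vertex \<open>v\<close> in the form \<open>(v, v)\<close>, so one orbit sum
  covers both.\<close>

definition beta where "beta e = card ((\<lambda>u. H #> u) ` (Cent (fst e) \<inter> Cent (snd e)))"

definition rep where "rep x = (SOME g. g \<in> x)"

definition orb where "orb e = {cj2 h e | h. h \<in> H}"

lemma rep: "x \<in> rcosets H \<Longrightarrow> rep x \<in> carrier G \<and> x = H #> rep x"
proof -
  assume "x \<in> rcosets H"
  then obtain g where g: "g \<in> carrier G" "x = H #> g" unfolding RCOSETS_def by blast
  then have "g \<in> x" using rcos_self H by blast
  then have r: "rep x \<in> x" unfolding rep_def by (rule someI)
  then have "rep x \<in> carrier G" using g r_coset_subset_G[OF subgroup.subset[OF H(1)], of g] by blast
  then show ?thesis using repr_independence[OF _ g(1) H(1), of "rep x"] r g(2) by simp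
qed

text \<open>The sum over all translates of the objects \<open>ob i\<close> by representatives of the cosets of \<open>H\<close>,
  arranged by \<open>H\<close>-orbits: the orbit of \<open>e\<close> is hit \<open>beta e\<close> times.\<close>

lemma orbit_sum:
  fixes f :: "'a \<times> 'a \<Rightarrow> real"
  assumes I: "finite I" and ob: "\<And>i. i \<in> I \<Longrightarrow> ob i \<in> carrier G \<times> carrier G"
    and dist: "\<And>i j g h. \<lbrakk>i \<in> I; j \<in> I; g \<in> carrier G; h \<in> carrier G; cj2 g (ob i) = cj2 h (ob j)\<rbrakk> \<Longrightarrow> i = j"
    and Ob: "Ob = {cj2 g (ob i) | g i. g \<in> carrier G \<and> i \<in> I}"
    and inv: "\<And>h e. h \<in> H \<Longrightarrow> e \<in> Ob \<Longrightarrow> f (cj2 h e) = f e"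
  shows "\<exists>W. (\<Sum>i\<in>I. \<Sum>x\<in>rcosets H. f (cj2 (rep x) (ob i))) = sum W (orb ` Ob) \<and> (\<forall>e\<in>Ob. W (orb e) = real (beta e) * f e)"
proof -
  have Obc: "e \<in> Ob \<Longrightarrow> fst e \<in> carrier G \<and> snd e \<in> carrier G" for e using ob by (auto simp: Ob mem_Times_iff)
  have obc: "i \<in> I \<Longrightarrow> fst (ob i) \<in> carrier G \<and> snd (ob i) \<in> carrier G" for i using ob by (auto simp: mem_Times_iff)
  have cj2m: "cj2 g (cj2 h e) = cj2 (g \<otimes> h) e"
    if "g \<in> carrier G" "h \<in> carrier G" "fst e \<in> carrier G \<and> snd e \<in> carrier G" for g h e
    using that by (simp add: cj_cj)
  have orb_self: "e \<in> orb e" if "e \<in> Ob" for e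
    using Obc[OF that] subgroup.one_closed[OF H(1)] unfolding orb_def
    by (intro CollectI exI[of _ \<one>]) (simp add: prod_eq_iff)
  \<comment> \<open>\<open>f\<close> is constant on orbits of \<open>H\<close>, so \<open>F\<close>
    is \<open>f\<close> viewed as a function of the orbit.\<close>
  define F where "F \<omega> = f (SOME e. e \<in> \<omega>)" for \<omega>
  have F: "F (orb e) = f e" if "e \<in> Ob" for e
  proof -
    have "(SOME d. d \<in> orb e) \<in> orb e" using orb_self[OF that] by (rule someI)
    then obtain h where "h \<in> H" "(SOME d. d \<in> orb e) = cj2 h e" unfolding orb_def by blast
    then show ?thesis using inv[OF _ that] by (simp add: F_def)
  qed
  define q where "q p = orb (cj2 (rep (snd p)) (ob (fst p)))" for p
  have mem: "cj2 (rep x) (ob i) \<in> Ob" if "i \<in> I" "x \<in> rcosets H" for i x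
    using that rep unfolding Ob by blast
  have card: "card {p \<in> I \<times> rcosets H. q p = orb e} = beta e" if e: "e \<in> Ob" for e
  proof -
    obtain g0 i0 where g0: "g0 \<in> carrier G" "i0 \<in> I" "e = cj2 g0 (ob i0)" using e unfolding Ob by blast
    have ec: "fst e \<in> carrier G \<and> snd e \<in> carrier G" using Obc e by blast
    define St where "St = Cent (fst e) \<inter> Cent (snd e)"
    have St: "u \<in> St \<longleftrightarrow> u \<in> carrier G \<and> cj2 u e = e" for u
      using ec by (auto simp: St_def Cent_def cj_eq_self prod_eq_iff)
    \<comment> \<open>The type is determined by the orbit, and the cosets that land in the orbit of
      \<open>e\<close> are those of the elements \<open>u \<otimes> g0\<close> with \<open>u\<close>
      in the stabilizer of \<open>e\<close>. Their number is \<open>beta e\<close>.\<close>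
    have "{p \<in> I \<times> rcosets H. q p = orb e} = {i0} \<times> (\<lambda>u. H #> (u \<otimes> g0)) ` St"
    proof (intro equalityI subsetI)
      fix p assume "p \<in> {p \<in> I \<times> rcosets H. q p = orb e}"
      then obtain i x where p: "p = (i, x)" "i \<in> I" "x \<in> rcosets H" "orb (cj2 (rep x) (ob i)) = orb e"
        by (auto simp: q_def)
      have rx: "rep x \<in> carrier G" "x = H #> rep x" using rep[OF p(3)] by auto
      obtain h where h: "h \<in> H" "cj2 (rep x) (ob i) = cj2 h e"
        using orb_self[OF mem[OF p(2,3)]] p(4) unfolding orb_def by blast
      have hc: "h \<in> carrier G" using h H_carrier by simp
      have "cj2 (rep x) (ob i) = cj2 (h \<otimes> g0) (ob i0)" using h(2) g0 cj2m[OF hc g0(1) obc[OF g0(2)]] by simp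
      then have i: "i = i0" using dist[OF p(2) g0(2) rx(1)] hc g0 by blast
      define u where "u = inv h \<otimes> rep x \<otimes> inv g0"
      have uc: "u \<in> carrier G" using hc rx g0 by (simp add: u_def)
      have ug: "u \<otimes> g0 = inv h \<otimes> rep x" using hc rx g0 by (simp add: u_def m_assoc)
      have "cj2 u e = cj2 (u \<otimes> g0) (ob i0)" using cj2m[OF uc g0(1) obc[OF g0(2)]] g0(3) by simp
      also have "\<dots> = cj2 (inv h) (cj2 (rep x) (ob i0))" using ug cj2m[of "inv h" "rep x" "ob i0"] hc rx obc[OF g0(2)] by simp
      also have "\<dots> = e" using h(2) i hc ec by (simp add: prod_eq_iff)
      finally have "u \<in> St" using St uc by blast
      moreover have "x = H #> (u \<otimes> g0)"
      proof -
        have "rep x \<otimes> inv (u \<otimes> g0) = h" unfolding ug using hc rx by (simp add: inv_mult_group)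
        then have "H #> rep x = H #> (u \<otimes> g0)" using h rx uc g0 by (subst rcos_eq_iff[OF H(1)]) auto
        then show ?thesis using rx by simp
      qed
      ultimately show "p \<in> {i0} \<times> (\<lambda>u. H #> (u \<otimes> g0)) ` St" using p(1) i by blast
    next
      fix p assume "p \<in> {i0} \<times> (\<lambda>u. H #> (u \<otimes> g0)) ` St"
      then obtain u where u: "u \<in> St" "p = (i0, H #> (u \<otimes> g0))" by blast
      define x where "x = H #> (u \<otimes> g0)"
      have uc: "u \<in> carrier G" "cj2 u e = e" using u St by auto
      have xR: "x \<in> rcosets H" unfolding x_def using uc g0 subgroup.subset[OF H(1)] by (intro rcosetsI) auto
      have rx: "rep x \<in> carrier G" "H #> (u \<otimes> g0) = H #> rep x" using rep[OF xR] by (auto simp: x_def)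
      define h where "h = u \<otimes> g0 \<otimes> inv (rep x)"
      have hH: "h \<in> H" unfolding h_def using rx uc g0 by (subst (asm) rcos_eq_iff[OF H(1)]) auto
      have hc: "h \<in> carrier G" using hH H_carrier by simp
      have hr: "rep x = inv h \<otimes> (u \<otimes> g0)" using rx uc g0 by (simp add: h_def inv_mult_group m_assoc)
      have ug: "cj2 (u \<otimes> g0) (ob i0) = e" using cj2m[OF uc(1) g0(1) obc[OF g0(2)]] g0(3) uc(2) by simp
      have "cj2 (rep x) (ob i0) = cj2 (inv h) e"
        unfolding hr using cj2m[of "inv h" "u \<otimes> g0" "ob i0"] ug hc uc g0 obc[OF g0(2)] by simp
      moreover have "orb (cj2 (inv h) e) = orb e"
      proof (intro equalityI subsetI)
        fix d assume "d \<in> orb (cj2 (inv h) e)"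
        then obtain k where "k \<in> H" "d = cj2 k (cj2 (inv h) e)" unfolding orb_def by blast
        then have "d = cj2 (k \<otimes> inv h) e" "k \<otimes> inv h \<in> H"
          using cj2m[of k "inv h" e] hc ec H_carrier hH H(1) by (auto simp: subgroup.m_closed subgroup.m_inv_closed)
        then show "d \<in> orb e" unfolding orb_def by blast
      next
        fix d assume "d \<in> orb e"
        then obtain k where k: "k \<in> H" "d = cj2 k e" unfolding orb_def by blast
        then have "cj2 (k \<otimes> h) (cj2 (inv h) e) = cj2 k e"
          using cj2m[of "k \<otimes> h" "inv h" e] hc ec H_carrier by (simp add: m_assoc)
        moreover have "k \<otimes> h \<in> H" using k hH H(1) by (simp add: subgroup.m_closed)
        ultimately show "d \<in> orb (cj2 (inv h) e)" unfolding orb_def using k by (metis (mono_tags, lifting) mem_Collect_eq)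
      qed
      ultimately show "p \<in> {p \<in> I \<times> rcosets H. q p = orb e}" using u(2) g0(2) xR by (simp add: q_def x_def)
    qed
    then have "card {p \<in> I \<times> rcosets H. q p = orb e} = card ((\<lambda>u. H #> (u \<otimes> g0)) ` St)"
      by (simp add: card_cartesian_product)
    also have "\<dots> = card ((\<lambda>u. H #> u) ` St)"
    proof (rule card_image_same_kernel(1))
      fix u v assume "u \<in> St" "v \<in> St"
      then have "u \<in> carrier G" "v \<in> carrier G" using St by auto
      then show "(H #> (u \<otimes> g0) = H #> (v \<otimes> g0)) = (H #> u = H #> v)"
        using g0(1) H(1) by (simp add: rcos_eq_iff inv_mult_group m_assoc)
    qed
    finally show ?thesis by (simp add: beta_def St_def)
  qed
  have "(\<Sum>i\<in>I. \<Sum>x\<in>rcosets H. f (cj2 (rep x) (ob i))) = (\<Sum>p\<in>I \<times> rcosets H. F (q p))"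
    unfolding sum.cartesian_product
  proof (rule sum.cong[OF refl])
    fix p assume "p \<in> I \<times> rcosets H"
    then show "(case p of (i, x) \<Rightarrow> f (cj2 (rep x) (ob i))) = F (q p)"
      using F[OF mem, of "fst p" "snd p"] by (auto simp: q_def)
  qed
  also have "\<dots> = (\<Sum>\<omega>\<in>q ` (I \<times> rcosets H). real (card {p \<in> I \<times> rcosets H. q p = \<omega>}) * F \<omega>)"
    using I H(2) by (intro sum_fun_comp) auto
  also have "q ` (I \<times> rcosets H) = orb ` Ob"
  proof
    show "q ` (I \<times> rcosets H) \<subseteq> orb ` Ob" using mem by (auto simp: q_def)
    show "orb ` Ob \<subseteq> q ` (I \<times> rcosets H)"
    proof
      fix \<omega> assume "\<omega> \<in> orb ` Ob"
      then obtain e where e: "e \<in> Ob" "\<omega> = orb e" by blast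
      have "\<one> \<in> Cent (fst e) \<inter> Cent (snd e)" using Obc[OF e(1)] by (simp add: Cent_def)
      moreover have "finite ((\<lambda>u. H #> u) ` (Cent (fst e) \<inter> Cent (snd e)))" by (rule finite_cosets) (auto simp: Cent_def)
      ultimately have "0 < beta e" unfolding beta_def card_gt_0_iff by blast
      then have "{p \<in> I \<times> rcosets H. q p = orb e} \<noteq> {}" using card[OF e(1)] by (metis card.empty less_irrefl)
      then show "\<omega> \<in> q ` (I \<times> rcosets H)" using e(2) by blast
    qed
  qed
  finally show ?thesis using card F
    by (intro exI[of _ "\<lambda>\<omega>. real (card {p \<in> I \<times> rcosets H. q p = \<omega>}) * F \<omega>"]) auto
qed

end

section \<open>Adjacency, connectedness, and the stabilizers of vertices and edges\<close>

context finite_index_tree_raag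
begin

definition adj where "adj v w \<longleftrightarrow> v \<in> vertices \<and> w \<in> vertices \<and> v \<noteq> w \<and> com G v w"

lemma adjE:
  assumes "adj v w"
  shows "(vtype v = 0) \<noteq> (vtype w = 0)" "\<exists>u\<in>carrier G. v = cj G u (P (vtype v)) \<and> w = cj G u (P (vtype w))"
proof -
  have a: "v \<in> vertices" "w \<in> vertices" "v \<noteq> w" "com G v w" using assms by (simp_all add: adj_def)
  obtain g where g: "g \<in> carrier G" "v = cj G g (P (vtype v))" using vertices_vtype(2)[OF a(1)] by blast
  obtain h where h: "h \<in> carrier G" "w = cj G h (P (vtype w))" using vertices_vtype(2)[OF a(2)] by blast
  have "com G (cj G g (P (vtype v))) (cj G h (P (vtype w)))" "cj G g (P (vtype v)) \<noteq> cj G h (P (vtype w))"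
    using a g h by auto
  from adjacent[OF vertices_vtype(1)[OF a(1)] vertices_vtype(1)[OF a(2)] g(1) h(1) this]
  obtain u where u: "(vtype v = 0) \<noteq> (vtype w = 0)" "u \<in> carrier G" "cj G u (P (vtype v)) = cj G g (P (vtype v))"
    "cj G u (P (vtype w)) = cj G h (P (vtype w))" by blast
  show "(vtype v = 0) \<noteq> (vtype w = 0)" by fact
  show "\<exists>u\<in>carrier G. v = cj G u (P (vtype v)) \<and> w = cj G u (P (vtype w))"
    using u(2) trans[OF g(2) u(3)[symmetric]] trans[OF h(2) u(4)[symmetric]] by blast
qed

lemma com_pow_iff:
  assumes "v \<in> vertices" "w \<in> vertices" "(k::int) \<noteq> 0" "(l::int) \<noteq> 0"
  shows "com G (v [^] k) (w [^] l) \<longleftrightarrow> com G v w"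
proof -
  have c: "v \<in> carrier G" "w \<in> carrier G" using assms by auto
  have "com G (v [^] k) (w [^] l) \<longleftrightarrow> com G (v [^] k) w" using vertices_pow_com[OF assms(2) _ assms(4)] c by simp
  also have "\<dots> \<longleftrightarrow> com G w (v [^] k)" by (rule com_sym)
  also have "\<dots> \<longleftrightarrow> com G w v" using vertices_pow_com[OF assms(1) _ assms(3)] c by simp
  finally show ?thesis by (simp add: com_sym)
qed

lemma P_ne: "0 < i \<Longrightarrow> i \<le> 2 \<Longrightarrow> P 0 \<noteq> P i"
proof
  assume i: "0 < i" "i \<le> 2" "P 0 = P i"
  then have "cj G \<one> (P 0 [^] (1::int)) = P i [^] (1::int)" using P_carrier[of i] by simp
  then show False using pow_conj[of 0 i \<one> 1 1] i by simp
qed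

lemma P_adj:
  assumes "0 < i" "i \<le> 2" "g \<in> carrier G" shows "adj (cj G g (P 0)) (cj G g (P i))"
  using assms P_carrier[of 0] P_carrier[of i] P_ne[of i] P_com[of i]
  by (simp add: adj_def verticesI cj_eq_iff com_cj)

text \<open>The Bass--Serre tree is connected.\<close>

lemma adj_invariant_const:
  assumes R: "\<And>v w. adj v w \<Longrightarrow> R v \<longleftrightarrow> R w" and "v \<in> vertices" "w \<in> vertices"
  shows "R v \<longleftrightarrow> R w"
proof -
  have c: "P i \<in> carrier G" if "i \<le> 2" for i using P_carrier that by simp
  have 0: "R (cj G g (P i)) = R (cj G g (P 0))" if "g \<in> carrier G" "i \<le> 2" for g i
    using R[OF P_adj[of i g]] that by (cases "i = 0") auto
  \<comment> \<open>If \<open>s\<close> centralizes \<open>P i\<close>, then the conjugates of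
    \<open>P 0\<close> by \<open>h\<close> and by \<open>h \<otimes> s\<close> are both equal or
    adjacent to the conjugate of \<open>P i\<close> by \<open>h\<close>. So the subgroup
    \<open>A\<close> contains the generators from \<open>generated\<close>.\<close>
  define A where "A = {g \<in> carrier G. \<forall>h\<in>carrier G. R (cj G (h \<otimes> g) (P 0)) = R (cj G h (P 0))}"
  have "subgroup A G"
  proof (rule subgroupI)
    have "\<one> \<in> A" by (simp add: A_def)
    then show "A \<noteq> {}" by blast
  next
    fix g assume g: "g \<in> A"
    then have gc: "g \<in> carrier G" by (simp add: A_def)
    show "inv g \<in> A" unfolding A_def
    proof (intro CollectI conjI ballI inv_closed gc)
      fix h assume h: "h \<in> carrier G"
      have "R (cj G (h \<otimes> inv g \<otimes> g) (P 0)) = R (cj G (h \<otimes> inv g) (P 0))"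
        using g gc h unfolding A_def by blast
      then show "R (cj G (h \<otimes> inv g) (P 0)) = R (cj G h (P 0))" using gc h by (simp add: m_assoc)
    qed
  next
    fix a b assume ab: "a \<in> A" "b \<in> A"
    then have abc: "a \<in> carrier G" "b \<in> carrier G" by (simp_all add: A_def)
    show "a \<otimes> b \<in> A" unfolding A_def
    proof (intro CollectI conjI ballI m_closed abc)
      fix h assume h: "h \<in> carrier G"
      then have "R (cj G (h \<otimes> a \<otimes> b) (P 0)) = R (cj G (h \<otimes> a) (P 0))" "R (cj G (h \<otimes> a) (P 0)) = R (cj G h (P 0))"
        using ab abc unfolding A_def by blast+
      then show "R (cj G (h \<otimes> (a \<otimes> b)) (P 0)) = R (cj G h (P 0))" using abc h by (simp add: m_assoc)
    qed
  qed (auto simp: A_def)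
  moreover have "{s \<in> carrier G. \<exists>i\<le>2. com G s (P i)} \<subseteq> A"
  proof
    fix s assume "s \<in> {s \<in> carrier G. \<exists>i\<le>2. com G s (P i)}"
    then obtain i where s: "s \<in> carrier G" "i \<le> 2" "com G s (P i)" by blast
    have "R (cj G (h \<otimes> s) (P 0)) = R (cj G h (P 0))" if h: "h \<in> carrier G" for h
    proof -
      have "cj G s (P i) = P i" using s c by (simp add: cj_eq_self)
      then have "cj G (h \<otimes> s) (P i) = cj G h (P i)" using s h c by (simp add: cj_cj[symmetric])
      then show ?thesis using 0[of "h \<otimes> s" i] 0[of h i] s h by simp
    qed
    then show "s \<in> A" using s by (simp add: A_def)
  qed
  ultimately have "generate G {s \<in> carrier G. \<exists>i\<le>2. com G s (P i)} \<subseteq> A" by (intro generate_subgroup_incl)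
  then have A: "carrier G \<subseteq> A" using generated by blast
  have "R u = R (P 0)" if uV: "u \<in> vertices" for u
  proof -
    obtain g i where g: "g \<in> carrier G" "i \<le> 2" "u = cj G g (P i)" using uV by (rule verticesE)
    have "R (cj G (\<one> \<otimes> g) (P 0)) = R (cj G \<one> (P 0))" using A g(1) one_closed unfolding A_def by blast
    then show ?thesis using 0[OF g(1,2)] g c by simp
  qed
  then show ?thesis using assms by simp
qed

text \<open>Take D = <v>(H \<inter> C(v)), which contains \<open>v\<close> as \<open>rank\<close>
  demands, and f = [C(v) : D]. Then [C(v) : H \<inter> C(v)] = f [D : H \<inter> C(v)], and the last
  index is z(v). Since D/<v> and (H \<inter> C(v))/(H \<inter> <v>) are isomorphic, restriction
  matches the two sets of homomorphisms; the second one involves \<open>H\<close> only.\<close>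

lemma beta_vertex:
  assumes v: "v \<in> vertices"
  shows "\<exists>f. beta (v, v) = f * centre_index v \<and> card (Z2hom G (H \<inter> Cent v) (H \<inter> cyc v)) = 2 ^ (m (vtype v) * f + 1)"
proof -
  have vc: "v \<in> carrier G" using v by simp
  obtain g where g: "g \<in> carrier G" "v = cj G g (P (vtype v))" "vtype v \<le> 2" using vertices_vtype[OF v] by blast
  have C: "subgroup (Cent v) G" by (rule Cent_subgroup[OF vc])
  have Z: "subgroup (cyc v) G" by (rule cyc_subgroup[OF vc])
  have HC: "subgroup (H \<inter> Cent v) G" by (rule subgroups_Inter_pair[OF H(1) C])
  define D where "D = {a \<otimes> b | a b. a \<in> cyc v \<and> b \<in> H \<inter> Cent v}"
  have comZ: "com G a b" if "a \<in> cyc v" "b \<in> Cent v" for a b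
    using cyc_com[OF vc _ _ that(1), of b] that(2) by (auto simp: Cent_def com_sym)
  have D: "subgroup D G" unfolding D_def by (rule com_product_subgroup[OF Z HC]) (use comZ in auto)
  have cC: "cyc v \<subseteq> Cent v" using vc com_int_pow[of v v] by (auto simp: Cent_def cyc_def com_sym)
  have DC: "D \<subseteq> Cent v" unfolding D_def using cC subgroup.m_closed[OF C] by auto
  have one: "\<one> \<in> H \<inter> Cent v" "\<one> \<in> cyc v" using subgroup.one_closed[OF HC] subgroup.one_closed[OF Z] by auto
  have HD: "H \<inter> Cent v \<subseteq> D" unfolding D_def using one(2) subgroup.mem_carrier[OF HC] by force
  have cD: "cyc v \<subseteq> D" unfolding D_def using one(1) cyc_carrier[OF vc] by force
  have vD: "v \<in> D" using cD cyc_self[OF vc] by blast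
  have finC: "finite ((\<lambda>x. H #> x) ` Cent v)" by (rule finite_cosets[OF subgroup.subset[OF C]])
  then have finHC: "finite ((\<lambda>x. (H \<inter> Cent v) #> x) ` Cent v)" using index_Int(2)[OF H(1) C] by simp
  have finD: "finite ((\<lambda>x. D #> x) ` Cent v)"
  proof -
    define k where "k M = D #> (SOME x. x \<in> Cent v \<and> (H \<inter> Cent v) #> x = M)" for M
    have "D #> x = k ((H \<inter> Cent v) #> x)" if x: "x \<in> Cent v" for x
    proof -
      have "\<exists>y. y \<in> Cent v \<and> (H \<inter> Cent v) #> y = (H \<inter> Cent v) #> x" using x by blast
      from someI_ex[OF this] obtain y where y: "y \<in> Cent v" "(H \<inter> Cent v) #> y = (H \<inter> Cent v) #> x"
        "k ((H \<inter> Cent v) #> x) = D #> y" unfolding k_def by blast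
      have "x \<in> carrier G" "y \<in> carrier G" using x y subgroup.mem_carrier[OF C] by auto
      then have "D #> y = D #> x" using y(2) HD rcos_eq_iff[OF HC, of y x] rcos_eq_iff[OF D, of y x] by auto
      then show ?thesis using y by simp
    qed
    then have "(\<lambda>x. D #> x) ` Cent v = k ` (\<lambda>x. (H \<inter> Cent v) #> x) ` Cent v" unfolding image_image by (rule image_cong[OF refl])
    then show ?thesis using finHC by simp
  qed
  have "beta (v, v) = index H (Cent v)" by (simp add: beta_def index_def)
  also have "\<dots> = index (H \<inter> Cent v) (Cent v)" by (rule index_Int(1)[OF H(1) C])
  also have "\<dots> = index D (Cent v) * index (H \<inter> Cent v) D" by (rule index_mult[OF HC D C HD DC])
  also have "index (H \<inter> Cent v) D = centre_index v"
  proof -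
    have "(H \<inter> Cent v) #> (a \<otimes> b) = (H \<inter> Cent v) #> a" if "a \<in> cyc v" "b \<in> H \<inter> Cent v" for a b
    proof -
      have ab: "a \<in> carrier G" "b \<in> carrier G" using that cyc_carrier[OF vc] subgroup.mem_carrier[OF HC] by auto
      have "a \<otimes> b = b \<otimes> a" using comZ[OF that(1)] that(2) by (simp add: com_def)
      then have "(a \<otimes> b) \<otimes> inv a = b" using ab by (simp add: m_assoc)
      then show ?thesis using ab that(2) by (subst rcos_eq_iff[OF HC]) auto
    qed
    then have "(\<lambda>x. (H \<inter> Cent v) #> x) ` D \<subseteq> (\<lambda>x. (H \<inter> Cent v) #> x) ` cyc v" unfolding D_def by blast
    then have "(\<lambda>x. (H \<inter> Cent v) #> x) ` D = (\<lambda>x. (H \<inter> Cent v) #> x) ` cyc v" using cD by blast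
    moreover have "card ((\<lambda>x. (H \<inter> Cent v) #> x) ` cyc v) = card ((\<lambda>x. H #> x) ` cyc v)"
    proof (rule card_image_same_kernel(1))
      fix a b assume ab: "a \<in> cyc v" "b \<in> cyc v"
      have "a \<otimes> inv b \<in> Cent v" using ab subgroup.m_closed[OF Z] subgroup.m_inv_closed[OF Z] cC by blast
      moreover have "a \<in> carrier G" "b \<in> carrier G" using ab cyc_carrier[OF vc] by auto
      ultimately show "((H \<inter> Cent v) #> a = (H \<inter> Cent v) #> b) = (H #> a = H #> b)"
        by (simp add: rcos_eq_iff[OF HC] rcos_eq_iff[OF H(1)])
    qed
    ultimately show ?thesis by (simp add: index_def centre_index_def)
  qed
  finally have b: "beta (v, v) = index D (Cent v) * centre_index v" .
  have "card (Z2hom G D {v}) = 2 ^ (m (vtype v) * index D (Cent v) + 1)"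
    unfolding index_def using rank[OF g(3,1) D] DC vD finD g(2) by simp
  moreover have "card (Z2hom G D {v}) = card (Z2hom G (H \<inter> Cent v) (H \<inter> cyc v))"
  proof -
    have Zv: "\<not> \<theta> a" if \<theta>: "\<theta> \<in> Z2hom G D {v}" and a: "a \<in> cyc v" for \<theta> a
    proof -
      have hom: "\<theta> (x \<otimes> y) = (\<theta> x \<noteq> \<theta> y)" if "x \<in> D" "y \<in> D" for x y using \<theta> that unfolding Z2hom_def by blast
      have tv: "\<not> \<theta> v" using \<theta> unfolding Z2hom_def by blast
      have t1: "\<not> \<theta> \<one>" using hom[of \<one> \<one>] subgroup.one_closed[OF D] by simp
      have "generate G {v} \<subseteq> {x \<in> D. \<not> \<theta> x}"
      proof (rule generate_subgroup_incl)
        show "subgroup {x \<in> D. \<not> \<theta> x} G"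
        proof (rule subgroupI)
          show "{x \<in> D. \<not> \<theta> x} \<noteq> {}" using t1 subgroup.one_closed[OF D] by blast
          show "{x \<in> D. \<not> \<theta> x} \<subseteq> carrier G" using subgroup.subset[OF D] by blast
          fix x y assume "x \<in> {x \<in> D. \<not> \<theta> x}" "y \<in> {x \<in> D. \<not> \<theta> x}"
          then show "x \<otimes> y \<in> {x \<in> D. \<not> \<theta> x}" using hom[of x y] subgroup.m_closed[OF D] by auto
        next
          fix x assume x: "x \<in> {x \<in> D. \<not> \<theta> x}"
          then have "x \<in> D" "inv x \<in> D" "x \<in> carrier G" using subgroup.m_inv_closed[OF D] subgroup.mem_carrier[OF D] by auto
          then show "inv x \<in> {x \<in> D. \<not> \<theta> x}" using hom[of x "inv x"] x t1 by auto
        qed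
      qed (use vD tv in auto)
      moreover have "generate G {v} = cyc v" using generate_pow[OF vc] by (simp add: cyc_def full_SetCompr_eq)
      ultimately show ?thesis using a by blast
    qed
    define \<rho> where "\<rho> \<theta> x = (x \<in> H \<inter> Cent v \<and> \<theta> x)" for \<theta> :: "'a \<Rightarrow> bool" and x
    have "bij_betw \<rho> (Z2hom G D {v}) (Z2hom G (H \<inter> Cent v) (H \<inter> cyc v))"
      unfolding bij_betw_def
    proof
      show "inj_on \<rho> (Z2hom G D {v})"
      proof (rule inj_onI)
        fix \<theta> \<theta>' assume t: "\<theta> \<in> Z2hom G D {v}" "\<theta>' \<in> Z2hom G D {v}" "\<rho> \<theta> = \<rho> \<theta>'"
        have e: "\<theta> b = \<theta>' b" if "b \<in> H \<inter> Cent v" for b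
          using fun_cong[OF t(3), of b] that by (simp add: \<rho>_def)
        have hom: "\<eta> (x \<otimes> y) = (\<eta> x \<noteq> \<eta> y)" if "\<eta> \<in> Z2hom G D {v}" "x \<in> D" "y \<in> D" for \<eta> x y
          using that unfolding Z2hom_def by blast
        show "\<theta> = \<theta>'"
        proof
          fix x show "\<theta> x = \<theta>' x"
          proof (cases "x \<in> D")
            case True
            then obtain a b where ab: "x = a \<otimes> b" "a \<in> cyc v" "b \<in> H \<inter> Cent v" unfolding D_def by blast
            then have "a \<in> D" "b \<in> D" using cD HD by auto
            then show ?thesis using ab hom[OF t(1)] hom[OF t(2)] Zv[OF t(1) ab(2)] Zv[OF t(2) ab(2)] e[OF ab(3)] by simp
          next
            case False
            then show ?thesis using t(1,2) unfolding Z2hom_def by blast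
          qed
        qed
      qed
      show "\<rho> ` Z2hom G D {v} = Z2hom G (H \<inter> Cent v) (H \<inter> cyc v)"
      proof (intro equalityI subsetI)
        fix \<eta> assume "\<eta> \<in> \<rho> ` Z2hom G D {v}"
        then obtain \<theta> where t: "\<theta> \<in> Z2hom G D {v}" "\<eta> = \<rho> \<theta>" by blast
        show "\<eta> \<in> Z2hom G (H \<inter> Cent v) (H \<inter> cyc v)"
          unfolding Z2hom_def mem_Collect_eq
        proof (intro conjI allI ballI impI)
          fix x y assume xy: "x \<in> H \<inter> Cent v" "y \<in> H \<inter> Cent v"
          then have "\<theta> (x \<otimes> y) = (\<theta> x \<noteq> \<theta> y)" using t(1) HD unfolding Z2hom_def by blast
          then show "\<eta> (x \<otimes> y) = (\<eta> x \<noteq> \<eta> y)" using xy subgroup.m_closed[OF HC xy] by (simp add: t(2) \<rho>_def)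
        next
          fix x assume "x \<in> H \<inter> cyc v"
          then show "\<not> \<eta> x" using Zv[OF t(1), of x] by (simp add: t(2) \<rho>_def)
        qed (auto simp: t(2) \<rho>_def)
      next
        fix \<eta> assume \<eta>: "\<eta> \<in> Z2hom G (H \<inter> Cent v) (H \<inter> cyc v)"
        have hom: "\<eta> (x \<otimes> y) = (\<eta> x \<noteq> \<eta> y)" if "x \<in> H \<inter> Cent v" "y \<in> H \<inter> Cent v" for x y
          using that \<eta> unfolding Z2hom_def by blast
        have van: "\<not> \<eta> x" if "x \<in> H \<inter> cyc v" for x using that \<eta> unfolding Z2hom_def by blast
        have sup: "\<eta> x \<Longrightarrow> x \<in> H \<inter> Cent v" for x using \<eta> unfolding Z2hom_def by blast
        have wd: "\<eta> b = \<eta> b'" if ab: "a \<in> cyc v" "b \<in> H \<inter> Cent v" "a' \<in> cyc v" "b' \<in> H \<inter> Cent v" "a \<otimes> b = a' \<otimes> b'" for a b a' b'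
        proof -
          have c: "a \<in> carrier G" "b \<in> carrier G" "a' \<in> carrier G" "b' \<in> carrier G"
            using ab cyc_carrier[OF vc] subgroup.mem_carrier[OF HC] by auto
          have "inv a' \<otimes> (a \<otimes> b) \<otimes> inv b = inv a' \<otimes> (a' \<otimes> b') \<otimes> inv b" using ab(5) by simp
          then have e: "inv a' \<otimes> a = b' \<otimes> inv b" using c by (simp add: m_assoc)
          have "inv a' \<otimes> a \<in> cyc v" using ab subgroup.m_closed[OF Z] subgroup.m_inv_closed[OF Z] by blast
          moreover have k: "b' \<otimes> inv b \<in> H \<inter> Cent v" using ab subgroup.m_closed[OF HC] subgroup.m_inv_closed[OF HC] by blast
          ultimately have "\<not> \<eta> (b' \<otimes> inv b)" using van e by simp
          moreover have "b' = (b' \<otimes> inv b) \<otimes> b" using c by (simp add: m_assoc)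
          ultimately show ?thesis using hom[OF k ab(2)] by simp
        qed
        \<comment> \<open>The extension ignores the factor in \<open>cyc v\<close>. It is well
          defined by \<open>wd\<close>: two decompositions differ by an element of
          \<open>H \<inter> cyc v\<close>, where \<open>\<eta>\<close> vanishes.\<close>
        define \<theta> where "\<theta> x = (\<exists>a b. a \<in> cyc v \<and> b \<in> H \<inter> Cent v \<and> x = a \<otimes> b \<and> \<eta> b)" for x
        have \<theta>: "\<theta> (a \<otimes> b) = \<eta> b" if "a \<in> cyc v" "b \<in> H \<inter> Cent v" for a b
          unfolding \<theta>_def using that wd by blast
        have "\<theta> \<in> Z2hom G D {v}"
          unfolding Z2hom_def mem_Collect_eq
        proof (intro conjI allI ballI impI)
          fix x assume "x \<notin> D"
          then show "\<not> \<theta> x" unfolding \<theta>_def D_def by blast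
        next
          fix x assume x: "x \<in> {v}"
          have "\<not> \<eta> \<one>" using van one by blast
          then show "\<not> \<theta> x" using \<theta>[OF cyc_self[OF vc] one(1)] x vc by simp
        next
          fix x y assume "x \<in> D" "y \<in> D"
          then obtain a b a' b' where ab: "x = a \<otimes> b" "a \<in> cyc v" "b \<in> H \<inter> Cent v"
            "y = a' \<otimes> b'" "a' \<in> cyc v" "b' \<in> H \<inter> Cent v" unfolding D_def by blast
          have c: "a \<in> carrier G" "b \<in> carrier G" "a' \<in> carrier G" "b' \<in> carrier G"
            using ab cyc_carrier[OF vc] subgroup.mem_carrier[OF HC] by auto
          have "x \<otimes> y = a \<otimes> (b \<otimes> a') \<otimes> b'" using ab c by (simp add: m_assoc)
          also have "b \<otimes> a' = a' \<otimes> b" using comZ[OF ab(5), of b] ab(3) by (simp add: com_def)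
          also have "a \<otimes> (a' \<otimes> b) \<otimes> b' = (a \<otimes> a') \<otimes> (b \<otimes> b')" using c by (simp add: m_assoc)
          finally have "\<theta> (x \<otimes> y) = \<eta> (b \<otimes> b')"
            using \<theta>[OF subgroup.m_closed[OF Z ab(2,5)] subgroup.m_closed[OF HC ab(3,6)]] by simp
          then show "\<theta> (x \<otimes> y) = (\<theta> x \<noteq> \<theta> y)" using hom[OF ab(3,6)] \<theta>[OF ab(2,3)] \<theta>[OF ab(5,6)] ab(1,4) by simp
        qed
        moreover have "\<rho> \<theta> = \<eta>"
        proof
          fix x show "\<rho> \<theta> x = \<eta> x"
          proof (cases "x \<in> H \<inter> Cent v")
            case True
            then have "\<theta> (\<one> \<otimes> x) = \<eta> x" using \<theta>[OF one(2)] by blast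
            then show ?thesis using True subgroup.mem_carrier[OF HC True] by (simp add: \<rho>_def)
          next
            case False
            then show ?thesis using sup by (auto simp: \<rho>_def)
          qed
        qed
        ultimately show "\<eta> \<in> \<rho> ` Z2hom G D {v}" by blast
      qed
    qed
    then show ?thesis by (rule bij_betw_same_card)
  qed
  ultimately show ?thesis using b by auto
qed

text \<open>The edge group U = C(v) \<inter> C(w) is <v> x <w>, so Z has index z(v) z(w) in U. On
  the other hand [U : Z] = [U : H \<inter> U] [H \<inter> U : Z], and the last factor is visible
  inside \<open>H\<close>.\<close>

lemma beta_edge:
  assumes vw: "adj v w"
  defines "Z \<equiv> {a \<otimes> b | a b. a \<in> H \<inter> cyc v \<and> b \<in> H \<inter> cyc w}"
  shows "centre_index v * centre_index w = beta (v, w) * index Z (H \<inter> (Cent v \<inter> Cent w))" "subgroup Z G" "Z \<subseteq> H \<inter> (Cent v \<inter> Cent w)"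
proof -
  have v: "v \<in> vertices" "w \<in> vertices" "v \<noteq> w" "com G v w" using vw by (simp_all add: adj_def)
  have c: "v \<in> carrier G" "w \<in> carrier G" using v by auto
  define U where "U = Cent v \<inter> Cent w"
  have U: "subgroup U G" unfolding U_def by (intro subgroups_Inter_pair Cent_subgroup c)
  have HU: "subgroup (H \<inter> U) G" by (rule subgroups_Inter_pair[OF H(1) U])
  have Hc: "subgroup (H \<inter> cyc v) G" "subgroup (H \<inter> cyc w) G"
    using subgroups_Inter_pair[OF H(1) cyc_subgroup] c by auto
  have powcom: "com G (v [^] (i::int)) (w [^] (j::int))" for i j
    using com_int_pow[of "v [^] i" w j] com_int_pow[of w v i] v c by (simp add: com_sym)
  show Z: "subgroup Z G" unfolding Z_def
    by (rule com_product_subgroup[OF Hc]) (use powcom in \<open>auto simp: cyc_def\<close>)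
  have pU: "v [^] (i::int) \<in> U" "w [^] (i::int) \<in> U" for i
    using c v com_int_pow[of v v i] com_int_pow[of w v i] com_int_pow[of v w i] com_int_pow[of w w i]
    by (auto simp: U_def Cent_def com_sym[of "v [^] i"] com_sym[of "w [^] i"] com_sym[of w v])
  show ZHU: "Z \<subseteq> H \<inter> (Cent v \<inter> Cent w)"
  proof
    fix x assume "x \<in> Z"
    then obtain a b where ab: "x = a \<otimes> b" "a \<in> H" "a \<in> cyc v" "b \<in> H" "b \<in> cyc w" unfolding Z_def by blast
    then have "a \<in> U" "b \<in> U" using pU by (auto simp: cyc_def)
    then show "x \<in> H \<inter> (Cent v \<inter> Cent w)"
      using ab subgroup.m_closed[OF U] subgroup.m_closed[OF H(1)] unfolding U_def[symmetric] by blast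
  qed
  have uniq: "i = 0 \<and> j = 0" if "v [^] (i::int) \<otimes> w [^] (j::int) = \<one>" for i j
  proof -
    have "v [^] i = w [^] (- j)" using that c by (simp add: int_pow_neg inv_equality inv_solve_right')
    then have "i = 0" using vertices_pow_eq(1)[OF v(1,2), of i "- j"] v(3) by blast
    then show ?thesis using that c vertices_pow_one[OF v(2), of j] by simp
  qed
  have diff: "(v [^] (i::int) \<otimes> w [^] (j::int)) \<otimes> inv (v [^] k \<otimes> w [^] l) = v [^] (i - k) \<otimes> w [^] (j - l)" for i j k l :: int
  proof -
    have "(v [^] i \<otimes> w [^] j) \<otimes> inv (v [^] k \<otimes> w [^] l) = v [^] i \<otimes> (w [^] (j - l) \<otimes> inv (v [^] k))"
      using c by (simp add: inv_mult_group m_assoc int_pow_diff)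
    also have "inv (v [^] k) = v [^] (- k)" using c by (simp add: int_pow_neg)
    also have "w [^] (j - l) \<otimes> v [^] (- k) = v [^] (- k) \<otimes> w [^] (j - l)" using powcom[of "- k" "j - l"] by (simp add: com_def)
    also have "v [^] i \<otimes> (v [^] (- k) \<otimes> w [^] (j - l)) = v [^] (i - k) \<otimes> w [^] (j - l)"
      using c int_pow_mult[of v i "- k"] by (simp add: m_assoc[symmetric])
    finally show ?thesis .
  qed
  have memZ: "v [^] (i::int) \<otimes> w [^] (j::int) \<in> Z \<longleftrightarrow> v [^] i \<in> H \<and> w [^] j \<in> H" for i j
  proof
    assume "v [^] i \<otimes> w [^] j \<in> Z"
    then obtain k l :: int where kl: "v [^] i \<otimes> w [^] j = v [^] k \<otimes> w [^] l" "v [^] k \<in> H" "w [^] l \<in> H"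
      unfolding Z_def cyc_def by blast
    have "v [^] (i - k) \<otimes> w [^] (j - l) = \<one>" using diff[of i j k l] kl(1) c by simp
    then show "v [^] i \<in> H \<and> w [^] j \<in> H" using uniq[of "i - k" "j - l"] kl by simp
  next
    assume "v [^] i \<in> H \<and> w [^] j \<in> H"
    then show "v [^] i \<otimes> w [^] j \<in> Z" unfolding Z_def cyc_def by blast
  qed
  have Uform: "U = (\<lambda>(i, j). v [^] (i::int) \<otimes> w [^] (j::int)) ` UNIV"
  proof
    show "(\<lambda>(i, j). v [^] (i::int) \<otimes> w [^] (j::int)) ` UNIV \<subseteq> U" using pU subgroup.m_closed[OF U] by auto
    obtain u where u: "u \<in> carrier G" "v = cj G u (P (vtype v))" "w = cj G u (P (vtype w))" using adjE(2)[OF vw] by blast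
    have t: "(vtype v = 0) \<noteq> (vtype w = 0)" "vtype v \<le> 2" "vtype w \<le> 2" using adjE(1)[OF vw] vertices_vtype(1) v by auto
    have pc: "P (vtype v) \<in> carrier G" "P (vtype w) \<in> carrier G" using P_carrier t by auto
    show "U \<subseteq> (\<lambda>(i, j). v [^] (i::int) \<otimes> w [^] (j::int)) ` UNIV"
    proof
      fix x assume "x \<in> U"
      then have x: "x \<in> carrier G" "com G x v" "com G x w" by (auto simp: U_def Cent_def)
      define y where "y = cj G (inv u) x"
      have y: "y \<in> carrier G" "com G y (P (vtype v))" "com G y (P (vtype w))"
      proof -
        have "cj G (inv u) v = P (vtype v)" "cj G (inv u) w = P (vtype w)"
          using cj_cancel(2)[OF u(1) pc(1)] cj_cancel(2)[OF u(1) pc(2)] u(2,3) by metis+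
        then show "y \<in> carrier G" "com G y (P (vtype v))" "com G y (P (vtype w))"
          using x u(1) c com_cj[of "inv u" x v] com_cj[of "inv u" x w] by (auto simp: y_def)
      qed
      have xy: "x = cj G u y" using x u by (simp add: y_def)
      have "\<exists>(i::int) (j::int). x = v [^] i \<otimes> w [^] j"
      proof (cases "vtype v = 0")
        case True
        then have "vtype w \<in> {1, 2}" using t by auto
        then obtain k l :: int where "y = P 0 [^] k \<otimes> P (vtype w) [^] l" using edge_group[of "vtype w" y] y True by auto
        then have "x = cj G u (P (vtype v)) [^] k \<otimes> cj G u (P (vtype w)) [^] l"
          using xy u(1) pc True by (simp add: cj_mult cj_int_pow)
        then have "x = v [^] k \<otimes> w [^] l" using u(2,3) by metis
        then show ?thesis by blast
      next
        case False
        then have tv: "vtype v \<in> {1, 2}" "vtype w = 0" using t by auto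
        then obtain k l :: int where "y = P 0 [^] k \<otimes> P (vtype v) [^] l" using edge_group[of "vtype v" y] y by auto
        then have "x = cj G u (P (vtype w)) [^] k \<otimes> cj G u (P (vtype v)) [^] l"
          using xy u(1) pc tv by (simp add: cj_mult cj_int_pow)
        then have "x = w [^] k \<otimes> v [^] l" using u(2,3) by metis
        then have "x = v [^] l \<otimes> w [^] k" using powcom[of l k] by (simp add: com_def)
        then show ?thesis by blast
      qed
      then show "x \<in> (\<lambda>(i, j). v [^] (i::int) \<otimes> w [^] (j::int)) ` UNIV" by force
    qed
  qed
  have "index Z U = card ((\<lambda>(i, j). Z #> (v [^] (i::int) \<otimes> w [^] (j::int))) ` UNIV)"
    unfolding index_def by (subst Uform) (simp add: image_image case_prod_unfold)
  also have "\<dots> = card ((\<lambda>(i, j). (H #> (v [^] (i::int)), H #> (w [^] (j::int)))) ` UNIV)"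
  proof (rule card_image_same_kernel(1))
    fix p q :: "int \<times> int"
    obtain i j k l where pq: "p = (i, j)" "q = (k, l)" by (cases p, cases q)
    have "Z #> (v [^] i \<otimes> w [^] j) = Z #> (v [^] k \<otimes> w [^] l) \<longleftrightarrow> v [^] (i - k) \<in> H \<and> w [^] (j - l) \<in> H"
      using c by (simp add: rcos_eq_iff[OF Z] diff memZ)
    then show "((case p of (i, j) \<Rightarrow> Z #> (v [^] i \<otimes> w [^] j)) = (case q of (i, j) \<Rightarrow> Z #> (v [^] i \<otimes> w [^] j))) =
      ((case p of (i, j) \<Rightarrow> (H #> v [^] i, H #> w [^] j)) = (case q of (i, j) \<Rightarrow> (H #> v [^] i, H #> w [^] j)))"
      using c by (simp add: pq rcos_eq_iff[OF H(1)] int_pow_diff)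
  qed
  also have "(\<lambda>(i, j). (H #> (v [^] (i::int)), H #> (w [^] (j::int)))) ` UNIV = (\<lambda>x. H #> x) ` cyc v \<times> (\<lambda>x. H #> x) ` cyc w"
    by (auto simp: cyc_def)
  finally have 1: "index Z U = centre_index v * centre_index w" by (simp add: card_cartesian_product centre_index_def)
  have "index Z U = index (H \<inter> U) U * index Z (H \<inter> U)"
    using ZHU by (intro index_mult[OF Z HU U]) (auto simp: U_def)
  also have "index (H \<inter> U) U = index H U" by (rule index_Int(1)[OF H(1) U, symmetric])
  also have "index H U = beta (v, w)" by (simp add: index_def beta_def U_def)
  finally show "centre_index v * centre_index w = beta (v, w) * index Z (H \<inter> (Cent v \<inter> Cent w))" using 1 by (simp add: U_def)
qed

end

section \<open>Comparing two groups along isomorphic subgroups of finite index\<close>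

locale commensuration = A: finite_index_tree_raag G P H m + B: finite_index_tree_raag G' P' H' m'
  for G :: "('a, 'c) monoid_scheme" and P H m and G' :: "('b, 'd) monoid_scheme" and P' H' m' +
  fixes \<phi> :: "'a \<Rightarrow> 'b"
  assumes bij: "bij_betw \<phi> H H'"
    and mult: "x \<in> H \<Longrightarrow> y \<in> H \<Longrightarrow> \<phi> (x \<otimes>\<^bsub>G\<^esub> y) = \<phi> x \<otimes>\<^bsub>G'\<^esub> \<phi> y"
begin

lemma \<phi>_in: "x \<in> H \<Longrightarrow> \<phi> x \<in> H'"
  using bij bij_betwE by blast

lemma \<phi>_eq: "x \<in> H \<Longrightarrow> y \<in> H \<Longrightarrow> \<phi> x = \<phi> y \<longleftrightarrow> x = y"
  using bij unfolding bij_betw_def inj_on_def by blast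

text \<open>Makes every result available for the inverse isomorphism; surjectivity of
  \<open>\<sigma>\<close> and the reverse inequality rest on it.\<close>

lemma swap: "commensuration G' P' H' m' G P H m (inv_into H \<phi>)"
proof (intro commensuration.intro commensuration_axioms.intro A.finite_index_tree_raag_axioms B.finite_index_tree_raag_axioms)
  show "bij_betw (inv_into H \<phi>) H' H" by (rule bij_betw_inv_into[OF bij])
  fix x y assume xy: "x \<in> H'" "y \<in> H'"
  define a where "a = inv_into H \<phi> x"
  define b where "b = inv_into H \<phi> y"
  have ab: "a \<in> H" "\<phi> a = x" "b \<in> H" "\<phi> b = y"
    using xy bij unfolding a_def b_def by (simp_all add: bij_betw_def inv_into_into f_inv_into_f)
  then have "\<phi> (a \<otimes>\<^bsub>G\<^esub> b) = x \<otimes>\<^bsub>G'\<^esub> y" by (simp add: mult)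
  moreover have "a \<otimes>\<^bsub>G\<^esub> b \<in> H" using ab subgroup.m_closed[OF A.H(1)] by blast
  ultimately show "inv_into H \<phi> (x \<otimes>\<^bsub>G'\<^esub> y) = inv_into H \<phi> x \<otimes>\<^bsub>G\<^esub> inv_into H \<phi> y"
    using bij unfolding a_def[symmetric] b_def[symmetric] by (metis bij_betw_def inv_into_f_f)
qed

lemma group_hom_\<phi>: "group_hom (G\<lparr>carrier := H\<rparr>) G' \<phi>"
  using A.subgroup_imp_group[OF A.H(1)] B.is_group mult \<phi>_in B.H_carrier
  by (auto simp: group_hom_def group_hom_axioms_def hom_def)

lemma \<phi>_one: "\<phi> \<one>\<^bsub>G\<^esub> = \<one>\<^bsub>G'\<^esub>"
  using group_hom.hom_one[OF group_hom_\<phi>] by simp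

lemma \<phi>_inv: "x \<in> H \<Longrightarrow> \<phi> (inv\<^bsub>G\<^esub> x) = inv\<^bsub>G'\<^esub> (\<phi> x)"
  using group_hom.hom_inv[OF group_hom_\<phi>, of x] A.m_inv_consistent[OF A.H(1)] by simp

lemma \<phi>_pow: "x \<in> H \<Longrightarrow> \<phi> (x [^]\<^bsub>G\<^esub> (k::int)) = \<phi> x [^]\<^bsub>G'\<^esub> k"
  using group_hom.hom_int_pow[OF group_hom_\<phi>, of x k] A.int_pow_consistent[OF A.H(1)] by simp

lemma \<phi>_com: "x \<in> H \<Longrightarrow> y \<in> H \<Longrightarrow> com G' (\<phi> x) (\<phi> y) \<longleftrightarrow> com G x y"
  using \<phi>_eq[of "x \<otimes>\<^bsub>G\<^esub> y" "y \<otimes>\<^bsub>G\<^esub> x"] subgroup.m_closed[OF A.H(1)] by (simp add: com_def mult)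

lemma \<phi>_cj: "x \<in> H \<Longrightarrow> y \<in> H \<Longrightarrow> \<phi> (cj G x y) = cj G' (\<phi> x) (\<phi> y)"
  using subgroup.m_closed[OF A.H(1)] subgroup.m_inv_closed[OF A.H(1)] by (simp add: cj_def mult \<phi>_inv)

section \<open>The isomorphism of trees induced by an isomorphism of finite index subgroups\<close>

lemma special_\<phi>: "A.special x \<Longrightarrow> B.special (\<phi> x)"
proof -
  assume "A.special x"
  then obtain a b where ab: "x \<in> H" "x \<noteq> \<one>\<^bsub>G\<^esub>" "a \<in> H" "b \<in> H" "com G a x" "com G b x" "\<not> com G a b"
    unfolding A.special_def by blast
  have "\<phi> x \<noteq> \<one>\<^bsub>G'\<^esub>" using \<phi>_eq[of x "\<one>\<^bsub>G\<^esub>"] ab subgroup.one_closed[OF A.H(1)] \<phi>_one by simp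
  moreover have "com G' (\<phi> a) (\<phi> x)" "com G' (\<phi> b) (\<phi> x)" "\<not> com G' (\<phi> a) (\<phi> b)"
    using ab by (simp_all add: \<phi>_com)
  ultimately show ?thesis unfolding B.special_def using ab \<phi>_in by blast
qed

text \<open>One matching pair of powers decides all of them: the image of any other nontrivial power
  of \<open>v\<close> in \<open>H\<close> is special, hence a power of some vertex \<open>w\<close>,
  and \<open>w\<close> has a nontrivial power in common with \<open>v'\<close>, so
  \<open>w = v'\<close>.\<close>

lemma image_sub:
  assumes "v \<in> A.vertices" "v' \<in> B.vertices" "v [^]\<^bsub>G\<^esub> (k::int) \<in> H" "k \<noteq> 0" "\<phi> (v [^]\<^bsub>G\<^esub> k) = v' [^]\<^bsub>G'\<^esub> (l::int)" "l \<noteq> 0"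
  shows "\<phi> ` (H \<inter> A.cyc v) \<subseteq> H' \<inter> B.cyc v'"
proof
  fix y assume "y \<in> \<phi> ` (H \<inter> A.cyc v)"
  then obtain a :: int where a: "y = \<phi> (v [^]\<^bsub>G\<^esub> a)" "v [^]\<^bsub>G\<^esub> a \<in> H" by (auto simp: A.cyc_def)
  have "y \<in> B.cyc v'"
  proof (cases "a = 0")
    case True
    then have "y = v' [^]\<^bsub>G'\<^esub> (0::int)" using a \<phi>_one by simp
    then show ?thesis unfolding B.cyc_def by blast
  next
    case False
    have "B.special y" unfolding a(1) by (rule special_\<phi>[OF A.vertex_special[OF assms(1) a(2) False]])
    then obtain w b where w: "w \<in> B.vertices" "(b::int) \<noteq> 0" "y = w [^]\<^bsub>G'\<^esub> b" using B.special_vertex by blast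
    have vc: "v \<in> carrier G" using assms(1) by simp
    have "(v [^]\<^bsub>G\<^esub> a) [^]\<^bsub>G\<^esub> k = (v [^]\<^bsub>G\<^esub> k) [^]\<^bsub>G\<^esub> a" using vc by (simp add: A.int_pow_pow mult.commute)
    then have "\<phi> ((v [^]\<^bsub>G\<^esub> a) [^]\<^bsub>G\<^esub> k) = \<phi> ((v [^]\<^bsub>G\<^esub> k) [^]\<^bsub>G\<^esub> a)" by simp
    then have "(w [^]\<^bsub>G'\<^esub> b) [^]\<^bsub>G'\<^esub> k = (v' [^]\<^bsub>G'\<^esub> l) [^]\<^bsub>G'\<^esub> a"
      using \<phi>_pow[OF a(2)] \<phi>_pow[OF assms(3)] assms(5) w(3) a(1) by simp
    then have "w = v'" using B.same_vertex[OF w(1) assms(2) w(2) assms(6,4)] by blast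
    then show ?thesis using w(3) unfolding B.cyc_def by blast
  qed
  then show "y \<in> H' \<inter> B.cyc v'" using a \<phi>_in by simp
qed

text \<open>A vertex is remembered through the trace of its cyclic group on the subgroup, which
  determines it by \<open>H_cyc_inj\<close>.\<close>

definition Rel where
  "Rel v v' \<longleftrightarrow> v \<in> A.vertices \<and> v' \<in> B.vertices \<and> \<phi> ` (H \<inter> A.cyc v) = H' \<inter> B.cyc v'"

text \<open>Some nontrivial power of \<open>v\<close> lies in \<open>H\<close> and is special, so
  its image is a power of a vertex; \<open>image_sub\<close> for \<open>\<phi>\<close> and for its
  inverse gives both inclusions.\<close>

lemma Rel_ex: assumes v: "v \<in> A.vertices" shows "\<exists>v'. Rel v v'"
proof -
  interpret S: commensuration G' P' H' m' G P H m "inv_into H \<phi>" by (rule swap)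
  obtain k :: int where k: "0 < k" "v [^]\<^bsub>G\<^esub> k \<in> H" using A.H_cyc_nontrivial[OF v] by blast
  have "B.special (\<phi> (v [^]\<^bsub>G\<^esub> k))" using k by (intro special_\<phi> A.vertex_special v) auto
  then obtain v' l where v': "v' \<in> B.vertices" "(l::int) \<noteq> 0" "\<phi> (v [^]\<^bsub>G\<^esub> k) = v' [^]\<^bsub>G'\<^esub> l"
    using B.special_vertex by blast
  have k0: "k \<noteq> 0" using k by simp
  have 1: "\<phi> ` (H \<inter> A.cyc v) \<subseteq> H' \<inter> B.cyc v'" by (rule image_sub[OF v v'(1) k(2) k0 v'(3,2)])
  have inH': "v' [^]\<^bsub>G'\<^esub> l \<in> H'" using \<phi>_in[OF k(2)] v'(3) by simp
  have "inv_into H \<phi> (v' [^]\<^bsub>G'\<^esub> l) = v [^]\<^bsub>G\<^esub> k"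
    unfolding v'(3)[symmetric] using bij k(2) by (simp add: bij_betw_def inv_into_f_f)
  from S.image_sub[OF v'(1) v inH' v'(2) this k0]
  have 2: "inv_into H \<phi> ` (H' \<inter> B.cyc v') \<subseteq> H \<inter> A.cyc v" .
  have "H' \<inter> B.cyc v' \<subseteq> \<phi> ` (H \<inter> A.cyc v)"
  proof
    fix y assume y: "y \<in> H' \<inter> B.cyc v'"
    then have "\<phi> (inv_into H \<phi> y) = y" using bij by (simp add: bij_betw_def f_inv_into_f)
    moreover have "inv_into H \<phi> y \<in> H \<inter> A.cyc v" using 2 y by blast
    ultimately show "y \<in> \<phi> ` (H \<inter> A.cyc v)" by (metis image_eqI)
  qed
  then show ?thesis unfolding Rel_def using v v'(1) 1 by blast
qed

definition \<sigma> where "\<sigma> v = (SOME v'. Rel v v')"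

lemma \<sigma>_Rel: "v \<in> A.vertices \<Longrightarrow> Rel v (\<sigma> v)"
  unfolding \<sigma>_def by (rule someI_ex[OF Rel_ex])

lemma \<sigma>_vertices: "v \<in> A.vertices \<Longrightarrow> \<sigma> v \<in> B.vertices"
  using \<sigma>_Rel[of v] by (simp add: Rel_def)

lemma \<sigma>_image: "v \<in> A.vertices \<Longrightarrow> \<phi> ` (H \<inter> A.cyc v) = H' \<inter> B.cyc (\<sigma> v)"
  using \<sigma>_Rel[of v] by (simp add: Rel_def)

lemma \<sigma>_eqI: "Rel v v' \<Longrightarrow> \<sigma> v = v'"
  by (metis B.H_cyc_inj Rel_def \<sigma>_Rel)

lemma \<sigma>_inj: assumes "v \<in> A.vertices" "w \<in> A.vertices" "\<sigma> v = \<sigma> w" shows "v = w"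
proof -
  have "\<phi> ` (H \<inter> A.cyc v) = \<phi> ` (H \<inter> A.cyc w)" using \<sigma>_image assms by simp
  then have "H \<inter> A.cyc v = H \<inter> A.cyc w"
    using inj_on_image_eq_iff[of \<phi> H] bij unfolding bij_betw_def by blast
  then show ?thesis using A.H_cyc_inj assms by blast
qed

lemma \<sigma>_surj: assumes "v' \<in> B.vertices" shows "\<exists>v\<in>A.vertices. \<sigma> v = v'"
proof -
  interpret S: commensuration G' P' H' m' G P H m "inv_into H \<phi>" by (rule swap)
  obtain v where v: "S.Rel v' v" using S.Rel_ex[OF assms] by blast
  then have "\<phi> ` (inv_into H \<phi> ` (H' \<inter> B.cyc v')) = \<phi> ` (H \<inter> A.cyc v)" unfolding S.Rel_def by simp
  moreover have "\<phi> ` (inv_into H \<phi> ` (H' \<inter> B.cyc v')) = H' \<inter> B.cyc v'"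
    using bij by (simp add: bij_betw_def image_inv_into_cancel)
  ultimately have "Rel v v'" using v unfolding S.Rel_def Rel_def by simp
  then show ?thesis using \<sigma>_eqI unfolding Rel_def by blast
qed

lemma \<sigma>_pow:
  assumes "v \<in> A.vertices"
  obtains k l :: int where "k \<noteq> 0" "l \<noteq> 0" "v [^]\<^bsub>G\<^esub> k \<in> H" "\<phi> (v [^]\<^bsub>G\<^esub> k) = \<sigma> v [^]\<^bsub>G'\<^esub> l"
proof -
  obtain k :: int where k: "0 < k" "v [^]\<^bsub>G\<^esub> k \<in> H" "v [^]\<^bsub>G\<^esub> k \<noteq> \<one>\<^bsub>G\<^esub>" using A.H_cyc_nontrivial[OF assms] by blast
  then have "v [^]\<^bsub>G\<^esub> k \<in> H \<inter> A.cyc v" unfolding A.cyc_def by blast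
  then have "\<phi> (v [^]\<^bsub>G\<^esub> k) \<in> B.cyc (\<sigma> v)" using \<sigma>_image[OF assms] by blast
  then obtain l :: int where l: "\<phi> (v [^]\<^bsub>G\<^esub> k) = \<sigma> v [^]\<^bsub>G'\<^esub> l" by (auto simp: B.cyc_def)
  have "\<phi> (v [^]\<^bsub>G\<^esub> k) \<noteq> \<one>\<^bsub>G'\<^esub>"
    using \<phi>_eq[of "v [^]\<^bsub>G\<^esub> k" "\<one>\<^bsub>G\<^esub>"] k subgroup.one_closed[OF A.H(1)] \<phi>_one by simp
  then have "l \<noteq> 0" using l by auto
  then show thesis using that[of k l] k l by auto
qed

text \<open>A vertex has the same centralizer as each of its nonzero powers, and
  \<open>\<phi>\<close> matches a power of \<open>v\<close> with a power of
  \<open>\<sigma> v\<close>.\<close>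

lemma \<sigma>_cent: assumes "v \<in> A.vertices" "x \<in> H" shows "com G' (\<phi> x) (\<sigma> v) \<longleftrightarrow> com G x v"
proof -
  obtain k l :: int where kl: "k \<noteq> 0" "l \<noteq> 0" "v [^]\<^bsub>G\<^esub> k \<in> H" "\<phi> (v [^]\<^bsub>G\<^esub> k) = \<sigma> v [^]\<^bsub>G'\<^esub> l"
    using \<sigma>_pow[OF assms(1)] .
  have "com G' (\<phi> x) (\<sigma> v) \<longleftrightarrow> com G' (\<phi> x) (\<phi> (v [^]\<^bsub>G\<^esub> k))"
    unfolding kl(4) using B.vertices_pow_com[OF \<sigma>_vertices[OF assms(1)] B.H_carrier[OF \<phi>_in[OF assms(2)]] kl(2)] by simp
  also have "\<dots> \<longleftrightarrow> com G x (v [^]\<^bsub>G\<^esub> k)" by (rule \<phi>_com[OF assms(2) kl(3)])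
  also have "\<dots> \<longleftrightarrow> com G x v" by (rule A.vertices_pow_com[OF assms(1) A.H_carrier[OF assms(2)] kl(1)])
  finally show ?thesis .
qed

lemma image_Cent: assumes "v \<in> A.vertices" shows "\<phi> ` (H \<inter> A.Cent v) = H' \<inter> B.Cent (\<sigma> v)"
proof (intro equalityI subsetI)
  fix y assume "y \<in> \<phi> ` (H \<inter> A.Cent v)"
  then obtain x where "y = \<phi> x" "x \<in> H" "com G x v" by (auto simp: A.Cent_def)
  then show "y \<in> H' \<inter> B.Cent (\<sigma> v)" using \<sigma>_cent[OF assms] \<phi>_in B.H_carrier by (auto simp: B.Cent_def)
next
  fix y assume y: "y \<in> H' \<inter> B.Cent (\<sigma> v)"
  then obtain x where x: "x \<in> H" "y = \<phi> x" using bij unfolding bij_betw_def by blast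
  then have "x \<in> H \<inter> A.Cent v" using y \<sigma>_cent[OF assms x(1)] A.H_carrier by (auto simp: A.Cent_def B.Cent_def)
  then show "y \<in> \<phi> ` (H \<inter> A.Cent v)" using x by blast
qed

lemma \<sigma>_com: assumes "v \<in> A.vertices" "w \<in> A.vertices" shows "com G' (\<sigma> v) (\<sigma> w) \<longleftrightarrow> com G v w"
proof -
  obtain k l :: int where kl: "k \<noteq> 0" "l \<noteq> 0" "v [^]\<^bsub>G\<^esub> k \<in> H" "\<phi> (v [^]\<^bsub>G\<^esub> k) = \<sigma> v [^]\<^bsub>G'\<^esub> l"
    using \<sigma>_pow[OF assms(1)] .
  obtain i j :: int where ij: "i \<noteq> 0" "j \<noteq> 0" "w [^]\<^bsub>G\<^esub> i \<in> H" "\<phi> (w [^]\<^bsub>G\<^esub> i) = \<sigma> w [^]\<^bsub>G'\<^esub> j"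
    using \<sigma>_pow[OF assms(2)] .
  show ?thesis
    using A.com_pow_iff[OF assms kl(1) ij(1)] B.com_pow_iff[OF \<sigma>_vertices[OF assms(1)] \<sigma>_vertices[OF assms(2)] kl(2) ij(2)]
      \<phi>_com[OF kl(3) ij(3)] kl(4) ij(4) by simp
qed

lemma \<sigma>_adj: assumes "v \<in> A.vertices" "w \<in> A.vertices" shows "B.adj (\<sigma> v) (\<sigma> w) \<longleftrightarrow> A.adj v w"
  unfolding A.adj_def B.adj_def using assms \<sigma>_com \<sigma>_vertices \<sigma>_inj by blast

lemma \<sigma>_equivariant: assumes "v \<in> A.vertices" "h \<in> H" shows "\<sigma> (cj G h v) = cj G' (\<phi> h) (\<sigma> v)"
proof (rule \<sigma>_eqI)
  have hc: "h \<in> carrier G" "\<phi> h \<in> carrier G'" using assms A.H_carrier B.H_carrier \<phi>_in by auto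
  have vc: "v \<in> carrier G" "\<sigma> v \<in> carrier G'" using assms \<sigma>_vertices by auto
  have hi: "inv\<^bsub>G\<^esub> h \<in> H" using subgroup.m_inv_closed[OF A.H(1) assms(2)] .
  have AH: "cj G h y \<in> H" "cj G (inv\<^bsub>G\<^esub> h) y \<in> H" if "y \<in> H" for y
    unfolding cj_def A.inv_inv[OF hc(1)]
    by (intro subgroup.m_closed[OF A.H(1)] assms(2) that hi)+
  have A: "H \<inter> A.cyc (cj G h v) = cj G h ` (H \<inter> A.cyc v)"
  proof (intro equalityI subsetI)
    fix x assume x: "x \<in> H \<inter> A.cyc (cj G h v)"
    then obtain k :: int where k: "x = cj G h (v [^]\<^bsub>G\<^esub> k)" using hc vc by (auto simp: A.cyc_def A.cj_int_pow)
    moreover from this have "v [^]\<^bsub>G\<^esub> k = cj G (inv\<^bsub>G\<^esub> h) x" using hc vc by simp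
    moreover have "cj G (inv\<^bsub>G\<^esub> h) x \<in> H"
      using x AH(2) by blast
    moreover have "v [^]\<^bsub>G\<^esub> k \<in> A.cyc v" unfolding A.cyc_def by blast
    ultimately have "v [^]\<^bsub>G\<^esub> k \<in> H \<inter> A.cyc v" by simp
    then show "x \<in> cj G h ` (H \<inter> A.cyc v)" by (rule image_eqI[rotated], intro k)
  next
    fix x assume "x \<in> cj G h ` (H \<inter> A.cyc v)"
    then obtain k :: int where k: "x = cj G h (v [^]\<^bsub>G\<^esub> k)" "v [^]\<^bsub>G\<^esub> k \<in> H" by (auto simp: A.cyc_def)
    then have "x = cj G h v [^]\<^bsub>G\<^esub> k" using hc vc by (simp add: A.cj_int_pow)
    moreover have "x \<in> H" using k AH(1) by simp
    ultimately show "x \<in> H \<inter> A.cyc (cj G h v)" unfolding A.cyc_def by blast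
  qed
  have hi': "inv\<^bsub>G'\<^esub> (\<phi> h) \<in> H'" using subgroup.m_inv_closed[OF B.H(1) \<phi>_in[OF assms(2)]] .
  have H': "cj G' (\<phi> h) y \<in> H'" "cj G' (inv\<^bsub>G'\<^esub> (\<phi> h)) y \<in> H'" if "y \<in> H'" for y
    unfolding cj_def B.inv_inv[OF hc(2)]
    by (intro subgroup.m_closed[OF B.H(1)] \<phi>_in[OF assms(2)] that hi')+
  have B: "H' \<inter> B.cyc (cj G' (\<phi> h) (\<sigma> v)) = cj G' (\<phi> h) ` (H' \<inter> B.cyc (\<sigma> v))"
  proof (intro equalityI subsetI)
    fix x assume x: "x \<in> H' \<inter> B.cyc (cj G' (\<phi> h) (\<sigma> v))"
    then obtain k :: int where k: "x = cj G' (\<phi> h) (\<sigma> v [^]\<^bsub>G'\<^esub> k)" using hc vc by (auto simp: B.cyc_def B.cj_int_pow)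
    moreover from this have "\<sigma> v [^]\<^bsub>G'\<^esub> k = cj G' (inv\<^bsub>G'\<^esub> (\<phi> h)) x" using hc vc by simp
    moreover have "cj G' (inv\<^bsub>G'\<^esub> (\<phi> h)) x \<in> H'" using H' x by blast
    moreover have "\<sigma> v [^]\<^bsub>G'\<^esub> k \<in> B.cyc (\<sigma> v)" unfolding B.cyc_def by blast
    ultimately have "\<sigma> v [^]\<^bsub>G'\<^esub> k \<in> H' \<inter> B.cyc (\<sigma> v)" by simp
    then show "x \<in> cj G' (\<phi> h) ` (H' \<inter> B.cyc (\<sigma> v))" by (rule image_eqI[rotated], intro k)
  next
    fix x assume "x \<in> cj G' (\<phi> h) ` (H' \<inter> B.cyc (\<sigma> v))"
    then obtain k :: int where k: "x = cj G' (\<phi> h) (\<sigma> v [^]\<^bsub>G'\<^esub> k)" "\<sigma> v [^]\<^bsub>G'\<^esub> k \<in> H'" by (auto simp: B.cyc_def)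
    then have "x = cj G' (\<phi> h) (\<sigma> v) [^]\<^bsub>G'\<^esub> k" using hc vc by (simp add: B.cj_int_pow)
    moreover have "x \<in> H'" using k H' by blast
    ultimately show "x \<in> H' \<inter> B.cyc (cj G' (\<phi> h) (\<sigma> v))" unfolding B.cyc_def by blast
  qed
  have "\<phi> ` cj G h ` (H \<inter> A.cyc v) = cj G' (\<phi> h) ` \<phi> ` (H \<inter> A.cyc v)"
    unfolding image_image using \<phi>_cj[OF assms(2)] by (intro image_cong) auto
  then have "\<phi> ` (H \<inter> A.cyc (cj G h v)) = H' \<inter> B.cyc (cj G' (\<phi> h) (\<sigma> v))"
    using A B \<sigma>_image[OF assms(1)] by simp
  then show "Rel (cj G h v) (cj G' (\<phi> h) (\<sigma> v))"
    unfolding Rel_def using A.cj_vertices(1)[OF assms(1) hc(1)] B.cj_vertices(1)[OF \<sigma>_vertices[OF assms(1)] hc(2)] by blast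
qed

section \<open>Comparison of vertex groups and edge groups\<close>

definition \<rho> where "\<rho> v = real (B.centre_index (\<sigma> v)) / real (A.centre_index v)"

lemma \<rho>_pos: "v \<in> A.vertices \<Longrightarrow> 0 < \<rho> v"
  using A.centre_index_pos B.centre_index_pos \<sigma>_vertices by (simp add: \<rho>_def)

lemma card_Z2hom_\<phi>:
  assumes D: "subgroup D G" "D \<subseteq> H" and Z: "Z \<subseteq> D"
  shows "card (Z2hom G D Z) = card (Z2hom G' (\<phi> ` D) (\<phi> ` Z))"
proof -
  have inj: "inv_into H \<phi> (\<phi> x) = x" if "x \<in> H" for x using that bij by (simp add: bij_betw_def)
  have Dm: "x \<otimes>\<^bsub>G\<^esub> y \<in> D" if "x \<in> D" "y \<in> D" for x y using that subgroup.m_closed[OF D(1)] by blast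
  have "bij_betw (\<lambda>\<theta> y. y \<in> \<phi> ` D \<and> \<theta> (inv_into H \<phi> y)) (Z2hom G D Z) (Z2hom G' (\<phi> ` D) (\<phi> ` Z))"
  proof (rule bij_betw_byWitness[where f' = "\<lambda>\<theta> x. x \<in> D \<and> \<theta> (\<phi> x)"])
    show "\<forall>\<theta>\<in>Z2hom G D Z. (\<lambda>x. x \<in> D \<and> \<phi> x \<in> \<phi> ` D \<and> \<theta> (inv_into H \<phi> (\<phi> x))) = \<theta>"
    proof (intro ballI ext)
      fix \<theta> x assume t: "\<theta> \<in> Z2hom G D Z"
      show "(x \<in> D \<and> \<phi> x \<in> \<phi> ` D \<and> \<theta> (inv_into H \<phi> (\<phi> x))) = \<theta> x"
      proof (cases "x \<in> D")
        case True
        then show ?thesis using inj D(2) by auto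
      next
        case False
        then show ?thesis using t unfolding Z2hom_def by blast
      qed
    qed
    show "\<forall>\<theta>\<in>Z2hom G' (\<phi> ` D) (\<phi> ` Z). (\<lambda>y. y \<in> \<phi> ` D \<and> inv_into H \<phi> y \<in> D \<and> \<theta> (\<phi> (inv_into H \<phi> y))) = \<theta>"
    proof (intro ballI ext)
      fix \<theta> y assume t: "\<theta> \<in> Z2hom G' (\<phi> ` D) (\<phi> ` Z)"
      show "(y \<in> \<phi> ` D \<and> inv_into H \<phi> y \<in> D \<and> \<theta> (\<phi> (inv_into H \<phi> y))) = \<theta> y"
      proof (cases "y \<in> \<phi> ` D")
        case True
        then show ?thesis using inj D(2) by auto
      next
        case False
        then show ?thesis using t unfolding Z2hom_def by blast
      qed
    qed
    show "(\<lambda>\<theta> y. y \<in> \<phi> ` D \<and> \<theta> (inv_into H \<phi> y)) ` Z2hom G D Z \<subseteq> Z2hom G' (\<phi> ` D) (\<phi> ` Z)"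
    proof (rule image_subsetI)
      fix \<theta> assume t: "\<theta> \<in> Z2hom G D Z"
      define \<eta> where "\<eta> = (\<lambda>y. y \<in> \<phi> ` D \<and> \<theta> (inv_into H \<phi> y))"
      have \<eta>: "\<eta> (\<phi> x) = \<theta> x" if "x \<in> D" for x using that inj D(2) by (auto simp: \<eta>_def)
      have "\<eta> \<in> Z2hom G' (\<phi> ` D) (\<phi> ` Z)" unfolding Z2hom_def mem_Collect_eq
      proof (intro conjI allI ballI impI)
        fix y assume "y \<notin> \<phi> ` D" then show "\<not> \<eta> y" by (simp add: \<eta>_def)
      next
        fix y z assume "y \<in> \<phi> ` D" "z \<in> \<phi> ` D"
        then obtain a b where ab: "a \<in> D" "y = \<phi> a" "b \<in> D" "z = \<phi> b" by blast
        then have "y \<otimes>\<^bsub>G'\<^esub> z = \<phi> (a \<otimes>\<^bsub>G\<^esub> b)" using mult[OF subsetD[OF D(2)] subsetD[OF D(2)]] by simp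
        moreover have "\<theta> (a \<otimes>\<^bsub>G\<^esub> b) = (\<theta> a \<noteq> \<theta> b)" using t ab unfolding Z2hom_def by blast
        ultimately show "\<eta> (y \<otimes>\<^bsub>G'\<^esub> z) = (\<eta> y \<noteq> \<eta> z)" using ab \<eta> Dm by simp
      next
        fix y assume "y \<in> \<phi> ` Z"
        then obtain x where "x \<in> Z" "y = \<phi> x" by blast
        moreover from this have "\<not> \<theta> x" using t unfolding Z2hom_def by blast
        ultimately show "\<not> \<eta> y" using \<eta> Z by auto
      qed
      then show "(\<lambda>y. y \<in> \<phi> ` D \<and> \<theta> (inv_into H \<phi> y)) \<in> Z2hom G' (\<phi> ` D) (\<phi> ` Z)" by (simp add: \<eta>_def)
    qed
    show "(\<lambda>\<theta> x. x \<in> D \<and> \<theta> (\<phi> x)) ` Z2hom G' (\<phi> ` D) (\<phi> ` Z) \<subseteq> Z2hom G D Z"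
    proof (rule image_subsetI)
      fix \<theta> assume t: "\<theta> \<in> Z2hom G' (\<phi> ` D) (\<phi> ` Z)"
      show "(\<lambda>x. x \<in> D \<and> \<theta> (\<phi> x)) \<in> Z2hom G D Z" unfolding Z2hom_def mem_Collect_eq
      proof (intro conjI allI ballI impI)
        fix x y assume xy: "x \<in> D" "y \<in> D"
        then have "\<theta> (\<phi> x \<otimes>\<^bsub>G'\<^esub> \<phi> y) = (\<theta> (\<phi> x) \<noteq> \<theta> (\<phi> y))" using t unfolding Z2hom_def by blast
        moreover have "\<phi> (x \<otimes>\<^bsub>G\<^esub> y) = \<phi> x \<otimes>\<^bsub>G'\<^esub> \<phi> y" using xy D(2) mult by blast
        ultimately show "(x \<otimes>\<^bsub>G\<^esub> y \<in> D \<and> \<theta> (\<phi> (x \<otimes>\<^bsub>G\<^esub> y))) = ((x \<in> D \<and> \<theta> (\<phi> x)) \<noteq> (y \<in> D \<and> \<theta> (\<phi> y)))"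
          using xy Dm by simp
      next
        fix x assume "x \<in> Z"
        then have "\<not> \<theta> (\<phi> x)" using t unfolding Z2hom_def by blast
        then show "\<not> (x \<in> D \<and> \<theta> (\<phi> x))" by simp
      qed simp
    qed
  qed
  then show ?thesis by (rule bij_betw_same_card)
qed

text \<open>Both vertex groups have the same number of homomorphisms to the group of order two, so
  the exponents agree: m f = m' f'. With beta = f z from \<open>beta_vertex\<close> on either side,
  the quotient of the centre indices appears as \<open>\<rho> v\<close>.\<close>

lemma vertex_ratio:
  assumes v: "v \<in> A.vertices"
  shows "real (A.beta (v, v)) * (real (m (A.vtype v)) * \<rho> v) = real (B.beta (\<sigma> v, \<sigma> v)) * real (m' (B.vtype (\<sigma> v)))"
proof -
  have s: "\<sigma> v \<in> B.vertices" using \<sigma>_vertices v by simp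
  obtain f where f: "A.beta (v, v) = f * A.centre_index v" "card (Z2hom G (H \<inter> A.Cent v) (H \<inter> A.cyc v)) = 2 ^ (m (A.vtype v) * f + 1)"
    using A.beta_vertex[OF v] by blast
  obtain f' where f': "B.beta (\<sigma> v, \<sigma> v) = f' * B.centre_index (\<sigma> v)"
    "card (Z2hom G' (H' \<inter> B.Cent (\<sigma> v)) (H' \<inter> B.cyc (\<sigma> v))) = 2 ^ (m' (B.vtype (\<sigma> v)) * f' + 1)"
    using B.beta_vertex[OF s] by blast
  have vc: "v \<in> carrier G" using v by simp
  have "A.cyc v \<subseteq> A.Cent v" using vc A.com_int_pow[of v v] by (auto simp: A.Cent_def A.cyc_def A.com_sym)
  then have "card (Z2hom G (H \<inter> A.Cent v) (H \<inter> A.cyc v)) = card (Z2hom G' (H' \<inter> B.Cent (\<sigma> v)) (H' \<inter> B.cyc (\<sigma> v)))"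
    unfolding image_Cent[OF v, symmetric] \<sigma>_image[OF v, symmetric]
    by (intro card_Z2hom_\<phi> A.subgroups_Inter_pair A.H(1) A.Cent_subgroup vc) auto
  then have "(2::nat) ^ (m (A.vtype v) * f + 1) = 2 ^ (m' (B.vtype (\<sigma> v)) * f' + 1)" using f f' by simp
  then have "m (A.vtype v) * f = m' (B.vtype (\<sigma> v)) * f'" by (metis Suc_eq_plus1 Suc_inject one_less_numeral_iff power_inject_exp semiring_norm(76))
  then have "real (m (A.vtype v)) * real f = real (m' (B.vtype (\<sigma> v))) * real f'" by (metis of_nat_mult)
  then have "real f * real (m (A.vtype v)) * real (B.centre_index (\<sigma> v)) = real f' * real (B.centre_index (\<sigma> v)) * real (m' (B.vtype (\<sigma> v)))"
    by (simp add: mult.commute mult.left_commute)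
  then show ?thesis using f(1) f'(1) A.centre_index_pos[OF v] by (simp add: \<rho>_def field_simps)
qed

text \<open>\<open>\<phi>\<close> carries the groups \<open>Z\<close> and \<open>U\<close> of the
  edge to those of its image, so the factor \<open>index Z U\<close> is common to both instances of
  \<open>beta_edge\<close> and cancels.\<close>

lemma edge_ratio:
  assumes vw: "A.adj v w"
  shows "real (A.beta (v, w)) * (\<rho> v * \<rho> w) = real (B.beta (\<sigma> v, \<sigma> w))"
proof -
  have v: "v \<in> A.vertices" "w \<in> A.vertices" using vw by (simp_all add: A.adj_def)
  have s: "\<sigma> v \<in> B.vertices" "\<sigma> w \<in> B.vertices" using \<sigma>_vertices v by auto
  have a': "B.adj (\<sigma> v) (\<sigma> w)" using \<sigma>_adj v vw by simp
  define Z where "Z = {a \<otimes>\<^bsub>G\<^esub> b | a b. a \<in> H \<inter> A.cyc v \<and> b \<in> H \<inter> A.cyc w}"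
  define Z' where "Z' = {a \<otimes>\<^bsub>G'\<^esub> b | a b. a \<in> H' \<inter> B.cyc (\<sigma> v) \<and> b \<in> H' \<inter> B.cyc (\<sigma> w)}"
  define U where "U = H \<inter> (A.Cent v \<inter> A.Cent w)"
  define U' where "U' = H' \<inter> (B.Cent (\<sigma> v) \<inter> B.Cent (\<sigma> w))"
  note e = A.beta_edge[OF vw, folded Z_def U_def]
  note e' = B.beta_edge[OF a', folded Z'_def U'_def]
  have injH: "inj_on \<phi> H" using bij by (simp add: bij_betw_def)
  have UU: "\<phi> ` U = U'"
  proof -
    have "U = (H \<inter> A.Cent v) \<inter> (H \<inter> A.Cent w)" by (auto simp: U_def)
    then have "\<phi> ` U = \<phi> ` (H \<inter> A.Cent v) \<inter> \<phi> ` (H \<inter> A.Cent w)"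
      using inj_on_image_Int[OF injH, of "H \<inter> A.Cent v" "H \<inter> A.Cent w"] by simp
    also have "\<dots> = U'" unfolding image_Cent[OF v(1)] image_Cent[OF v(2)] U'_def by blast
    finally show ?thesis .
  qed
  have ZZ: "\<phi> ` Z = Z'"
  proof (intro equalityI subsetI)
    fix y assume "y \<in> \<phi> ` Z"
    then obtain a b where ab: "a \<in> H \<inter> A.cyc v" "b \<in> H \<inter> A.cyc w" "y = \<phi> (a \<otimes>\<^bsub>G\<^esub> b)" unfolding Z_def by blast
    then have "y = \<phi> a \<otimes>\<^bsub>G'\<^esub> \<phi> b" using mult by simp
    moreover have "\<phi> a \<in> H' \<inter> B.cyc (\<sigma> v)" "\<phi> b \<in> H' \<inter> B.cyc (\<sigma> w)"
      using ab(1,2) unfolding \<sigma>_image[OF v(1), symmetric] \<sigma>_image[OF v(2), symmetric] by blast+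
    ultimately show "y \<in> Z'" unfolding Z'_def by blast
  next
    fix y assume "y \<in> Z'"
    then obtain a b where ab: "a \<in> H' \<inter> B.cyc (\<sigma> v)" "b \<in> H' \<inter> B.cyc (\<sigma> w)" "y = a \<otimes>\<^bsub>G'\<^esub> b" unfolding Z'_def by blast
    then have "a \<in> \<phi> ` (H \<inter> A.cyc v)" "b \<in> \<phi> ` (H \<inter> A.cyc w)" using \<sigma>_image v by auto
    then obtain c d where cd: "a = \<phi> c" "c \<in> H \<inter> A.cyc v" "b = \<phi> d" "d \<in> H \<inter> A.cyc w" by blast
    then have "y = \<phi> (c \<otimes>\<^bsub>G\<^esub> d)" using ab(3) mult by simp
    moreover have "c \<otimes>\<^bsub>G\<^esub> d \<in> Z" unfolding Z_def using cd by blast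
    ultimately show "y \<in> \<phi> ` Z" by blast
  qed
  have ZU: "Z \<subseteq> U" "U \<subseteq> H" using e(3) by (auto simp: U_def)
  have sU: "subgroup U G" unfolding U_def using v by (intro A.subgroups_Inter_pair A.H(1) A.Cent_subgroup) auto
  have index: "A.index Z U = B.index Z' U'"
  proof -
    have "card ((\<lambda>u. Z #>\<^bsub>G\<^esub> u) ` U) = card ((\<lambda>u. Z' #>\<^bsub>G'\<^esub> \<phi> u) ` U)"
    proof (rule card_image_same_kernel(1))
      fix a b assume ab: "a \<in> U" "b \<in> U"
      then have h: "a \<in> H" "b \<in> H" using ZU by auto
      moreover from this have "inv\<^bsub>G\<^esub> b \<in> H" by (intro subgroup.m_inv_closed[OF A.H(1)])
      moreover from calculation have "a \<otimes>\<^bsub>G\<^esub> inv\<^bsub>G\<^esub> b \<in> H" by (intro subgroup.m_closed[OF A.H(1)])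
      ultimately have h: "a \<in> H" "b \<in> H" "inv\<^bsub>G\<^esub> b \<in> H" "a \<otimes>\<^bsub>G\<^esub> inv\<^bsub>G\<^esub> b \<in> H" by blast+
      have "Z #>\<^bsub>G\<^esub> a = Z #>\<^bsub>G\<^esub> b \<longleftrightarrow> a \<otimes>\<^bsub>G\<^esub> inv\<^bsub>G\<^esub> b \<in> Z"
        using h A.H_carrier by (intro A.rcos_eq_iff[OF e(2)]) auto
      also have "\<dots> \<longleftrightarrow> \<phi> (a \<otimes>\<^bsub>G\<^esub> inv\<^bsub>G\<^esub> b) \<in> Z'"
        unfolding ZZ[symmetric] using inj_on_image_mem_iff[OF injH h(4)] ZU by auto
      also have "\<dots> \<longleftrightarrow> \<phi> a \<otimes>\<^bsub>G'\<^esub> inv\<^bsub>G'\<^esub> (\<phi> b) \<in> Z'" using h by (simp add: mult \<phi>_inv)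
      also have "\<dots> \<longleftrightarrow> Z' #>\<^bsub>G'\<^esub> \<phi> a = Z' #>\<^bsub>G'\<^esub> \<phi> b"
        using h \<phi>_in B.H_carrier by (intro B.rcos_eq_iff[OF e'(2), symmetric]) auto
      finally show "(Z #>\<^bsub>G\<^esub> a = Z #>\<^bsub>G\<^esub> b) = (Z' #>\<^bsub>G'\<^esub> \<phi> a = Z' #>\<^bsub>G'\<^esub> \<phi> b)" .
    qed
    then show ?thesis unfolding A.index_def B.index_def UU[symmetric] image_image .
  qed
  have z: "0 < A.centre_index v" "0 < A.centre_index w" using A.centre_index_pos v by auto
  define r where "r = real (A.index Z U)"
  define b where "b = real (A.beta (v, w))"
  have 1: "real (A.centre_index v) * real (A.centre_index w) = b * r"
    using e(1) unfolding b_def r_def by (metis of_nat_mult)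
  have 2: "real (B.centre_index (\<sigma> v)) * real (B.centre_index (\<sigma> w)) = real (B.beta (\<sigma> v, \<sigma> w)) * r"
    using e'(1) index unfolding r_def by (metis of_nat_mult)
  have "0 < b * r" using 1 z by (metis mult_pos_pos of_nat_0_less_iff)
  then have "b \<noteq> 0" "r \<noteq> 0" by auto
  moreover have "\<rho> v * \<rho> w = (real (B.beta (\<sigma> v, \<sigma> w)) * r) / (b * r)"
    unfolding 1[symmetric] 2[symmetric] by (simp add: \<rho>_def)
  ultimately show ?thesis by (simp add: b_def[symmetric])
qed

text \<open>The equivariant bijection \<open>s\<close> maps orbits of \<open>H\<close> to orbits of
  \<open>H'\<close>. By \<open>orbit_sum\<close> both sides are sums over orbits, and
  \<open>eq\<close> says that corresponding orbits carry equal weight.\<close>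

lemma transfer:
  fixes f :: "'a \<times> 'a \<Rightarrow> real" and f' :: "'b \<times> 'b \<Rightarrow> real"
  assumes I: "finite I" "\<And>i. i \<in> I \<Longrightarrow> ob i \<in> carrier G \<times> carrier G"
    "\<And>i j g h. \<lbrakk>i \<in> I; j \<in> I; g \<in> carrier G; h \<in> carrier G; A.cj2 g (ob i) = A.cj2 h (ob j)\<rbrakk> \<Longrightarrow> i = j"
    "Ob = {A.cj2 g (ob i) | g i. g \<in> carrier G \<and> i \<in> I}"
    and I': "finite I'" "\<And>i. i \<in> I' \<Longrightarrow> ob' i \<in> carrier G' \<times> carrier G'"
    "\<And>i j g h. \<lbrakk>i \<in> I'; j \<in> I'; g \<in> carrier G'; h \<in> carrier G'; B.cj2 g (ob' i) = B.cj2 h (ob' j)\<rbrakk> \<Longrightarrow> i = j"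
    "Ob' = {B.cj2 g (ob' i) | g i. g \<in> carrier G' \<and> i \<in> I'}"
    and s: "bij_betw s Ob Ob'" "\<And>h e. h \<in> H \<Longrightarrow> e \<in> Ob \<Longrightarrow> s (A.cj2 h e) = B.cj2 (\<phi> h) (s e)"
    and inv: "\<And>h e. h \<in> H \<Longrightarrow> e \<in> Ob \<Longrightarrow> f (A.cj2 h e) = f e" "\<And>h e. h \<in> H' \<Longrightarrow> e \<in> Ob' \<Longrightarrow> f' (B.cj2 h e) = f' e"
    and eq: "\<And>e. e \<in> Ob \<Longrightarrow> real (A.beta e) * f e = real (B.beta (s e)) * f' (s e)"
  shows "(\<Sum>i\<in>I. \<Sum>x\<in>rcosets\<^bsub>G\<^esub> H. f (A.cj2 (A.rep x) (ob i))) = (\<Sum>i\<in>I'. \<Sum>x\<in>rcosets\<^bsub>G'\<^esub> H'. f' (B.cj2 (B.rep x) (ob' i)))"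
proof -
  obtain W where W: "(\<Sum>i\<in>I. \<Sum>x\<in>rcosets\<^bsub>G\<^esub> H. f (A.cj2 (A.rep x) (ob i))) = sum W (A.orb ` Ob)"
    "\<forall>e\<in>Ob. W (A.orb e) = real (A.beta e) * f e"
  proof -
    have "\<exists>W. (\<Sum>i\<in>I. \<Sum>x\<in>rcosets\<^bsub>G\<^esub> H. f (A.cj2 (A.rep x) (ob i))) = sum W (A.orb ` Ob) \<and>
        (\<forall>e\<in>Ob. W (A.orb e) = real (A.beta e) * f e)"
      by (rule A.orbit_sum; (fact I | fact inv))
    then show ?thesis using that by blast
  qed
  obtain W' where W': "(\<Sum>i\<in>I'. \<Sum>x\<in>rcosets\<^bsub>G'\<^esub> H'. f' (B.cj2 (B.rep x) (ob' i))) = sum W' (B.orb ` Ob')"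
    "\<forall>e\<in>Ob'. W' (B.orb e) = real (B.beta e) * f' e"
  proof -
    have "\<exists>W. (\<Sum>i\<in>I'. \<Sum>x\<in>rcosets\<^bsub>G'\<^esub> H'. f' (B.cj2 (B.rep x) (ob' i))) = sum W (B.orb ` Ob') \<and>
        (\<forall>e\<in>Ob'. W (B.orb e) = real (B.beta e) * f' e)"
      by (rule B.orbit_sum; (fact I' | fact inv))
    then show ?thesis using that by blast
  qed
  have orb: "s ` A.orb e = B.orb (s e)" if e: "e \<in> Ob" for e
  proof (intro equalityI subsetI)
    fix y assume "y \<in> s ` A.orb e"
    then obtain h where "h \<in> H" "y = s (A.cj2 h e)" unfolding A.orb_def by blast
    then have "y = B.cj2 (\<phi> h) (s e)" "\<phi> h \<in> H'" using s(2) e \<phi>_in by auto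
    then show "y \<in> B.orb (s e)" unfolding B.orb_def by blast
  next
    fix y assume "y \<in> B.orb (s e)"
    then obtain h' where h': "h' \<in> H'" "y = B.cj2 h' (s e)" unfolding B.orb_def by blast
    then obtain h where "h \<in> H" "h' = \<phi> h" using bij unfolding bij_betw_def by blast
    then have "y = s (A.cj2 h e)" "A.cj2 h e \<in> A.orb e" using s(2) e h' unfolding A.orb_def by auto
    then show "y \<in> s ` A.orb e" by blast
  qed
  have sub: "A.orb e \<subseteq> Ob" if e: "e \<in> Ob" for e
  proof
    fix d assume "d \<in> A.orb e"
    then obtain h where h: "h \<in> H" "d = A.cj2 h e" unfolding A.orb_def by blast
    obtain g i where g: "g \<in> carrier G" "i \<in> I" "e = A.cj2 g (ob i)" using e unfolding I(4) by blast
    have "d = A.cj2 (h \<otimes>\<^bsub>G\<^esub> g) (ob i)" using h g I(2)[OF g(2)] A.H_carrier[OF h(1)] by (auto simp: A.cj_cj)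
    moreover have "h \<otimes>\<^bsub>G\<^esub> g \<in> carrier G" using h g A.H_carrier by simp
    ultimately show "d \<in> Ob" unfolding I(4) using g(2) by blast
  qed
  have "B.orb ` Ob' = (\<lambda>\<omega>. s ` \<omega>) ` (A.orb ` Ob)"
  proof -
    have "Ob' = s ` Ob" using s(1) by (simp add: bij_betw_def)
    then show ?thesis using orb by (simp add: image_image)
  qed
  moreover have "inj_on (\<lambda>\<omega>. s ` \<omega>) (A.orb ` Ob)"
  proof (rule inj_onI)
    fix x y assume "x \<in> A.orb ` Ob" "y \<in> A.orb ` Ob" "s ` x = s ` y"
    then show "x = y" using inj_on_image_eq_iff[of s Ob x y] s(1) sub unfolding bij_betw_def by blast
  qed
  ultimately have "sum W' (B.orb ` Ob') = sum (W' \<circ> (\<lambda>\<omega>. s ` \<omega>)) (A.orb ` Ob)" by (simp add: sum.reindex)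
  also have "\<dots> = sum W (A.orb ` Ob)"
  proof (rule sum.cong[OF refl])
    fix \<omega> assume "\<omega> \<in> A.orb ` Ob"
    then obtain e where e: "e \<in> Ob" "\<omega> = A.orb e" by blast
    have se: "s e \<in> Ob'" using s(1) e(1) bij_betwE by blast
    show "(W' \<circ> (\<lambda>\<omega>. s ` \<omega>)) \<omega> = W \<omega>" using e orb[OF e(1)] W(2) W'(2) se eq by simp
  qed
  finally show ?thesis using W(1) W'(1) by simp
qed

end

section \<open>Sums over vertices and edges, and the resulting inequality\<close>

context finite_index_tree_raag
begin

lemma centre_index_cj: assumes "v \<in> vertices" "h \<in> H" shows "centre_index (cj G h v) = centre_index v"
proof -
  have c: "v \<in> carrier G" "h \<in> carrier G" using assms H_carrier by auto
  have hi: "inv h \<in> H" using subgroup.m_inv_closed[OF H(1) assms(2)] .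
  have cjH: "cj G h x \<in> H \<longleftrightarrow> x \<in> H" if "x \<in> carrier G" for x
  proof
    assume "cj G h x \<in> H"
    then have "inv h \<otimes> cj G h x \<otimes> h \<in> H" by (intro subgroup.m_closed[OF H(1)] hi assms(2))
    then show "x \<in> H" using c that by (simp add: cj_def m_assoc)
  next
    assume "x \<in> H"
    then show "cj G h x \<in> H" unfolding cj_def by (intro subgroup.m_closed[OF H(1)] hi assms(2))
  qed
  have "card ((\<lambda>k::int. H #> (cj G h v [^] k)) ` UNIV) = card ((\<lambda>k::int. H #> (v [^] k)) ` UNIV)"
  proof (rule card_image_same_kernel(1))
    fix k l :: int
    have "cj G h v [^] k \<otimes> inv (cj G h v [^] l) = cj G h (v [^] (k - l))"
      using c by (simp add: int_pow_diff cj_mult cj_inv cj_int_pow)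
    then show "(H #> (cj G h v [^] k) = H #> (cj G h v [^] l)) = (H #> (v [^] k) = H #> (v [^] l))"
      using c cjH[of "v [^] (k - l)"] by (simp add: rcos_eq_iff[OF H(1)] int_pow_diff)
  qed
  then show ?thesis by (simp add: centre_index_def cyc_def image_image)
qed

lemma edges_eq:
  "{cj2 g (P 0, P i) | g i. g \<in> carrier G \<and> i \<in> {1, 2}} = {e. adj (fst e) (snd e) \<and> vtype (fst e) = 0}"
proof (intro equalityI subsetI)
  fix e assume "e \<in> {cj2 g (P 0, P i) | g i. g \<in> carrier G \<and> i \<in> {1, 2}}"
  then obtain g i where g: "g \<in> carrier G" "i \<in> {1, 2}" "e = cj2 g (P 0, P i)" by blast
  then show "e \<in> {e. adj (fst e) (snd e) \<and> vtype (fst e) = 0}"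
    using P_adj[of i g] vtype_cj[of g 0] by auto
next
  fix e assume "e \<in> {e. adj (fst e) (snd e) \<and> vtype (fst e) = 0}"
  then have e: "adj (fst e) (snd e)" "vtype (fst e) = 0" by auto
  obtain u where u: "u \<in> carrier G" "fst e = cj G u (P (vtype (fst e)))" "snd e = cj G u (P (vtype (snd e)))"
    using adjE(2)[OF e(1)] by blast
  have "vtype (snd e) \<noteq> 0" "vtype (snd e) \<le> 2" using adjE(1)[OF e(1)] e vertices_vtype(1) by (auto simp: adj_def)
  then have t: "vtype (snd e) \<in> {1, 2}" by auto
  have "e = cj2 u (P 0, P (vtype (snd e)))"
    using u(2,3) e(2) by (simp add: prod_eq_iff)
  then show "e \<in> {cj2 g (P 0, P i) | g i. g \<in> carrier G \<and> i \<in> {1, 2}}" using u(1) t by blast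
qed

lemma rep_carrier: "x \<in> rcosets H \<Longrightarrow> rep x \<in> carrier G"
  using rep by blast

end

context commensuration
begin

lemma \<rho>_cj: assumes "v \<in> A.vertices" "h \<in> H" shows "\<rho> (cj G h v) = \<rho> v"
  unfolding \<rho>_def using A.centre_index_cj[OF assms] B.centre_index_cj[OF \<sigma>_vertices[OF assms(1)] \<phi>_in[OF assms(2)]] \<sigma>_equivariant[OF assms] by simp

lemma type_cj: assumes "v \<in> A.vertices" "h \<in> H" shows "B.vtype (\<sigma> (cj G h v)) = B.vtype (\<sigma> v)"
  using \<sigma>_equivariant[OF assms] B.cj_vertices(2)[OF \<sigma>_vertices[OF assms(1)] B.H_carrier[OF \<phi>_in[OF assms(2)]]] by simp

lemma P_vertices: "g \<in> carrier G \<Longrightarrow> i \<le> 2 \<Longrightarrow> cj G g (P i) \<in> A.vertices"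
  by (rule A.verticesI)

text \<open>The number R_ij of the argument: the total weight \<open>\<rho>\<close> of the type
  \<open>i\<close> vertices that go to type \<open>j\<close>.\<close>

definition type_sum where
  "type_sum i j = (\<Sum>x\<in>rcosets\<^bsub>G\<^esub> H. if B.vtype (\<sigma> (cj G (A.rep x) (P i))) = j then \<rho> (cj G (A.rep x) (P i)) else 0)"

lemma type_sum_nonneg: "i \<le> 2 \<Longrightarrow> 0 \<le> type_sum i j"
  unfolding type_sum_def by (intro sum_nonneg) (use P_vertices A.rep_carrier \<rho>_pos in \<open>auto intro: less_imp_le\<close>)

text \<open>\<open>transfer\<close> is applied to the relation of \<open>vertex_ratio\<close>,
  restricted to vertices with image of type \<open>j\<close>. On the right the summand is the
  constant \<open>m' j\<close>, so only the number of cosets remains.\<close>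

lemma vertex_count:
  assumes "j \<le> 2"
  shows "real (m 0) * type_sum 0 j + real (m 1) * type_sum 1 j + real (m 2) * type_sum 2 j = real (m' j) * real (card (rcosets\<^bsub>G'\<^esub> H'))"
proof -
  define Ob where "Ob = {(v, v) | v. v \<in> A.vertices}"
  define Ob' where "Ob' = {(v, v) | v. v \<in> B.vertices}"
  define s where "s e = (\<sigma> (fst e), \<sigma> (snd e))" for e
  define f where "f e = (if B.vtype (\<sigma> (fst e)) = j then real (m (A.vtype (fst e))) * \<rho> (fst e) else 0)" for e :: "'a \<times> 'a"
  define f' where "f' e = (if B.vtype (fst e) = j then real (m' j) else 0)" for e :: "'b \<times> 'b"
  have eq: "(\<Sum>i\<in>{..2}. \<Sum>x\<in>rcosets\<^bsub>G\<^esub> H. f (A.cj2 (A.rep x) (P i, P i))) = (\<Sum>i\<in>{..2}. \<Sum>x\<in>rcosets\<^bsub>G'\<^esub> H'. f' (B.cj2 (B.rep x) (P' i, P' i)))"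
  proof (rule transfer[where Ob = Ob and Ob' = Ob' and s = s])
    show "finite {..2::nat}" "finite {..2::nat}" by simp_all
    show "(P i, P i) \<in> carrier G \<times> carrier G" if "i \<in> {..2}" for i using that A.P_carrier by auto
    show "(P' i, P' i) \<in> carrier G' \<times> carrier G'" if "i \<in> {..2}" for i using that B.P_carrier by auto
    show "i = j" if "i \<in> {..2}" "j \<in> {..2}" "g \<in> carrier G" "h \<in> carrier G" "A.cj2 g (P i, P i) = A.cj2 h (P j, P j)" for i j g h
      using A.vtype_cj[of g i] A.vtype_cj[of h j] that by auto
    show "i = j" if "i \<in> {..2}" "j \<in> {..2}" "g \<in> carrier G'" "h \<in> carrier G'" "B.cj2 g (P' i, P' i) = B.cj2 h (P' j, P' j)" for i j g h
      using B.vtype_cj[of g i] B.vtype_cj[of h j] that by auto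
    show "Ob = {A.cj2 g (P i, P i) | g i. g \<in> carrier G \<and> i \<in> {..2}}" unfolding Ob_def A.vertices_def by auto
    show "Ob' = {B.cj2 g (P' i, P' i) | g i. g \<in> carrier G' \<and> i \<in> {..2}}" unfolding Ob'_def B.vertices_def by auto
    show "bij_betw s Ob Ob'" unfolding bij_betw_def
    proof
      show "inj_on s Ob" by (rule inj_onI) (auto simp: s_def Ob_def dest: \<sigma>_inj)
      show "s ` Ob = Ob'"
      proof (intro equalityI subsetI)
        fix e assume "e \<in> s ` Ob"
        then show "e \<in> Ob'" using \<sigma>_vertices by (auto simp: s_def Ob_def Ob'_def)
      next
        fix e assume "e \<in> Ob'"
        then obtain v' where v': "v' \<in> B.vertices" "e = (v', v')" unfolding Ob'_def by blast
        then obtain v where "v \<in> A.vertices" "\<sigma> v = v'" using \<sigma>_surj by blast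
        then have "e = s (v, v)" "(v, v) \<in> Ob" using v' by (auto simp: s_def Ob_def)
        then show "e \<in> s ` Ob" by blast
      qed
    qed
    show "s (A.cj2 h e) = B.cj2 (\<phi> h) (s e)" if "h \<in> H" "e \<in> Ob" for h e
      using that \<sigma>_equivariant by (auto simp: s_def Ob_def)
    show "f (A.cj2 h e) = f e" if "h \<in> H" "e \<in> Ob" for h e
      using that type_cj \<rho>_cj A.cj_vertices(2) A.H_carrier by (auto simp: f_def Ob_def)
    show "f' (B.cj2 h e) = f' e" if "h \<in> H'" "e \<in> Ob'" for h e
      using that B.cj_vertices(2) B.H_carrier by (auto simp: f'_def Ob'_def)
    show "real (A.beta e) * f e = real (B.beta (s e)) * f' (s e)" if e: "e \<in> Ob" for e
    proof -
      obtain v where v: "v \<in> A.vertices" "e = (v, v)" using e unfolding Ob_def by blast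
      then show ?thesis using vertex_ratio[OF v(1)] by (simp add: f_def f'_def s_def)
    qed
  qed
  have "(\<Sum>x\<in>rcosets\<^bsub>G\<^esub> H. f (A.cj2 (A.rep x) (P i, P i))) = real (m i) * type_sum i j" if "i \<le> 2" for i
    unfolding type_sum_def sum_distrib_left
    by (rule sum.cong[OF refl]) (use that A.vtype_cj[OF A.rep_carrier] in \<open>simp add: f_def\<close>)
  then have L: "(\<Sum>i\<in>{..2}. \<Sum>x\<in>rcosets\<^bsub>G\<^esub> H. f (A.cj2 (A.rep x) (P i, P i))) = (\<Sum>i\<in>{..2}. real (m i) * type_sum i j)"
    by (intro sum.cong) auto
  have "(\<Sum>x\<in>rcosets\<^bsub>G'\<^esub> H'. f' (B.cj2 (B.rep x) (P' i, P' i))) = (if i = j then real (m' j) * real (card (rcosets\<^bsub>G'\<^esub> H')) else 0)" if "i \<le> 2" for i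
  proof -
    have "(\<Sum>x\<in>rcosets\<^bsub>G'\<^esub> H'. f' (B.cj2 (B.rep x) (P' i, P' i))) = (\<Sum>x\<in>rcosets\<^bsub>G'\<^esub> H'. if i = j then real (m' j) else 0)"
      by (rule sum.cong[OF refl]) (use that B.vtype_cj[OF B.rep_carrier] in \<open>simp add: f'_def\<close>)
    then show ?thesis by simp
  qed
  then have R: "(\<Sum>i\<in>{..2}. \<Sum>x\<in>rcosets\<^bsub>G'\<^esub> H'. f' (B.cj2 (B.rep x) (P' i, P' i))) = (\<Sum>i\<in>{..2}. if i = j then real (m' j) * real (card (rcosets\<^bsub>G'\<^esub> H')) else 0)"
    by (intro sum.cong) auto
  also have "\<dots> = real (m' j) * real (card (rcosets\<^bsub>G'\<^esub> H'))" using assms by (simp add: sum.delta)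
  finally have "(\<Sum>i\<in>{..2}. real (m i) * type_sum i j) = real (m' j) * real (card (rcosets\<^bsub>G'\<^esub> H'))" using eq L by simp
  moreover have "{..2::nat} = {0, 1, 2}" by auto
  ultimately show ?thesis by (simp add: add.assoc)
qed

text \<open>The weight of the end of the edge that goes to a branch vertex, provided the image has
  type \<open>j\<close>. The case distinction covers the possibility that \<open>\<sigma>\<close>
  exchanges centres with branch vertices.\<close>

definition edge_weight where
  "edge_weight j e = (if B.vtype (\<sigma> (fst e)) = 0 then (if B.vtype (\<sigma> (snd e)) = j then \<rho> (snd e) else 0)
     else (if B.vtype (\<sigma> (fst e)) = j then \<rho> (fst e) else 0))"

text \<open>The common value of all edge sums; its summands refer to the centres of the second tree
  only, which is why \<open>j\<close> does not occur.\<close>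

definition centre_sum where
  "centre_sum = (\<Sum>x\<in>rcosets\<^bsub>G'\<^esub> H'. 1 / \<rho> (inv_into A.vertices \<sigma> (cj G' (B.rep x) (P' 0))))"

lemma \<sigma>_bij: "bij_betw \<sigma> A.vertices B.vertices"
  unfolding bij_betw_def using \<sigma>_inj \<sigma>_vertices \<sigma>_surj by (auto simp: inj_on_def image_iff) metis

lemma inv_\<sigma>: "v \<in> A.vertices \<Longrightarrow> inv_into A.vertices \<sigma> (\<sigma> v) = v" "v' \<in> B.vertices \<Longrightarrow> inv_into A.vertices \<sigma> v' \<in> A.vertices"
  "v' \<in> B.vertices \<Longrightarrow> \<sigma> (inv_into A.vertices \<sigma> v') = v'"
  using \<sigma>_bij by (auto simp: bij_betw_def inv_into_f_f inv_into_into f_inv_into_f)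

text \<open>Dividing \<open>edge_ratio\<close> by the weight of the end that goes to a centre leaves
  the weight of the other end on the left and a quantity depending only on the central end on the
  right. The edges of a fixed type \<open>j\<close> are indexed by group elements just as the
  centres are, so their sum does not depend on \<open>j\<close>.\<close>

lemma edge_count:
  assumes j: "j \<in> {1, 2}"
  shows "(\<Sum>i\<in>{1,2}. \<Sum>x\<in>rcosets\<^bsub>G\<^esub> H. edge_weight j (A.cj2 (A.rep x) (P 0, P i))) = centre_sum"
proof -
  define Ob where "Ob = {e. A.adj (fst e) (snd e) \<and> A.vtype (fst e) = 0}"
  define Ob' where "Ob' = {e. B.adj (fst e) (snd e) \<and> B.vtype (fst e) = 0}"
  \<comment> \<open>Edges are oriented from the central end, so the image has to be turned round
    when \<open>\<sigma>\<close> exchanges the two classes.\<close>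
  define s where "s e = (if B.vtype (\<sigma> (fst e)) = 0 then (\<sigma> (fst e), \<sigma> (snd e)) else (\<sigma> (snd e), \<sigma> (fst e)))" for e
  define f' where "f' e = (if B.vtype (snd e) = j then 1 / \<rho> (inv_into A.vertices \<sigma> (fst e)) else 0)" for e :: "'b \<times> 'b"
  have ObVt: "fst e \<in> A.vertices" "snd e \<in> A.vertices" "A.adj (fst e) (snd e)" "A.vtype (fst e) = 0" "A.vtype (snd e) \<noteq> 0" if "e \<in> Ob" for e
    using that A.adjE(1)[of "fst e" "snd e"] by (auto simp: Ob_def A.adj_def)
  have ObVt': "fst e \<in> B.vertices" "snd e \<in> B.vertices" "B.adj (fst e) (snd e)" "B.vtype (fst e) = 0" "B.vtype (snd e) \<noteq> 0" if "e \<in> Ob'" for e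
    using that B.adjE(1)[of "fst e" "snd e"] by (auto simp: Ob'_def B.adj_def)
  have adj_sym: "B.adj a b \<Longrightarrow> B.adj b a" "A.adj c d \<Longrightarrow> A.adj d c" for a b c d
    by (auto simp: B.adj_def A.adj_def B.com_sym A.com_sym)
  have eq: "(\<Sum>i\<in>{1,2}. \<Sum>x\<in>rcosets\<^bsub>G\<^esub> H. edge_weight j (A.cj2 (A.rep x) (P 0, P i))) =
      (\<Sum>i\<in>{1,2}. \<Sum>x\<in>rcosets\<^bsub>G'\<^esub> H'. f' (B.cj2 (B.rep x) (P' 0, P' i)))"
  proof (rule transfer[where Ob = Ob and Ob' = Ob' and s = s])
    show "finite {1, 2::nat}" "finite {1, 2::nat}" by simp_all
    show "(P 0, P i) \<in> carrier G \<times> carrier G" if "i \<in> {1, 2}" for i using that A.P_carrier by auto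
    show "(P' 0, P' i) \<in> carrier G' \<times> carrier G'" if "i \<in> {1, 2}" for i using that B.P_carrier by auto
    show "i = k" if "i \<in> {1, 2}" "k \<in> {1, 2}" "g \<in> carrier G" "h \<in> carrier G" "A.cj2 g (P 0, P i) = A.cj2 h (P 0, P k)" for i k g h
      using A.vtype_cj[of g i] A.vtype_cj[of h k] that by auto
    show "i = k" if "i \<in> {1, 2}" "k \<in> {1, 2}" "g \<in> carrier G'" "h \<in> carrier G'" "B.cj2 g (P' 0, P' i) = B.cj2 h (P' 0, P' k)" for i k g h
      using B.vtype_cj[of g i] B.vtype_cj[of h k] that by auto
    show "Ob = {A.cj2 g (P 0, P i) | g i. g \<in> carrier G \<and> i \<in> {1, 2}}" unfolding Ob_def A.edges_eq ..
    show "Ob' = {B.cj2 g (P' 0, P' i) | g i. g \<in> carrier G' \<and> i \<in> {1, 2}}" unfolding Ob'_def B.edges_eq ..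
    show "bij_betw s Ob Ob'" unfolding bij_betw_def
    proof
      show "inj_on s Ob"
      proof (rule inj_onI)
        fix e d assume ed: "e \<in> Ob" "d \<in> Ob" "s e = s d"
        note E = ObVt[OF ed(1)]
        note D = ObVt[OF ed(2)]
        have "(\<sigma> (fst e) = \<sigma> (fst d) \<and> \<sigma> (snd e) = \<sigma> (snd d)) \<or> (\<sigma> (fst e) = \<sigma> (snd d) \<and> \<sigma> (snd e) = \<sigma> (fst d))"
          using ed(3) by (auto simp: s_def split: if_splits)
        then show "e = d"
        proof
          assume "\<sigma> (fst e) = \<sigma> (fst d) \<and> \<sigma> (snd e) = \<sigma> (snd d)"
          then show "e = d" using \<sigma>_inj E D by (auto simp: prod_eq_iff)
        next
          assume "\<sigma> (fst e) = \<sigma> (snd d) \<and> \<sigma> (snd e) = \<sigma> (fst d)"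
          then have "fst e = snd d" using \<sigma>_inj E D by blast
          then show "e = d" using E D by simp
        qed
      qed
      show "s ` Ob = Ob'"
      proof (intro equalityI subsetI)
        fix e' assume "e' \<in> s ` Ob"
        then obtain e where e: "e \<in> Ob" "e' = s e" by blast
        have a: "B.adj (\<sigma> (fst e)) (\<sigma> (snd e))" using \<sigma>_adj ObVt[OF e(1)] by blast
        then have "(B.vtype (\<sigma> (fst e)) = 0) \<noteq> (B.vtype (\<sigma> (snd e)) = 0)" by (rule B.adjE(1))
        then show "e' \<in> Ob'" unfolding e(2) using a adj_sym(1)[OF a] by (auto simp: s_def Ob'_def)
      next
        fix e' assume e': "e' \<in> Ob'"
        define v where "v = inv_into A.vertices \<sigma> (fst e')"
        define w where "w = inv_into A.vertices \<sigma> (snd e')"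
        have vw: "v \<in> A.vertices" "w \<in> A.vertices" "\<sigma> v = fst e'" "\<sigma> w = snd e'"
          using inv_\<sigma> ObVt'[OF e'] by (auto simp: v_def w_def)
        have a: "A.adj v w" using \<sigma>_adj[OF vw(1,2)] vw ObVt'[OF e'] by simp
        show "e' \<in> s ` Ob"
        proof (cases "A.vtype v = 0")
          case True
          then have "(v, w) \<in> Ob" "s (v, w) = e'" using a vw ObVt'[OF e'] by (auto simp: Ob_def s_def)
          then show ?thesis by (metis image_eqI)
        next
          case False
          then have "A.vtype w = 0" using A.adjE(1)[OF a] by simp
          then have "(w, v) \<in> Ob" "s (w, v) = e'" using adj_sym(2)[OF a] vw ObVt'[OF e'] by (auto simp: Ob_def s_def)
          then show ?thesis by (metis image_eqI)
        qed
      qed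
    qed
    show "s (A.cj2 h e) = B.cj2 (\<phi> h) (s e)" if "h \<in> H" "e \<in> Ob" for h e
      using that ObVt[OF that(2)] \<sigma>_equivariant type_cj by (simp add: s_def)
    show "edge_weight j (A.cj2 h e) = edge_weight j e" if "h \<in> H" "e \<in> Ob" for h e
      using that ObVt[OF that(2)] type_cj \<rho>_cj by (simp add: edge_weight_def)
    show "f' (B.cj2 h' e) = f' e" if h': "h' \<in> H'" and e: "e \<in> Ob'" for h' e
    proof -
      note E = ObVt'[OF e]
      obtain h where h: "h \<in> H" "\<phi> h = h'" using bij h' unfolding bij_betw_def by blast
      define v where "v = inv_into A.vertices \<sigma> (fst e)"
      have v: "v \<in> A.vertices" "\<sigma> v = fst e" using inv_\<sigma> E by (auto simp: v_def)
      have "\<sigma> (cj G h v) = cj G' h' (fst e)" using \<sigma>_equivariant[OF v(1) h(1)] h v by simp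
      then have "inv_into A.vertices \<sigma> (cj G' h' (fst e)) = cj G h v"
        using inv_\<sigma>(1)[OF A.cj_vertices(1)[OF v(1) A.H_carrier[OF h(1)]]] by simp
      then show ?thesis using \<rho>_cj[OF v(1) h(1)] B.cj_vertices(2)[OF E(2) B.H_carrier[OF h']] by (simp add: f'_def v_def)
    qed
    show "real (A.beta e) * edge_weight j e = real (B.beta (s e)) * f' (s e)" if e: "e \<in> Ob" for e
    proof -
      note E = ObVt[OF e]
      have b: "B.beta (b, a) = B.beta (a, b)" for a b by (simp add: B.beta_def Int_commute)
      have ratio: "real (A.beta e) * (\<rho> (fst e) * \<rho> (snd e)) = real (B.beta (\<sigma> (fst e), \<sigma> (snd e)))"
        using edge_ratio[OF E(3)] by simp
      have p: "\<rho> (fst e) \<noteq> 0" "\<rho> (snd e) \<noteq> 0" using \<rho>_pos[OF E(1)] \<rho>_pos[OF E(2)] by auto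
      show ?thesis
        using p by (auto simp: edge_weight_def s_def f'_def inv_\<sigma>(1)[OF E(1)] inv_\<sigma>(1)[OF E(2)] b[of "\<sigma> (snd e)" "\<sigma> (fst e)"] ratio[symmetric])
    qed
  qed
  have "(\<Sum>x\<in>rcosets\<^bsub>G'\<^esub> H'. f' (B.cj2 (B.rep x) (P' 0, P' i))) = (if i = j then centre_sum else 0)" if "i \<in> {1, 2}" for i
  proof -
    have "(\<Sum>x\<in>rcosets\<^bsub>G'\<^esub> H'. f' (B.cj2 (B.rep x) (P' 0, P' i))) =
        (\<Sum>x\<in>rcosets\<^bsub>G'\<^esub> H'. if i = j then 1 / \<rho> (inv_into A.vertices \<sigma> (cj G' (B.rep x) (P' 0))) else 0)"
      by (rule sum.cong[OF refl]) (use that B.vtype_cj[OF B.rep_carrier, of _ i] in \<open>auto simp: f'_def\<close>)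
    then show ?thesis by (simp add: centre_sum_def)
  qed
  then have "(\<Sum>i\<in>{1,2}. \<Sum>x\<in>rcosets\<^bsub>G'\<^esub> H'. f' (B.cj2 (B.rep x) (P' 0, P' i))) = centre_sum" using j by auto
  then show ?thesis using eq by simp
qed

text \<open>Exactly one end of an edge is central, in either tree. So the agreement of centrality
  before and after \<open>\<sigma>\<close> is the same at both ends of an edge, and connectedness
  makes it global.\<close>

lemma swap_dichotomy:
  "(\<forall>v\<in>A.vertices. A.vtype v = 0 \<longleftrightarrow> B.vtype (\<sigma> v) = 0) \<or> (\<forall>v\<in>A.vertices. A.vtype v = 0 \<longleftrightarrow> B.vtype (\<sigma> v) \<noteq> 0)"
proof -
  define R where "R v \<longleftrightarrow> (A.vtype v = 0 \<longleftrightarrow> B.vtype (\<sigma> v) = 0)" for v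
  have step: "R v = R w" if "A.adj v w" for v w
  proof -
    have "B.adj (\<sigma> v) (\<sigma> w)" using that \<sigma>_adj by (simp add: A.adj_def)
    then show ?thesis using A.adjE(1)[OF that] B.adjE(1) by (auto simp: R_def)
  qed
  have "R v = R w" if "v \<in> A.vertices" "w \<in> A.vertices" for v w
    by (rule A.adj_invariant_const[OF step that])
  then have "(\<forall>v\<in>A.vertices. R v) \<or> (\<forall>v\<in>A.vertices. \<not> R v)" by metis
  then show ?thesis unfolding R_def by simp
qed

theorem branch_inequality:
  assumes "m 1 \<le> m 2" shows "m' 2 * m 1 \<le> m' 1 * m 2"
proof -
  define N where "N = real (card (rcosets\<^bsub>G'\<^esub> H'))"
  have "rcosets\<^bsub>G'\<^esub> H' \<noteq> {}" using B.rcosetsI[OF subgroup.subset[OF B.H(1)] B.one_closed] by blast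
  then have N: "0 < N" using B.H(2) by (simp add: N_def card_gt_0_iff)
  note vc = vertex_count[folded N_def]
  have cjP: "cj G (A.rep x) (P i) \<in> A.vertices" "A.vtype (cj G (A.rep x) (P i)) = i" if "x \<in> rcosets\<^bsub>G\<^esub> H" "i \<le> 2" for x i
    using that A.rep_carrier P_vertices A.vtype_cj by auto
  show ?thesis
    using swap_dichotomy
  proof
    assume S: "\<forall>v\<in>A.vertices. A.vtype v = 0 \<longleftrightarrow> B.vtype (\<sigma> v) = 0"
    have r0: "type_sum 0 j = 0" if "j \<in> {1, 2}" for j
      unfolding type_sum_def by (rule sum.neutral) (use S cjP[of _ 0] that in auto)
    have C: "type_sum 1 j + type_sum 2 j = centre_sum" if "j \<in> {1, 2}" for j
    proof -
      have "(\<Sum>x\<in>rcosets\<^bsub>G\<^esub> H. edge_weight j (A.cj2 (A.rep x) (P 0, P i))) = type_sum i j" if "i \<in> {1, 2}" for i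
        unfolding type_sum_def by (rule sum.cong[OF refl]) (use S cjP[of _ 0] in \<open>auto simp: edge_weight_def\<close>)
      then show ?thesis using edge_count[OF that] by simp
    qed
    have nn: "0 \<le> type_sum 1 1" "0 \<le> type_sum 2 1" "0 \<le> type_sum 1 2" "0 \<le> type_sum 2 2" using type_sum_nonneg by auto
    have 1: "real (m 1) * type_sum 1 1 + real (m 2) * type_sum 2 1 = real (m' 1) * N" using vc[of 1] r0[of 1] by simp
    have 2: "real (m 1) * type_sum 1 2 + real (m 2) * type_sum 2 2 = real (m' 2) * N" using vc[of 2] r0[of 2] by simp
    have m12: "real (m 1) \<le> real (m 2)" using assms by simp
    \<comment> \<open>How \<open>centre_sum\<close> is divided between types 1 and 2 is unknown, but
      each vertex sum lies between \<open>m 1\<close> and \<open>m 2\<close> times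
      \<open>centre_sum\<close>. The lower bound is used for \<open>j = 1\<close>, the upper one for
      \<open>j = 2\<close>, and \<open>centre_sum\<close> is eliminated.\<close>
    have "real (m 1) * (type_sum 1 1 + type_sum 2 1) \<le> real (m 1) * type_sum 1 1 + real (m 2) * type_sum 2 1"
      using mult_right_mono[OF m12 nn(2)] by (simp add: distrib_left)
    then have lo: "real (m 1) * centre_sum \<le> real (m' 1) * N" using 1 C[of 1] by simp
    have "real (m 1) * type_sum 1 2 + real (m 2) * type_sum 2 2 \<le> real (m 2) * (type_sum 1 2 + type_sum 2 2)"
      using mult_right_mono[OF m12 nn(3)] by (simp add: distrib_left)
    then have hi: "real (m' 2) * N \<le> real (m 2) * centre_sum" using 2 C[of 2] by simp
    have "real (m' 2) * real (m 1) * N = real (m 1) * (real (m' 2) * N)" by simp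
    also have "\<dots> \<le> real (m 1) * (real (m 2) * centre_sum)" using hi by (intro mult_left_mono) auto
    also have "\<dots> = real (m 2) * (real (m 1) * centre_sum)" by simp
    also have "\<dots> \<le> real (m 2) * (real (m' 1) * N)" using lo by (intro mult_left_mono) auto
    also have "\<dots> = real (m' 1) * real (m 2) * N" by simp
    finally have "real (m' 2) * real (m 1) \<le> real (m' 1) * real (m 2)" using N by simp
    then show ?thesis by (metis of_nat_le_iff of_nat_mult)
  next
    assume S: "\<forall>v\<in>A.vertices. A.vtype v = 0 \<longleftrightarrow> B.vtype (\<sigma> v) \<noteq> 0"
    have r0: "type_sum i j = 0" if ij: "i \<in> {1, 2}" "j \<in> {1, 2}" for i j
      unfolding type_sum_def
    proof (rule sum.neutral, rule ballI)
      fix x assume x: "x \<in> rcosets\<^bsub>G\<^esub> H"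
      have i: "i \<le> 2" "i \<noteq> 0" using ij by auto
      have "B.vtype (\<sigma> (cj G (A.rep x) (P i))) = 0" using S cjP[OF x i(1)] i(2) by metis
      then show "(if B.vtype (\<sigma> (cj G (A.rep x) (P i))) = j then \<rho> (cj G (A.rep x) (P i)) else 0) = 0"
        using ij by auto
    qed
    \<comment> \<open>In the exchanged case both kinds of edges take their weight from the central
      end, so the edge sum is twice the same sum over centres.\<close>
    have C: "type_sum 0 j + type_sum 0 j = centre_sum" if "j \<in> {1, 2}" for j
    proof -
      have "(\<Sum>x\<in>rcosets\<^bsub>G\<^esub> H. edge_weight j (A.cj2 (A.rep x) (P 0, P i))) = type_sum 0 j" if "i \<in> {1, 2}" for i
        unfolding type_sum_def
      proof (rule sum.cong[OF refl])
        fix x assume x: "x \<in> rcosets\<^bsub>G\<^esub> H"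
        have "B.vtype (\<sigma> (cj G (A.rep x) (P 0))) \<noteq> 0" using S cjP[OF x, of 0] by simp
        then show "edge_weight j (A.cj2 (A.rep x) (P 0, P i)) =
            (if B.vtype (\<sigma> (cj G (A.rep x) (P 0))) = j then \<rho> (cj G (A.rep x) (P 0)) else 0)"
          by (simp add: edge_weight_def)
      qed
      then show ?thesis using edge_count[OF that] by simp
    qed
    have e: "type_sum 0 1 = type_sum 0 2" using C[of 1] C[of 2] by simp
    have 1: "real (m 0) * type_sum 0 1 = real (m' 1) * N" using vc[of 1] r0[of 1 1] r0[of 2 1] by simp
    have 2: "real (m 0) * type_sum 0 2 = real (m' 2) * N" using vc[of 2] r0[of 1 2] r0[of 2 2] by simp
    have "real (m' 1) * N = real (m' 2) * N" unfolding 1[symmetric] 2[symmetric] e ..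
    then have "m' 1 = m' 2" using N by simp
    then show ?thesis using assms by simp
  qed
qed

end

section \<open>Commensurable groups of trees of diameter four\<close>

lemma commensurable_ratio:
  fixes m1 m2 n1 n2 :: nat
  assumes pos: "0 < m1" "m1 \<le> m2" "0 < n1" "n1 \<le> n2" and c: "commensurable (RAAG_P m1 m2) (RAAG_P n1 n2)"
  shows "m1 * n2 = m2 * n1"
proof -
  interpret M: P_raag m1 m2 "RAAG_P m1 m2" by unfold_locales (use pos in auto)
  interpret N: P_raag n1 n2 "RAAG_P n1 n2" by unfold_locales (use pos in auto)
  obtain A B \<phi> where A: "subgroup A (RAAG_P m1 m2)" "finite (rcosets\<^bsub>RAAG_P m1 m2\<^esub> A)"
    and B: "subgroup B (RAAG_P n1 n2)" "finite (rcosets\<^bsub>RAAG_P n1 n2\<^esub> B)"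
    and \<phi>: "\<phi> \<in> iso (RAAG_P m1 m2\<lparr>carrier := A\<rparr>) (RAAG_P n1 n2\<lparr>carrier := B\<rparr>)"
    using c unfolding commensurable_def is_iso_def by blast
  have MA: "finite_index_tree_raag (RAAG_P m1 m2) M.gen A M.brank"
    by (intro finite_index_tree_raag.intro finite_index_tree_raag_axioms.intro M.P_tree_raag A M.branch_rank)
  have NB: "finite_index_tree_raag (RAAG_P n1 n2) N.gen B N.brank"
    by (intro finite_index_tree_raag.intro finite_index_tree_raag_axioms.intro N.P_tree_raag B N.branch_rank)
  interpret V: commensuration "RAAG_P m1 m2" M.gen A M.brank "RAAG_P n1 n2" N.gen B N.brank \<phi>
    using \<phi> by (intro commensuration.intro commensuration_axioms.intro MA NB) (auto simp: iso_def hom_def)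
  interpret W: commensuration "RAAG_P n1 n2" N.gen B N.brank "RAAG_P m1 m2" M.gen A M.brank "inv_into A \<phi>"
    by (rule V.swap)
  have b: "M.brank 1 = m1" "M.brank 2 = m2" "N.brank 1 = n1" "N.brank 2 = n2"
    by (simp_all add: M.brank_def N.brank_def)
  have "n2 * m1 \<le> n1 * m2" using V.branch_inequality unfolding b using pos by blast
  moreover have "m2 * n1 \<le> m1 * n2" using W.branch_inequality unfolding b using pos by blast
  ultimately show ?thesis by (simp add: mult.commute)
qed

theorem mainTheorem3:
  shows "(\<forall>m1 m2 n1 n2 :: nat.
            0 < m1 \<and> m1 \<le> m2 \<and> 0 < n1 \<and> n1 \<le> n2 \<and>
            commensurable (RAAG_P m1 m2) (RAAG_P n1 n2)
            \<longrightarrow> real m1 / real n1 = real m2 / real n2)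
       \<and> (\<exists>S :: (nat \<times> nat) set. infinite S \<and>
            (\<forall>(d1, d2) \<in> S. 0 < d1 \<and> d1 \<le> d2) \<and>
            (\<forall>(d1, d2) \<in> S. \<forall>(e1, e2) \<in> S. (d1, d2) \<noteq> (e1, e2) \<longrightarrow>
                \<not> commensurable (RAAG_P d1 d2) (RAAG_P e1 e2)))"
proof
  show "\<forall>m1 m2 n1 n2 :: nat.
            0 < m1 \<and> m1 \<le> m2 \<and> 0 < n1 \<and> n1 \<le> n2 \<and>
            commensurable (RAAG_P m1 m2) (RAAG_P n1 n2)
            \<longrightarrow> real m1 / real n1 = real m2 / real n2"
  proof (intro allI impI)
    fix m1 m2 n1 n2 :: nat
    assume *: "0 < m1 \<and> m1 \<le> m2 \<and> 0 < n1 \<and> n1 \<le> n2 \<and> commensurable (RAAG_P m1 m2) (RAAG_P n1 n2)"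
    then have "m1 * n2 = m2 * n1" by (intro commensurable_ratio) auto
    then have "real m1 * real n2 = real m2 * real n1" by (metis of_nat_mult)
    then show "real m1 / real n1 = real m2 / real n2" using * by (simp add: field_simps)
  qed
  \<comment> \<open>With first parameter 1 the relation m_1 n_2 = m_2 n_1 forces equal second
    parameters, so these trees are pairwise incommensurable.\<close>
  have inj: "inj (\<lambda>k::nat. (1::nat, Suc k))" by (simp add: inj_def)
  have "infinite (range (\<lambda>k::nat. (1::nat, Suc k)))" using inj finite_imageD infinite_UNIV_nat by blast
  moreover have "\<not> commensurable (RAAG_P 1 (Suc k)) (RAAG_P 1 (Suc l))" if "k \<noteq> l" for k l
    using commensurable_ratio[of 1 "Suc k" 1 "Suc l"] that by auto
  ultimately show "\<exists>S :: (nat \<times> nat) set. infinite S \<and>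
            (\<forall>(d1, d2) \<in> S. 0 < d1 \<and> d1 \<le> d2) \<and>
            (\<forall>(d1, d2) \<in> S. \<forall>(e1, e2) \<in> S. (d1, d2) \<noteq> (e1, e2) \<longrightarrow>
                \<not> commensurable (RAAG_P d1 d2) (RAAG_P e1 e2))"
    by (intro exI[of _ "range (\<lambda>k::nat. (1::nat, Suc k))"]) auto
qed

end
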